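(* Let $n>1$ and $d\ge 2$ be integers, let $r\in\{1,-1\}$ with $n\equiv r \pmod d$, let $c,e$ be indeterminates, and let $W=(n-r)/d$ or $W=n-1$. Then, modulo $[n]\Phi_n(q)^3$, \begin{align*} &\sum_{k=0}^W[2dk+r]\frac{\left(q^r;q^d\right)^4_k\left(cq^r,eq^r;q^d\right)_k}{{\left(q^d;q^d\right)^4_k} \left(q^d/c,q^d/e;q^d\right)_k}(ce)^{-k}q^{(2d-3r)k}\\ &\equiv[n]\frac{q^{r(r-n)/d}}{\left(q^d;q^d\right)_{(n-r)/d}}\left (1-[n]^2\sum_{i=1}^{(n-r)/d}\frac{q^{di}}{[di]^2}\right) \sum_{k=0}^{(n-r)/d}\frac{\left(q^{2r+dk};q^d\right)_{(n-r)/d-k}(q^{d-r}/(ce);q^d)_k\left(q^{r};q^d\right)^3_k} {\left(q^d/c,q^d/e,q^d;q^d\right)_k}q^{dk}. \end{align*}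
   Context: $q$ is an indeterminate. The $q$-shifted factorial is $(a;q)_0=1$, $(a;q)_m=(1-a)(1-aq)\cdots(1-aq^{m-1})$ for positive integers $m$, and $(a_1,\dots,a_s;q)_m=(a_1;q)_m\cdots(a_s;q)_m$; $(a;q)_m^j$ means $((a;q)_m)^j$. For an integer $m$, $[m]=(1-q^m)/(1-q)$. $\Phi_n(q)$ is the $n$-th cyclotomic polynomial. For rational functions $A,B$ in $q$ and the parameters, and a polynomial $P$ in $q$, $A\equiv B \pmod P$ means that $A-B=P\cdot F/G$ with $F,G$ polynomials and $G$ coprime to $P$. *)

theory Defs
  imports "HOL-Computational_Algebra.Computational_Algebra"
begin

text \<open>Cyclotomic polynomials over the rationals, via the defining identity
  x^n - 1 = prod over d dvd n of Phi_d(x), i.e. Phi_n = (x^n - 1) div prod_{d | n, d < n} Phi_d.\<close>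
function cyclotomic :: "nat \<Rightarrow> rat poly" where
  "cyclotomic n = (if n = 0 then 1 else
     (monom 1 n - 1) div (\<Prod>d\<in>{d\<in>{..<n}. d dvd n}. cyclotomic d))"
  by auto
termination by (relation "measure id") auto

text \<open>Ground ring: polynomials in q with coefficients in Q[e][c], i.e. Q[c,e,q]
  (outermost variable q, middle variable e, innermost variable c).\<close>
type_synonym R = "rat poly poly poly"
type_synonym K = "R fract"

definition rpoly_q :: "rat poly \<Rightarrow> R" where
  "rpoly_q p = map_poly (\<lambda>a. [:[:a:]:]) p"

definition qvar :: K where "qvar = Fract [:0, 1:] 1"
definition evar :: K where "evar = Fract [:[:0, 1:]:] 1"
definition cvar :: K where "cvar = Fract [:[:[:0, 1:]:]:] 1"

definition qpoch :: "K \<Rightarrow> K \<Rightarrow> nat \<Rightarrow> K" where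
  "qpoch a b m = (\<Prod>j<m. 1 - a * b ^ j)"

definition qint :: "int \<Rightarrow> K" where
  "qint m = (1 - qvar powi m) / (1 - qvar)"

definition qint_poly :: "nat \<Rightarrow> rat poly" where
  "qint_poly n = (\<Sum>i<n. monom 1 i)"

definition qcong :: "K \<Rightarrow> K \<Rightarrow> R \<Rightarrow> bool" where
  "qcong A B P \<longleftrightarrow> (\<exists>F G. G \<noteq> 0 \<and> coprime G P \<and> A - B = Fract (P * F) G)"

end

theory Submission
  imports Defs "HOL-Computational_Algebra.Field_as_Ring"
begin

text \<open>
  Write \<open>a = q\<^sup>r\<close>, \<open>p = q\<^sup>d\<close>, \<open>M = (n - r)/d\<close>, so that \<open>a p\<^sup>M = q\<^sup>n\<close>. Replace three of the four
  factors \<open>(a; p)\<^sub>k/(p; p)\<^sub>k\<close> of the summand by \<open>(x a; p)\<^sub>k/(p/x; p)\<^sub>k\<close>, and likewise for \<open>y\<close> and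
  \<open>z\<close>. The resulting sum \<open>f(x,y,z)\<close> is very-well-poised and symmetric in \<open>x, y, z\<close>. For
  \<open>x = u = q\<^sup>-\<^sup>n\<close> it terminates and Watson's transformation gives \<open>f(u,y,z) = g(u,y,z)\<close>, where \<open>g\<close>
  is an explicit symmetric function divisible by \<open>1 - q\<^sup>n\<close>; hence \<open>f = g\<close> as soon as one of
  \<open>x, y, z\<close> is \<open>u\<close>.

  Fix a prime factor \<open>\<pi>\<close> of the modulus, and let \<open>m\<close> be the order of \<open>q\<close> modulo \<open>\<pi>\<close>.
  If \<open>m = n\<close>, reflecting \<open>k \<mapsto> M - k\<close> shows \<open>f \<equiv> 0\<close> modulo \<open>\<pi>\<close> identically in \<open>x, y, z\<close>. So
  \<open>(f - g)/\<pi>\<close> is integral at \<open>\<pi>\<close> and vanishes at three points of the line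
  \<open>(1 + w, 1 + w/2, 1 + w/3)\<close>, namely \<open>w = h, 2h, 3h\<close> with \<open>h = u - 1\<close>; its value at \<open>w = 0\<close> is
  therefore divisible by \<open>h\<^sup>3\<close>, and \<open>\<pi>\<close> divides \<open>h\<close>. This gives the congruence modulo \<open>\<pi>\<^sup>4\<close>.
  If \<open>m < n\<close>, only a congruence modulo \<open>\<pi>\<close> is needed: the sum splits into blocks of length \<open>m\<close>,
  each vanishing modulo \<open>\<pi>\<close> by the same reflection. Irreducibility of the cyclotomic polynomials is
  never used, because \<open>q\<^sup>n - 1\<close> is squarefree.
\<close>

text \<open>The exponent 4 is one factor \<pi> from the antisymmetry plus one factor
  \<open>h\<close> for each of the three deformed parameters, and \<open>[n] * Phi_n ^ 3\<close>
  contains a prime with m = n at most 1 + 3 times. The slopes 1, 1/2, 1/3 place the root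
  \<open>u\<close> at three different multiples of \<open>h\<close>; 2 and 3 are invertible because
  the ground ring contains the rationals. The parameters are not adjoined as indeterminates. They
  are values in the same fraction field, and "identically in x, y, z" becomes a statement about
  sequences whose divided differences with step \<open>h\<close> stay integral. The value of
  \<open>g\<close> at w = 0 is not yet the claimed right-hand side: it contains the product of the
  factors (1 - u p^i)(1 - p^i/u), and expanding its quotient by the square of (p; p) of length M to
  second order in 1 - q^n produces the bracket with the sum over p^i/(1 - p^i)^2. For m < n some
  factors of the denominators vanish modulo \<pi>, on both sides. There integrality is itself a
  matter of proof: vanishing factors are counted as powers of 1 - q^m above and below.\<close>

definition poch :: "'a::field \<Rightarrow> 'a \<Rightarrow> nat \<Rightarrow> 'a" where
  "poch x b k = (\<Prod>j<k. 1 - x * b ^ j)"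

definition shifted_poch :: "'a::field \<Rightarrow> 'a \<Rightarrow> nat \<Rightarrow> 'a" where
  "shifted_poch x b k = (\<Prod>j<k. x - b ^ j)"

text \<open>This is \<open>b\<close> to the power k(k-1)/2. As a product it satisfies its recurrence
  and addition law without halved exponents.\<close>

definition tri_power :: "'a::field \<Rightarrow> nat \<Rightarrow> 'a" where
  "tri_power b k = (\<Prod>j<k. b ^ j)"

lemma poch_0 [simp]: "poch x b 0 = 1"
  by (simp add: poch_def)

lemma poch_Suc: "poch x b (Suc k) = poch x b k * (1 - x * b ^ k)"
  by (simp add: poch_def)

lemma poch_add: "poch x b (k + l) = poch x b k * poch (x * b ^ k) b l"
  by (induction l) (simp_all add: poch_Suc power_add mult.assoc)

lemma poch_Suc_shift: "poch x b (Suc k) = (1 - x) * poch (x * b) b k"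
  using poch_add[of x b 1 k] by (simp add: poch_Suc)

lemma poch_nonzero_iff: "poch x b k \<noteq> 0 \<longleftrightarrow> (\<forall>j<k. x * b ^ j \<noteq> 1)"
  by (auto simp: poch_def)

lemma poch_nonzero_mono: "poch x b n \<noteq> 0 \<Longrightarrow> k \<le> n \<Longrightarrow> poch x b k \<noteq> 0"
  by (auto simp: poch_nonzero_iff)

lemma poch_inverse_power_eq_0: "b \<noteq> 0 \<Longrightarrow> n < k \<Longrightarrow> poch (inverse (b ^ n)) b k = 0"
  by (auto simp: poch_def intro!: bexI[of _ n])

lemma shifted_poch_0 [simp]: "shifted_poch x b 0 = 1"
  by (simp add: shifted_poch_def)

lemma shifted_poch_Suc: "shifted_poch x b (Suc k) = shifted_poch x b k * (x - b ^ k)"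
  by (simp add: shifted_poch_def)

lemma shifted_poch_Suc_mult: "shifted_poch (b * x) b (Suc k) = (b * x - 1) * b ^ k * shifted_poch x b k"
proof -
  have "shifted_poch (b * x) b (Suc k) = (b * x - 1) * (\<Prod>j<k. b * (x - b ^ j))"
    unfolding shifted_poch_def prod.lessThan_Suc_shift by (simp add: algebra_simps)
  thus ?thesis
    by (simp add: shifted_poch_def prod.distrib)
qed

lemma shifted_poch_add:
  "shifted_poch (b ^ (j + n)) b (j + i) = shifted_poch (b ^ (j + n)) b j * b ^ (j * i) * shifted_poch (b ^ n) b i"
  by (induction i) (simp_all add: shifted_poch_Suc power_add algebra_simps)

lemma shifted_poch_power_eq_0: "n < k \<Longrightarrow> shifted_poch (b ^ n) b k = 0"
  by (auto simp: shifted_poch_def)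

lemma shifted_poch_conv_poch: "x \<noteq> 0 \<Longrightarrow> shifted_poch x b k = x ^ k * poch (inverse x) b k"
  by (induction k) (simp_all add: shifted_poch_Suc poch_Suc field_simps)

lemma tri_power_0 [simp]: "tri_power b 0 = 1"
  by (simp add: tri_power_def)

lemma tri_power_Suc: "tri_power b (Suc k) = tri_power b k * b ^ k"
  by (simp add: tri_power_def)

lemma tri_power_nonzero [simp]: "b \<noteq> 0 \<Longrightarrow> tri_power b k \<noteq> 0"
  by (simp add: tri_power_def)

lemma tri_power_add: "tri_power b (j + i) = tri_power b j * tri_power b i * b ^ (j * i)"
  by (induction i) (simp_all add: tri_power_Suc power_add algebra_simps)

lemma tri_power_square: "b ^ k * tri_power b k ^ 2 = b ^ (k * k)"
proof (induction k)
  case (Suc k)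
  have "b ^ Suc k * tri_power b (Suc k) ^ 2 = b ^ k * tri_power b k ^ 2 * (b * b ^ k * b ^ k)"
    by (simp add: tri_power_Suc power2_eq_square)
  also have "\<dots> = b ^ (Suc k * Suc k)"
    unfolding Suc.IH by (simp add: power_add)
  finally show ?case .
qed auto

text \<open>Pulling \<open>b ^ l\<close> out of the factor \<open>b ^ (j + i) - b ^ l\<close> leaves
  \<open>- (1 - b ^ (j + i - l))\<close>; for l < j these are the factors of
  \<open>poch b b (j + i)\<close> that \<open>poch b b i\<close> lacks. It is the polynomial form of
  the formula expressing (q^(-N); q)_j by q-factorials.\<close>

lemma shifted_poch_power_mult_poch:
  "shifted_poch (b ^ (j + i)) b j * poch b b i = (-1) ^ j * tri_power b j * poch b b (j + i)"
proof (induction j arbitrary: i)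
  case (Suc j)
  have "shifted_poch (b ^ (Suc j + i)) b (Suc j) * poch b b i
      = shifted_poch (b ^ (j + Suc i)) b j * (- (b ^ j)) * (poch b b i * (1 - b * b ^ i))"
    by (simp add: shifted_poch_Suc algebra_simps power_add)
  also have "poch b b i * (1 - b * b ^ i) = poch b b (Suc i)"
    by (simp add: poch_Suc)
  also have "shifted_poch (b ^ (j + Suc i)) b j * (- (b ^ j)) * poch b b (Suc i)
      = - (b ^ j) * ((-1) ^ j * tri_power b j * poch b b (j + Suc i))"
    using Suc.IH[of "Suc i"] by (simp add: mult_ac)
  finally show ?case
    by (simp add: tri_power_Suc mult_ac)
qed auto

text \<open>Read backwards, the factors on the left are 1 - 1/(x b^l) for l < n, and multiplication
  by x b^l turns each into -(1 - x b^l).\<close>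

lemma poch_reverse:
  assumes "x \<noteq> 0" "b \<noteq> 0"
  shows "poch (b / (x * b ^ n)) b n * (x ^ n * tri_power b n) = (-1) ^ n * poch x b n"
proof (induction n)
  case (Suc n)
  have eq: "b / (x * b ^ Suc n) * b = b / (x * b ^ n)"
    using assms by simp
  have "poch (b / (x * b ^ Suc n)) b (Suc n) * (x ^ Suc n * tri_power b (Suc n))
      = (1 - b / (x * b ^ Suc n)) * (x * b ^ n) * (poch (b / (x * b ^ n)) b n * (x ^ n * tri_power b n))"
    unfolding poch_Suc_shift eq by (simp add: tri_power_Suc mult_ac)
  also have "(1 - b / (x * b ^ Suc n)) * (x * b ^ n) = - (1 - x * b ^ n)"
    using assms by (simp add: field_simps)
  also have "- (1 - x * b ^ n) * (poch (b / (x * b ^ n)) b n * (x ^ n * tri_power b n))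
      = (-1) ^ Suc n * poch x b (Suc n)"
    unfolding Suc.IH by (simp add: poch_Suc algebra_simps)
  finally show ?case .
qed auto

subsection \<open>Terminating basic hypergeometric summations\<close>

text \<open>The part of the summand that does not depend on the length N of the sum.\<close>

definition six_phi_five_coeff :: "'a::field \<Rightarrow> 'a \<Rightarrow> 'a \<Rightarrow> 'a \<Rightarrow> nat \<Rightarrow> 'a" where
  "six_phi_five_coeff q a d e k = poch a q k * poch d q k * poch e q k * (a * q / (d * e)) ^ k
     / (poch q q k * poch (a * q / d) q k * poch (a * q / e) q k)"

text \<open>Here \<open>shifted_poch Q q k\<close> is \<open>(1/Q; q)\<^sub>k Q\<^sup>k\<close>; keeping \<open>Q\<close> free until it is specialised to \<open>q\<^sup>N\<close>
  turns the recurrence in \<open>N\<close> into a polynomial identity.\<close>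

definition six_phi_five_term :: "'a::field \<Rightarrow> 'a \<Rightarrow> 'a \<Rightarrow> 'a \<Rightarrow> 'a \<Rightarrow> nat \<Rightarrow> 'a" where
  "six_phi_five_term q a d e Q k = (1 - a * q ^ (2 * k)) * six_phi_five_coeff q a d e k
     * shifted_poch Q q k / poch (a * Q * q) q k"

text \<open>The closed form of the sum predicts the ratio between the values at \<open>q * Q\<close>
  and at \<open>Q\<close>. Cross-multiplying with this ratio makes the combination of summands
  telescope in the sense of Wilf and Zeilberger; the right-hand side is the certificate. For
  \<open>Q = q ^ N\<close> it vanishes as soon as n exceeds N.\<close>

lemma six_phi_five_telescope:
  fixes q a d e Q :: "'a::field"
  defines "X \<equiv> a * q / (d * e)"
  assumes "d \<noteq> 0" "e \<noteq> 0"
    and nz: "poch q q n \<noteq> 0" "poch (a * q / d) q n \<noteq> 0" "poch (a * q / e) q n \<noteq> 0"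
    and nzQ: "poch (a * Q * q) q (Suc n) \<noteq> 0"
  shows "(\<Sum>k\<le>n. (1 - a * q * Q / d) * (1 - a * q * Q / e) * six_phi_five_term q a d e (q * Q) k
            - (1 - a * q * Q) * (1 - X * Q) * six_phi_five_term q a d e Q k)
       = Q * (1 - a * q * Q) * six_phi_five_coeff q a d e n * (1 - a * q ^ n) * (1 - d * q ^ n)
           * (1 - e * q ^ n) * X * shifted_poch Q q n / poch (a * Q * q) q (Suc n)"
  using nz nzQ
proof (induction n)
  case 0
  define \<delta> \<epsilon> where "\<delta> = inverse d" and "\<epsilon> = inverse e"
  have de: "d * \<delta> = 1" "e * \<epsilon> = 1" using assms by (auto simp: \<delta>_def \<epsilon>_def)
  have "1 - a * q * Q \<noteq> 0" using 0 by (simp add: poch_Suc mult_ac)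
  moreover have "(1 - a * q * Q * \<delta>) * (1 - a * q * Q * \<epsilon>) * (1 - a) - (1 - a * q * Q) * (1 - a * q * \<delta> * \<epsilon> * Q) * (1 - a)
     = Q * (1 - a) * (1 - d) * (1 - e) * (a * q * \<delta> * \<epsilon>)"
    using de by algebra
  ultimately show ?case
    by (simp add: six_phi_five_term_def six_phi_five_coeff_def X_def poch_Suc \<delta>_def \<epsilon>_def
        divide_inverse mult_ac)
next
  case (Suc n)
  define \<delta> \<epsilon> where "\<delta> = inverse d" and "\<epsilon> = inverse e"
  have de: "d * \<delta> = 1" "e * \<epsilon> = 1" using assms by (auto simp: \<delta>_def \<epsilon>_def)
  have X: "X = a * q * \<delta> * \<epsilon>" by (simp add: X_def \<delta>_def \<epsilon>_def field_simps)
  define K where "K = q ^ n"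
  define C where "C = six_phi_five_coeff q a d e (Suc n)"
  define B where "B = shifted_poch Q q n"
  define D where "D = poch (a * Q * q) q (Suc n)"
  define E where "E = 1 - a * Q * q * (q * K)"
  have nzD: "D \<noteq> 0" "E \<noteq> 0"
    using Suc.prems(4) by (simp_all add: D_def E_def K_def poch_Suc[of _ _ "Suc n"])
  have nz1: "1 - a * Q * q \<noteq> 0"
    using nzD(1) by (simp add: D_def poch_Suc_shift)
  have "1 - q * K \<noteq> 0" "1 - a * q * \<delta> * K \<noteq> 0" "1 - a * q * \<epsilon> * K \<noteq> 0"
    using Suc.prems(1-3) by (auto simp: poch_Suc K_def \<delta>_def \<epsilon>_def divide_inverse)
  moreover have "C = six_phi_five_coeff q a d e n * ((1 - a * q ^ n) * (1 - d * q ^ n) * (1 - e * q ^ n) * X)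
      / ((1 - q * K) * (1 - a * q * \<delta> * K) * (1 - a * q * \<epsilon> * K))"
    by (simp add: C_def six_phi_five_coeff_def poch_Suc K_def \<delta>_def \<epsilon>_def X_def divide_inverse mult_ac)
  ultimately have C: "C * (1 - q * K) * (1 - a * q * \<delta> * K) * (1 - a * q * \<epsilon> * K) =
      six_phi_five_coeff q a d e n * (1 - a * q ^ n) * (1 - d * q ^ n) * (1 - e * q ^ n) * X"
    by simp
  have q2: "q ^ (2 * Suc n) = q ^ 2 * K ^ 2"
    unfolding K_def power_mult[symmetric] power_add[symmetric] by (simp add: mult.commute)
  have t1: "six_phi_five_term q a d e Q (Suc n) = (1 - a * q ^ 2 * K ^ 2) * C * B * (Q - K) / D"
    unfolding six_phi_five_term_def q2
    by (simp add: C_def B_def D_def K_def shifted_poch_Suc mult_ac)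
  have D': "(1 - a * Q * q) * poch (a * (q * Q) * q) q (Suc n) = D * E"
    using poch_Suc_shift[of "a * Q * q" q "Suc n"] poch_Suc[of "a * Q * q" q "Suc n"]
    by (simp add: D_def E_def K_def mult_ac)
  hence D'': "poch (a * (q * Q) * q) q (Suc n) = D * E / (1 - a * Q * q)"
    using nz1 by (simp add: field_simps)
  have t2: "six_phi_five_term q a d e (q * Q) (Suc n)
      = (1 - a * q ^ 2 * K ^ 2) * C * (q * Q - 1) * K * B * (1 - a * Q * q) / (D * E)"
    unfolding six_phi_five_term_def shifted_poch_Suc_mult D'' q2
    by (simp add: C_def B_def K_def mult_ac)
  \<comment> \<open>With \<open>C * B / (D * E)\<close> factored out, the induction step is this
    identity. Writing \<open>\<delta>\<close> and \<open>\<epsilon>\<close> for the inverses of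
    \<open>d\<close> and \<open>e\<close> makes it polynomial, with \<open>d * \<delta> = 1\<close>
    and \<open>e * \<epsilon> = 1\<close> as the only side relations.\<close>
  have key: "Q * (1 - a * q * Q) * (1 - q * K) * (1 - a * q * \<delta> * K) * (1 - a * q * \<epsilon> * K) * E
      + (1 - a * q ^ 2 * K ^ 2) * ((1 - a * q * Q * \<delta>) * (1 - a * q * Q * \<epsilon>) * (q * Q - 1) * K * (1 - a * Q * q)
         - (1 - a * q * Q) * (1 - X * Q) * (Q - K) * E)
      = Q * (1 - a * q * Q) * (1 - a * (q * K)) * (1 - d * (q * K)) * (1 - e * (q * K)) * X * (Q - K)"
  proof -
    have Xd: "(1 - d * (q * K)) * (1 - e * (q * K)) * X =
        a * q * \<delta> * \<epsilon> - a * q * \<epsilon> * (q * K) - a * q * \<delta> * (q * K) + a * q * (q * K) * (q * K)"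
      using de unfolding X by algebra
    have "Q * (1 - a * q * Q) * (1 - a * (q * K)) * ((1 - d * (q * K)) * (1 - e * (q * K)) * X) * (Q - K)
      = Q * (1 - a * q * Q) * (1 - q * K) * (1 - a * q * \<delta> * K) * (1 - a * q * \<epsilon> * K) * E
      + (1 - a * q ^ 2 * K ^ 2) * ((1 - a * q * Q * \<delta>) * (1 - a * q * Q * \<epsilon>) * (q * Q - 1) * K * (1 - a * Q * q)
         - (1 - a * q * Q) * (1 - X * Q) * (Q - K) * E)"
      unfolding Xd unfolding X E_def by algebra
    thus ?thesis by (simp add: mult_ac)
  qed
  have IH: "(\<Sum>k\<le>n. (1 - a * q * Q / d) * (1 - a * q * Q / e) * six_phi_five_term q a d e (q * Q) k
            - (1 - a * q * Q) * (1 - X * Q) * six_phi_five_term q a d e Q k)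
       = Q * (1 - a * q * Q) * (C * (1 - q * K) * (1 - a * q * \<delta> * K) * (1 - a * q * \<epsilon> * K)) * B / D"
    unfolding C using Suc.IH Suc.prems(1-3)[THEN poch_nonzero_mono, of n] Suc.prems(4)[THEN poch_nonzero_mono, of "Suc n"]
    by (simp add: B_def D_def mult_ac)
  have inv: "a * q * Q / d = a * q * Q * \<delta>" "a * q * Q / e = a * q * Q * \<epsilon>"
    by (simp_all add: \<delta>_def \<epsilon>_def divide_inverse)
  have factor: "u0 * u1 * (C * f1 * f2 * f3) * B / D + (d1 * d2 * (v * C * s * K * B * w / (D * E)) - u1 * u2 * (v * C * B * t / D))
      = C * B / (D * E) * (u0 * u1 * f1 * f2 * f3 * E + v * (d1 * d2 * s * K * w - u1 * u2 * t * E))"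
    for u0 u1 f1 f2 f3 d1 d2 v s w u2 t
    using nzD by (simp add: field_simps)
  have "(\<Sum>k\<le>Suc n. (1 - a * q * Q / d) * (1 - a * q * Q / e) * six_phi_five_term q a d e (q * Q) k
            - (1 - a * q * Q) * (1 - X * Q) * six_phi_five_term q a d e Q k)
      = C * B / (D * E) * (Q * (1 - a * q * Q) * (1 - q * K) * (1 - a * q * \<delta> * K) * (1 - a * q * \<epsilon> * K) * E
      + (1 - a * q ^ 2 * K ^ 2) * ((1 - a * q * Q * \<delta>) * (1 - a * q * Q * \<epsilon>) * (q * Q - 1) * K * (1 - a * Q * q)
         - (1 - a * q * Q) * (1 - X * Q) * (Q - K) * E))"
    unfolding sum.atMost_Suc IH t1 t2 unfolding inv by (rule factor)
  also have "\<dots> = Q * (1 - a * q * Q) * C * (1 - a * q ^ Suc n) * (1 - d * q ^ Suc n)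
           * (1 - e * q ^ Suc n) * X * shifted_poch Q q (Suc n) / poch (a * Q * q) q (Suc (Suc n))"
    unfolding key poch_Suc[of _ _ "Suc n"] shifted_poch_Suc
    by (simp add: C_def B_def D_def E_def K_def mult_ac)
  finally show ?case by (simp add: C_def)
qed

theorem six_phi_five:
  fixes q a d e :: "'a::field"
  assumes "d \<noteq> 0" "e \<noteq> 0"
    and "poch q q n \<noteq> 0" "poch (a * q / d) q n \<noteq> 0" "poch (a * q / e) q n \<noteq> 0"
    and a: "\<And>i. a * q ^ i \<noteq> 1"
  shows "(\<Sum>k\<le>n. six_phi_five_term q a d e (q ^ n) k)
       = poch a q (Suc n) * poch (a * q / (d * e)) q n / (poch (a * q / d) q n * poch (a * q / e) q n)"
  using assms(3-5)
proof (induction n)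
  case 0
  show ?case by (simp add: six_phi_five_term_def six_phi_five_coeff_def poch_Suc)
next
  case (Suc n)
  define X where "X = a * q / (d * e)"
  define Q where "Q = q ^ n"
  have nz: "poch q q n \<noteq> 0" "poch (a * q / d) q n \<noteq> 0" "poch (a * q / e) q n \<noteq> 0"
    using Suc.prems[THEN poch_nonzero_mono, of n] by simp_all
  have pa: "poch (a * Q * q) q m \<noteq> 0" for m
    unfolding poch_nonzero_iff using a[of "n + 1 + _"] by (simp add: Q_def power_add mult_ac)
  have nzd: "1 - a * q * Q / d \<noteq> 0" "1 - a * q * Q / e \<noteq> 0"
    using Suc.prems by (auto simp: poch_Suc Q_def)
  have "(\<Sum>k\<le>Suc n. (1 - a * q * Q / d) * (1 - a * q * Q / e) * six_phi_five_term q a d e (q * Q) k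
            - (1 - a * q * Q) * (1 - X * Q) * six_phi_five_term q a d e Q k) = 0"
    unfolding X_def by (subst six_phi_five_telescope)
      (use assms Suc.prems pa in \<open>auto simp: shifted_poch_power_eq_0 Q_def\<close>)
  hence "(1 - a * q * Q / d) * (1 - a * q * Q / e) * (\<Sum>k\<le>Suc n. six_phi_five_term q a d e (q * Q) k)
      = (1 - a * q * Q) * (1 - X * Q) * (\<Sum>k\<le>Suc n. six_phi_five_term q a d e Q k)"
    unfolding sum_subtractf sum_distrib_left by simp
  also have "(\<Sum>k\<le>Suc n. six_phi_five_term q a d e Q k) = (\<Sum>k\<le>n. six_phi_five_term q a d e Q k)"
    by (simp add: six_phi_five_term_def shifted_poch_power_eq_0 Q_def)
  finally have "(\<Sum>k\<le>Suc n. six_phi_five_term q a d e (q * Q) k)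
      = (1 - a * q * Q) * (1 - X * Q) * (\<Sum>k\<le>n. six_phi_five_term q a d e Q k)
        / ((1 - a * q * Q / d) * (1 - a * q * Q / e))"
    using nzd by (intro eq_divide_imp) (simp_all add: mult.commute)
  also have "(\<Sum>k\<le>n. six_phi_five_term q a d e Q k)
      = poch a q (Suc n) * poch X q n / (poch (a * q / d) q n * poch (a * q / e) q n)"
    unfolding Q_def X_def using nz by (rule Suc.IH)
  finally show ?case
    by (simp add: Q_def poch_Suc X_def mult_ac)
qed


section \<open>The terminating balanced 3phi2 sum (q-Pfaff-Saalschuetz)\<close>

definition saalschuetz_term :: "'a::field \<Rightarrow> 'a \<Rightarrow> 'a \<Rightarrow> 'a \<Rightarrow> 'a \<Rightarrow> 'a \<Rightarrow> nat \<Rightarrow> 'a" where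
  "saalschuetz_term q a b g f K j = poch (inverse K) q j * poch (a * K) q j * poch f q j * q ^ j
     / (poch q q j * poch b q j * poch g q j)"

text \<open>The balancing condition says that \<open>a * q * f\<close> divided by \<open>b\<close>
  is \<open>g\<close> and vice versa, so the factor \<open>f\<close> clears both quotients and the
  contiguous relation becomes polynomial.\<close>

lemma saalschuetz_quadratic:
  fixes a b f g q K :: "'a::field"
  assumes "b \<noteq> 0" "g \<noteq> 0" "b * g = a * q * f"
  shows "(1 - a * q / b * K) * (1 - a * q / g * K) * f = f - (b + g) * K + a * q * K ^ 2"
proof -
  have 1: "a * q / b * f = g" "a * q / g * f = b"
    using assms by (simp_all add: field_simps)
  have "(1 - a * q / b * K) * (1 - a * q / g * K) * f
      = f - (a * q / b * f + a * q / g * f) * K + (a * q / b * f) * (a * q / g) * K ^ 2"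
    by (simp only: ring_distribs right_diff_distrib left_diff_distrib power2_eq_square mult_ac mult_1_left mult_1_right) simp
  thus ?thesis unfolding 1 using assms by simp
qed

text \<open>Same scheme as \<open>six_phi_five_telescope\<close>, with \<open>K\<close> for
  \<open>q ^ k\<close>: the multipliers come from the ratio of the closed forms at k + 1 and k. The
  certificate contains \<open>poch (inverse K) q n\<close>, which is 0 for \<open>K = q ^ k\<close>
  and n > k.\<close>

lemma saalschuetz_telescope:
  fixes q a b g f K :: "'a::field"
  assumes "q \<noteq> 0" "K \<noteq> 0" "a \<noteq> 0" "b \<noteq> 0" "g \<noteq> 0" and bg: "b * g = a * q * f"
    and "poch q q n \<noteq> 0" "poch b q n \<noteq> 0" "poch g q n \<noteq> 0"
  shows "(\<Sum>j\<le>n. (1 - b * K) * (1 - g * K) * saalschuetz_term q a b g f (q * K) j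
          - (1 - a * q / b * K) * (1 - a * q / g * K) * f * saalschuetz_term q a b g f K j)
       = (1 - a * q * K ^ 2) * poch (inverse K) q n * poch (a * q * K) q n * poch f q (Suc n)
          / (poch q q n * poch b q n * poch g q n)"
  using assms(7-9)
proof (induction n)
  case 0
  have "(1 - b * K) * (1 - g * K) - (1 - a * q / b * K) * (1 - a * q / g * K) * f = (1 - a * q * K ^ 2) * (1 - f)"
    unfolding saalschuetz_quadratic[OF assms(4,5) bg] using bg by algebra
  thus ?case by (simp add: saalschuetz_term_def poch_Suc mult_ac)
next
  case (Suc n)
  define L where "L = q ^ n"
  define P where "P = poch (inverse K) q n"
  define A where "A = poch (a * q * K) q n"
  define F where "F = poch f q (Suc n)"
  define D where "D = poch q q (Suc n) * poch b q (Suc n) * poch g q (Suc n)"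
  have D: "D \<noteq> 0" using Suc.prems by (simp add: D_def)
  have iq: "q * (inverse K * inverse q) = inverse K"
    using \<open>q \<noteq> 0\<close> by simp
  have t1: "saalschuetz_term q a b g f (q * K) (Suc n)
      = (1 - inverse (q * K)) * P * A * (1 - a * q * K * L) * F * (q * L) / D"
    using poch_Suc_shift[of "inverse (q * K)" q n] poch_Suc[of "a * q * K" q n] iq
    by (simp add: saalschuetz_term_def L_def P_def A_def F_def D_def mult_ac)
  have t2: "saalschuetz_term q a b g f K (Suc n) = P * (1 - L / K) * (1 - a * K) * A * F * (q * L) / D"
    using poch_Suc[of "inverse K" q n] poch_Suc_shift[of "a * K" q n]
    by (simp add: saalschuetz_term_def L_def P_def A_def F_def D_def divide_inverse mult_ac)
  have D': "poch q q n * poch b q n * poch g q n * ((1 - q * L) * (1 - b * L) * (1 - g * L)) = D"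
    by (simp add: D_def poch_Suc L_def mult_ac)
  have IH: "(\<Sum>j\<le>n. (1 - b * K) * (1 - g * K) * saalschuetz_term q a b g f (q * K) j
          - (1 - a * q / b * K) * (1 - a * q / g * K) * f * saalschuetz_term q a b g f K j)
       = (1 - a * q * K ^ 2) * P * A * F * ((1 - q * L) * (1 - b * L) * (1 - g * L)) / D"
    using Suc.IH Suc.prems[THEN poch_nonzero_mono, of n] D unfolding D'[symmetric]
    by (simp add: P_def A_def F_def)
  have key: "(1 - a * q * K ^ 2) * ((1 - q * L) * (1 - b * L) * (1 - g * L))
      + q * L * ((1 - b * K) * (1 - g * K) * (1 - inverse (q * K)) * (1 - a * q * K * L)
          - (1 - a * q / b * K) * (1 - a * q / g * K) * f * (1 - L / K) * (1 - a * K))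
      = (1 - a * q * K ^ 2) * (1 - L / K) * (1 - a * q * K * L) * (1 - f * (q * L))"
  proof -
    note 1 = saalschuetz_quadratic[OF assms(4,5) bg]
    have bf: "b * g = a * q * f" by (rule bg)
    define \<kappa> where "\<kappa> = inverse K"
    have k: "K * \<kappa> = 1" "L / K = L * \<kappa>" "q * inverse (q * K) = \<kappa>"
      using assms by (auto simp: \<kappa>_def divide_inverse)
    have 2: "q * L * ((1 - b * K) * (1 - g * K) * (1 - inverse (q * K)) * (1 - a * q * K * L) - Y)
        = L * ((1 - b * K) * (1 - g * K) * (q - \<kappa>) * (1 - a * q * K * L)) - q * L * Y" for Y
      unfolding k(3)[symmetric] by (simp add: algebra_simps)
    have "(1 - a * q * K ^ 2) * ((1 - q * L) * (1 - b * L) * (1 - g * L)) +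
       (L * ((1 - b * K) * (1 - g * K) * (q - \<kappa>) * (1 - a * q * K * L)) -
         q * L * ((f - (b + g) * K + a * q * K ^ 2) * (1 - L * \<kappa>) * (1 - a * K)))
      = (1 - a * q * K ^ 2) * (1 - L * \<kappa>) * (1 - a * q * K * L) * (1 - f * (q * L))"
      using k(1) bf by algebra
    thus ?thesis
      unfolding 1 2 k(2) .
  qed
  have factor: "c * P * A * F * w / D + (u * (r1 * P * A * s * F * y / D) - v * (P * r2 * r3 * A * F * y / D))
      = P * A * F / D * (c * w + y * (u * r1 * s - v * r2 * r3))" for c w u r1 s y v r2 r3
    by (simp add: divide_inverse algebra_simps)
  have "(\<Sum>j\<le>Suc n. (1 - b * K) * (1 - g * K) * saalschuetz_term q a b g f (q * K) j
          - (1 - a * q / b * K) * (1 - a * q / g * K) * f * saalschuetz_term q a b g f K j)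
      = P * A * F / D * ((1 - a * q * K ^ 2) * ((1 - q * L) * (1 - b * L) * (1 - g * L))
      + q * L * ((1 - b * K) * (1 - g * K) * (1 - inverse (q * K)) * (1 - a * q * K * L)
          - (1 - a * q / b * K) * (1 - a * q / g * K) * f * (1 - L / K) * (1 - a * K)))"
    unfolding sum.atMost_Suc IH t1 t2 by (rule factor)
  also have "\<dots> = (1 - a * q * K ^ 2) * poch (inverse K) q (Suc n) * poch (a * q * K) q (Suc n) * poch f q (Suc (Suc n))
          / (poch q q (Suc n) * poch b q (Suc n) * poch g q (Suc n))"
    unfolding key poch_Suc[of f q "Suc n"] unfolding poch_Suc[of "inverse K"] poch_Suc[of "a * q * K"]
    by (simp add: P_def A_def F_def D_def L_def divide_inverse mult_ac)
  finally show ?case .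
qed

theorem saalschuetz:
  fixes q a b g f :: "'a::field"
  assumes "q \<noteq> 0" "a \<noteq> 0" "b \<noteq> 0" "g \<noteq> 0" and bg: "b * g = a * q * f"
    and "poch q q k \<noteq> 0" "poch b q k \<noteq> 0" "poch g q k \<noteq> 0"
  shows "(\<Sum>j\<le>k. saalschuetz_term q a b g f (q ^ k) j)
       = poch (a * q / b) q k * poch (a * q / g) q k * f ^ k / (poch b q k * poch g q k)"
  using assms(6-8)
proof (induction k)
  case 0
  show ?case by (simp add: saalschuetz_term_def)
next
  case (Suc k)
  define K where "K = q ^ k"
  have nz: "1 - b * K \<noteq> 0" "1 - g * K \<noteq> 0"
    using Suc.prems by (auto simp: poch_Suc K_def)
  have "(\<Sum>j\<le>Suc k. (1 - b * K) * (1 - g * K) * saalschuetz_term q a b g f (q * K) j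
          - (1 - a * q / b * K) * (1 - a * q / g * K) * f * saalschuetz_term q a b g f K j) = 0"
    by (subst saalschuetz_telescope) (use assms Suc.prems in \<open>auto simp: poch_inverse_power_eq_0 K_def\<close>)
  hence "(1 - b * K) * (1 - g * K) * (\<Sum>j\<le>Suc k. saalschuetz_term q a b g f (q * K) j)
      = (1 - a * q / b * K) * (1 - a * q / g * K) * f * (\<Sum>j\<le>Suc k. saalschuetz_term q a b g f K j)"
    unfolding sum_subtractf sum_distrib_left by simp
  also have "(\<Sum>j\<le>Suc k. saalschuetz_term q a b g f K j) = (\<Sum>j\<le>k. saalschuetz_term q a b g f K j)"
    using \<open>q \<noteq> 0\<close> by (simp add: saalschuetz_term_def poch_inverse_power_eq_0 K_def)
  also have "\<dots> = poch (a * q / b) q k * poch (a * q / g) q k * f ^ k / (poch b q k * poch g q k)"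
    unfolding K_def using Suc.prems[THEN poch_nonzero_mono, of k] by (intro Suc.IH) auto
  finally have "(\<Sum>j\<le>Suc k. saalschuetz_term q a b g f (q * K) j)
      = (1 - a * q / b * K) * (1 - a * q / g * K) * f
        * (poch (a * q / b) q k * poch (a * q / g) q k * f ^ k / (poch b q k * poch g q k))
        / ((1 - b * K) * (1 - g * K))"
    using nz by (intro eq_divide_imp) (simp_all add: mult.commute)
  thus ?case
    by (simp add: K_def poch_Suc mult_ac)
qed


subsection \<open>Watson's transformation\<close>

text \<open>The very-well-poised \<open>\<^sub>8\<phi>\<^sub>7\<close> has base \<open>p\<close>, leading parameter \<open>a\<close> and free parameters
  \<open>x a, y a, z a, c a, e a\<close>; the parameter \<open>a\<close> itself contributes \<open>\<chi> = 1\<close>.\<close>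

definition wp_ratio :: "'a::field \<Rightarrow> 'a \<Rightarrow> 'a \<Rightarrow> nat \<Rightarrow> 'a" where
  "wp_ratio a p \<chi> k = poch (\<chi> * a) p k / poch (p / \<chi>) p k"

definition wp_term :: "'a::field \<Rightarrow> 'a \<Rightarrow> 'a \<Rightarrow> 'a \<Rightarrow> 'a \<Rightarrow> 'a \<Rightarrow> 'a \<Rightarrow> nat \<Rightarrow> 'a" where
  "wp_term a p x y z c e k = (1 - a * p ^ (2 * k)) * wp_ratio a p 1 k * wp_ratio a p x k * wp_ratio a p y k
     * wp_ratio a p z k * wp_ratio a p c k * wp_ratio a p e k * (p ^ 2 / (a ^ 3 * x * y * z * c * e)) ^ k"

text \<open>The denominator \<open>(x y z a\<^sup>2; p)\<^sub>k\<close> of the balanced \<open>\<^sub>4\<phi>\<^sub>3\<close> is multiplied out with the prefactor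
  \<open>(x y z a\<^sup>2; p)\<^sub>M\<close>, because it can vanish (for \<open>x = y = z = 1\<close>, \<open>r = -1\<close>, \<open>d = 2\<close>).\<close>

definition watson_term :: "'a::field \<Rightarrow> 'a \<Rightarrow> nat \<Rightarrow> 'a \<Rightarrow> 'a \<Rightarrow> 'a \<Rightarrow> 'a \<Rightarrow> 'a \<Rightarrow> nat \<Rightarrow> 'a" where
  "watson_term a p M x y z c e k = poch (x * y * z * a ^ 2 * p ^ k) p (M - k) * poch (p / (a * c * e)) p k
     * poch (x * a) p k * poch (y * a) p k * poch (z * a) p k
     / (poch (p / c) p k * poch (p / e) p k * poch p p k) * p ^ k"

lemma sum_triangle_swap:
  "(\<Sum>k\<le>M. \<Sum>j\<le>k. h k j) = (\<Sum>j\<le>(M::nat). \<Sum>i\<le>M - j. (h (j + i) j :: 'a::comm_monoid_add))"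
  by (simp add: sum.Sigma)
     (rule sum.reindex_bij_witness[of _ "\<lambda>(j, i). (j + i, j)" "\<lambda>(k, j). (j, k - j)"]; force)

text \<open>\<open>saalschuetz\<close> expands the factors with \<open>c\<close> and
  \<open>e\<close> as a sum over j. After exchanging the summations, the inner sum over i = k - j is
  a \<open>six_phi_five\<close> with leading parameter \<open>a * p ^ (2 * j)\<close>; it terminates
  because \<open>x * a\<close> is the inverse of \<open>p ^ M\<close>.\<close>

theorem watson_transformation:
  fixes a p x y z c e :: "'a::field" and M :: nat
  assumes nz: "p \<noteq> 0" "a \<noteq> 0" "y \<noteq> 0" "z \<noteq> 0" "c \<noteq> 0" "e \<noteq> 0"
    and x: "x * (a * p ^ M) = 1"
    and an: "\<And>i. a * p ^ i \<noteq> 1"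
    and pn: "poch p p M \<noteq> 0" "poch (p / y) p M \<noteq> 0" "poch (p / z) p M \<noteq> 0"
      "poch (p / c) p M \<noteq> 0" "poch (p / e) p M \<noteq> 0"
  shows "(\<Sum>k\<le>M. wp_term a p x y z c e k)
    = (1 - a * p ^ M) / (a * x * y * z) ^ M * poch (p * x) p M / (poch (p / y) p M * poch (p / z) p M)
      * (\<Sum>k\<le>M. watson_term a p M x y z c e k)"
proof -
  define f where "f = p / (a * c * e)"
  define X where "X = p / (a * y * z)"
  define Q where "Q = p ^ M"
  define g where "g j = poch f p j * p ^ j / (poch p p j * poch (p / c) p j * poch (p / e) p j)" for j
  define D where "D = poch (p / y) p M * poch (p / z) p M"
  \<comment> \<open>What remains of the summand once the \<open>c\<close> and \<open>e\<close>
    ratios and \<open>f ^ k\<close>, the input of \<open>saalschuetz\<close>, are split off; the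
    base of the power factors as \<open>Q * X * f\<close>.\<close>
  define \<tau> where "\<tau> k = (1 - a * p ^ (2 * k)) * wp_ratio a p 1 k * wp_ratio a p x k * wp_ratio a p y k
     * wp_ratio a p z k * (Q * X) ^ k" for k
  have x': "x = inverse (a * p ^ M)"
    using x by (metis inverse_unique mult.commute)
  have x0: "x \<noteq> 0" using x by auto
  have f0: "f \<noteq> 0" and X0: "X \<noteq> 0" using nz by (simp_all add: f_def X_def)
  have pa: "poch (a * w) p m \<noteq> 0" if "w = p ^ l" for w l m
    unfolding poch_nonzero_iff using an[of "l + _"] that by (simp add: power_add mult_ac)
  have xa: "x * a = inverse Q" and px: "p / x = a * Q * p"
    using nz by (simp_all add: x' Q_def divide_inverse mult_ac)

  have saal: "wp_ratio a p c k * wp_ratio a p e k * f ^ k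
      = (\<Sum>j\<le>k. poch (inverse (p ^ k)) p j * poch (a * p ^ k) p j * g j)" if "k \<le> M" for k
  proof -
    have "(\<Sum>j\<le>k. saalschuetz_term p a (p / c) (p / e) f (p ^ k) j)
       = poch (a * p / (p / c)) p k * poch (a * p / (p / e)) p k * f ^ k / (poch (p / c) p k * poch (p / e) p k)"
      using nz pn[THEN poch_nonzero_mono, of k] that by (intro saalschuetz) (auto simp: f_def)
    thus ?thesis
      using nz by (simp add: wp_ratio_def saalschuetz_term_def g_def mult_ac)
  qed
  have split: "wp_term a p x y z c e k = \<tau> k * (wp_ratio a p c k * wp_ratio a p e k * f ^ k)" for k
  proof -
    have "p ^ 2 / (a ^ 3 * x * y * z * c * e) = Q * X * f"
      using nz unfolding x' Q_def X_def f_def by (simp add: field_simps power2_eq_square power3_eq_cube)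
    thus ?thesis
      by (simp add: wp_term_def \<tau>_def power_mult_distrib mult_ac)
  qed
  \<comment> \<open>The factor of the double summand at k = j + i, apart from \<open>g j\<close>,
    that is independent of i.\<close>
  define E where "E j = poch a p (2 * j) * ((-1) ^ j * tri_power p j / p ^ (j * j)) * shifted_poch Q p j
      * poch (y * a) p j * poch (z * a) p j * X ^ j / (poch (a * Q * p) p j * poch (p / y) p j * poch (p / z) p j)" for j
  have inner: "\<tau> (j + i) * (poch (inverse (p ^ (j + i))) p j * poch (a * p ^ (j + i)) p j)
      = E j * six_phi_five_term p (a * p ^ (2 * j)) (y * a * p ^ j) (z * a * p ^ j) (p ^ n) i"
    if M: "M = j + n" and i: "i \<le> n" for i j n
  proof -
    \<comment> \<open>Together the two products have 2j + i consecutive factors; this is where the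
      leading parameter of the inner sum comes from.\<close>
    have 1: "poch a p (j + i) * poch (a * p ^ (j + i)) p j = poch a p (2 * j) * poch (a * p ^ (2 * j)) p i"
      using poch_add[of a p "j + i" j] poch_add[of a p "2 * j" i] by (simp add: mult_2 add_ac)
    have "poch (inverse (p ^ (j + i))) p j = shifted_poch (p ^ (j + i)) p j / p ^ (j * j + j * i)"
      using nz(1) shifted_poch_conv_poch[of "p ^ (j + i)" p j]
      by (simp add: power_mult[symmetric] power_add[symmetric] algebra_simps)
    moreover have "poch p p (j + i) \<noteq> 0" "poch p p i \<noteq> 0"
      using poch_nonzero_mono[OF pn(1)] i M by auto
    ultimately have 2: "poch (inverse (p ^ (j + i))) p j / poch p p (j + i)
       = (-1) ^ j * tri_power p j / (p ^ (j * j) * p ^ (j * i)) / poch p p i"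
      using shifted_poch_power_mult_poch[of p j i] nz(1) by (simp add: field_simps power_add)
    have 3: "wp_ratio a p x (j + i) * Q ^ (j + i)
       = shifted_poch Q p j * p ^ (j * i) * shifted_poch (p ^ n) p i
          / (poch (a * Q * p) p j * poch (a * Q * p * p ^ j) p i)"
    proof -
      have "wp_ratio a p x (j + i) * Q ^ (j + i) = Q ^ (j + i) * poch (inverse Q) p (j + i) / poch (a * Q * p) p (j + i)"
        by (simp add: wp_ratio_def xa px)
      also have "Q ^ (j + i) * poch (inverse Q) p (j + i) = shifted_poch Q p (j + i)"
        using nz(1) by (simp add: shifted_poch_conv_poch Q_def)
      also have "\<dots> = shifted_poch Q p j * p ^ (j * i) * shifted_poch (p ^ n) p i"
        unfolding Q_def M by (rule shifted_poch_add)
      finally show ?thesis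
        by (simp add: poch_add)
    qed
    have 4: "wp_ratio a p w (j + i) = poch (w * a) p j / poch (p / w) p j
        * (poch (w * a * p ^ j) p i / poch (p / w * p ^ j) p i)" for w
      by (simp add: wp_ratio_def poch_add)
    have sq: "p ^ (2 * j) = p ^ j * p ^ j"
      by (simp add: mult_2 power_add)
    have 5: "a * p ^ (2 * j) * p / (w * a * p ^ j) = p / w * p ^ j" if "w \<noteq> 0" for w
      using nz that unfolding sq by (simp add: field_simps)
    have 6: "a * p ^ (2 * j) * p / (y * a * p ^ j * (z * a * p ^ j)) = X"
      using nz unfolding sq by (simp add: X_def field_simps)
    have 7: "a * p ^ (2 * j) * p ^ n * p = a * Q * p * p ^ j"
      unfolding sq by (simp add: Q_def M power_add mult_ac)
    have 8: "a * p ^ (2 * j) * p ^ (2 * i) = a * p ^ (2 * (j + i))"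
      by (simp add: power_add mult.assoc distrib_left)
    have "\<tau> (j + i) * (poch (inverse (p ^ (j + i))) p j * poch (a * p ^ (j + i)) p j)
      = (1 - a * p ^ (2 * (j + i))) * (poch a p (j + i) * poch (a * p ^ (j + i)) p j)
         * (poch (inverse (p ^ (j + i))) p j / poch p p (j + i)) * (wp_ratio a p x (j + i) * Q ^ (j + i))
         * wp_ratio a p y (j + i) * wp_ratio a p z (j + i) * X ^ (j + i)"
      by (simp add: \<tau>_def wp_ratio_def[of a p 1] power_mult_distrib mult_ac)
    also have "\<dots> = E j * six_phi_five_term p (a * p ^ (2 * j)) (y * a * p ^ j) (z * a * p ^ j) (p ^ n) i"
      unfolding 1 2 3 4[of y] 4[of z] six_phi_five_term_def six_phi_five_coeff_def 5[OF nz(3)] 5[OF nz(4)] 6 7 8 E_def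
      using nz(1) by (simp add: power_add divide_inverse mult_ac)
    finally show ?thesis .
  qed
  define Y where "Y = poch (p * x) p M / (a * x * y * z) ^ M"
  have outer: "E j * (\<Sum>i\<le>n. six_phi_five_term p (a * p ^ (2 * j)) (y * a * p ^ j) (z * a * p ^ j) (p ^ n) i) * g j
      = (1 - a * p ^ M) * Y / D * watson_term a p M x y z c e j"
    if M: "M = j + n" for j n
  proof -
    have sq: "p ^ (2 * j) = p ^ j * p ^ j"
      by (simp add: mult_2 power_add)
    have 5: "a * p ^ (2 * j) * p / (w * a * p ^ j) = p / w * p ^ j" if "w \<noteq> 0" for w
      using nz that unfolding sq by (simp add: field_simps)
    have 6: "a * p ^ (2 * j) * p / (y * a * p ^ j * (z * a * p ^ j)) = X"
      using nz unfolding sq by (simp add: X_def field_simps)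
    have split_poch: "poch w p j * poch (w * p ^ j) p n = poch w p M" for w
      by (simp add: M poch_add)
    have nzD: "poch (p / w) p j \<noteq> 0 \<and> poch (p / w * p ^ j) p n \<noteq> 0" if "poch (p / w) p M \<noteq> 0" for w
      using that by (simp add: M poch_add)
    have s: "(\<Sum>i\<le>n. six_phi_five_term p (a * p ^ (2 * j)) (y * a * p ^ j) (z * a * p ^ j) (p ^ n) i)
       = poch (a * p ^ (2 * j)) p (Suc n) * poch X p n / (poch (p / y * p ^ j) p n * poch (p / z * p ^ j) p n)"
      using six_phi_five[of "y * a * p ^ j" "z * a * p ^ j" p n "a * p ^ (2 * j)"] nz nzD[OF pn(2)] nzD[OF pn(3)]
        poch_nonzero_mono[OF pn(1), of n] an[of "2 * j + _"]
      unfolding 5[OF nz(3)] 5[OF nz(4)] 6 by (simp add: M power_add mult_ac)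
    have t: "poch a p (2 * j) * poch (a * p ^ (2 * j)) p (Suc n) = poch a p M * (1 - a * p ^ M) * poch (a * Q * p) p j"
    proof -
      have "poch a p (2 * j) * poch (a * p ^ (2 * j)) p (Suc n) = poch a p (Suc M + j)"
        unfolding poch_add[symmetric] by (rule arg_cong[where f = "poch a p"]) (simp add: M)
      also have "\<dots> = poch a p (Suc M) * poch (a * p ^ Suc M) p j"
        by (rule poch_add)
      finally show ?thesis
        by (simp add: Q_def poch_Suc mult_ac)
    qed
    have nQ: "poch (a * Q * p) p j \<noteq> 0"
      using pa[of "p ^ Suc M" "Suc M" j] by (simp add: Q_def mult_ac)
    \<comment> \<open>\<open>poch_reverse\<close> is applied to products of lengths \<open>M\<close>
      and \<open>n\<close>. It yields the numerator of \<open>Y\<close> and the first factor of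
      \<open>watson_term\<close> directly, so that no product in \<open>x * y * z * a ^ 2\<close> is
      ever inverted.\<close>
    have key: "poch a p M * ((-1) ^ j * tri_power p j / p ^ (j * j)) * shifted_poch Q p j * X ^ j * poch X p n
        = Y * poch (x * y * z * a ^ 2 * p ^ j) p n * poch (x * a) p j"
    proof -
      have sh: "shifted_poch Q p j = p ^ (M * j) * poch (x * a) p j"
        using shifted_poch_conv_poch[of Q p j] nz by (simp add: Q_def xa power_mult)
      have arg1: "p * x = p / (a * p ^ M)"
        by (simp add: x' divide_inverse)
      have r1: "poch (p * x) p M = (-1) ^ M * poch a p M / (a ^ M * tri_power p M)"
        using poch_reverse[of a p M] nz unfolding arg1 by (simp add: eq_divide_eq)
      have arg2: "x * y * z * a ^ 2 * p ^ j = p / (X * p ^ n)"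
        using nz by (simp add: x' X_def M field_simps power_add power2_eq_square)
      have r2: "poch (x * y * z * a ^ 2 * p ^ j) p n = (-1) ^ n * poch X p n / (X ^ n * tri_power p n)"
        using poch_reverse[of X p n] nz X0 unfolding arg2 by (simp add: eq_divide_eq)
      have ayz: "(a * x * y * z) ^ M * (a ^ M * X ^ M * (p ^ M) ^ M) = p ^ M"
      proof -
        have "a * x * y * z * (a * X * p ^ M) = p"
          using nz by (simp add: x' X_def field_simps)
        thus ?thesis by (metis power_mult_distrib mult.assoc)
      qed
      have ayz': "1 / (a * x * y * z) ^ M = a ^ M * X ^ M * p ^ (M * M) / p ^ M"
        using ayz nz x0 by (simp add: divide_simps power_mult) (simp add: mult_ac)
      have sgn: "(-1) ^ M * (-1) ^ n = ((-1) ^ j :: 'a)"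
        by (simp add: M power_add flip: power_mult_distrib)
      have tri: "tri_power p j / p ^ (j * j) * p ^ (M * j) = p ^ (M * M) / p ^ M / (tri_power p M * tri_power p n)"
      proof -
        have "p ^ (M * M) / p ^ M = tri_power p M ^ 2"
          using tri_power_square[of p M] nz(1) by (simp add: field_simps)
        hence "p ^ (M * M) / p ^ M / (tri_power p M * tri_power p n) = tri_power p M / tri_power p n"
          using nz(1) by (simp add: power2_eq_square)
        also have "\<dots> = tri_power p j * p ^ (j * n)"
          using nz(1) by (simp add: M tri_power_add)
        also have "\<dots> = tri_power p j / p ^ (j * j) * p ^ (M * j)"
          using nz(1) by (simp add: M power_add algebra_simps)
        finally show ?thesis ..
      qed
      have XM: "X ^ M = X ^ j * X ^ n" by (simp add: M power_add)
      have "Y * poch (x * y * z * a ^ 2 * p ^ j) p n * poch (x * a) p j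
         = (1 / (a * x * y * z) ^ M) * poch (p * x) p M * poch (x * y * z * a ^ 2 * p ^ j) p n * poch (x * a) p j"
        by (simp add: Y_def)
      also have "\<dots> = poch a p M * poch X p n * X ^ j * poch (x * a) p j * ((-1) ^ M * (-1) ^ n)
           * (p ^ (M * M) / p ^ M / (tri_power p M * tri_power p n))"
        unfolding ayz' r1 r2 XM using nz X0 by (simp add: field_simps)
      also have "\<dots> = poch a p M * ((-1) ^ j * tri_power p j / p ^ (j * j)) * shifted_poch Q p j * X ^ j * poch X p n"
        unfolding sgn tri[symmetric] sh by (simp add: mult_ac)
      finally show ?thesis ..
    qed
    have "E j * (\<Sum>i\<le>n. six_phi_five_term p (a * p ^ (2 * j)) (y * a * p ^ j) (z * a * p ^ j) (p ^ n) i) * g j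
      = (poch a p (2 * j) * poch (a * p ^ (2 * j)) p (Suc n)) / poch (a * Q * p) p j
         * (((-1) ^ j * tri_power p j / p ^ (j * j)) * shifted_poch Q p j * X ^ j * poch X p n)
         * poch (y * a) p j * poch (z * a) p j
         / ((poch (p / y) p j * poch (p / y * p ^ j) p n) * (poch (p / z) p j * poch (p / z * p ^ j) p n)) * g j"
      unfolding s E_def by (simp add: divide_inverse mult_ac)
    also have "\<dots> = (1 - a * p ^ M)
         * (poch a p M * ((-1) ^ j * tri_power p j / p ^ (j * j)) * shifted_poch Q p j * X ^ j * poch X p n)
         * poch (y * a) p j * poch (z * a) p j / D * g j"
      unfolding t split_poch D_def using nQ by (simp add: mult_ac)
    also have "\<dots> = (1 - a * p ^ M) * Y / D * watson_term a p M x y z c e j"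
      unfolding key watson_term_def g_def f_def by (simp add: M divide_inverse mult_ac)
    finally show ?thesis .
  qed
  have "(\<Sum>k\<le>M. wp_term a p x y z c e k)
      = (\<Sum>k\<le>M. \<Sum>j\<le>k. \<tau> k * (poch (inverse (p ^ k)) p j * poch (a * p ^ k) p j) * g j)"
    by (intro sum.cong refl) (subst split, subst saal, auto simp: sum_distrib_left mult_ac)
  also have "\<dots> = (\<Sum>j\<le>M. \<Sum>i\<le>M - j.
      \<tau> (j + i) * (poch (inverse (p ^ (j + i))) p j * poch (a * p ^ (j + i)) p j) * g j)"
    by (rule sum_triangle_swap)
  also have "\<dots> = (\<Sum>j\<le>M. (1 - a * p ^ M) * Y / D * watson_term a p M x y z c e j)"
  proof (intro sum.cong refl)
    fix j assume "j \<in> {..M}"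
    hence M: "M = j + (M - j)" by simp
    show "(\<Sum>i\<le>M - j. \<tau> (j + i) * (poch (inverse (p ^ (j + i))) p j * poch (a * p ^ (j + i)) p j) * g j)
      = (1 - a * p ^ M) * Y / D * watson_term a p M x y z c e j"
      unfolding outer[OF M, symmetric] sum_distrib_left sum_distrib_right
      by (intro sum.cong refl) (simp add: inner[OF M])
  qed
  also have "\<dots> = (1 - a * p ^ M) * Y / D * (\<Sum>j\<le>M. watson_term a p M x y z c e j)"
    by (simp only: sum_distrib_left)
  finally show ?thesis
    by (simp add: Y_def D_def)
qed

lemma wp_term_swap_xy: "wp_term a p x y z c e = wp_term a p y x z c e"
  and wp_term_swap_xz: "wp_term a p x y z c e = wp_term a p z y x c e"
  by (simp_all add: fun_eq_iff wp_term_def mult_ac)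

lemma watson_term_swap_xy: "watson_term a p M x y z c e = watson_term a p M y x z c e"
  and watson_term_swap_xz: "watson_term a p M x y z c e = watson_term a p M z y x c e"
  by (simp_all add: fun_eq_iff watson_term_def mult_ac)

subsection \<open>Antisymmetry of the very-well-poised term\<close>

lemma wp_ratio_0 [simp]: "wp_ratio a p \<chi> 0 = 1"
  by (simp add: wp_ratio_def)

lemma wp_ratio_Suc:
  "wp_ratio a p \<chi> (Suc k) = wp_ratio a p \<chi> k * ((1 - \<chi> * a * p ^ k) / (1 - p ^ Suc k / \<chi>))"
  by (simp add: wp_ratio_def poch_Suc)

text \<open>When the leading parameter is the inverse of \<open>p ^ M\<close>, the numerator of
  length \<open>M\<close> runs through the factors of the denominator in reverse order, up to
  monomials.\<close>

lemma wp_ratio_full: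
  fixes p :: "'a::field"
  assumes "p \<noteq> 0" "\<chi> \<noteq> 0" "poch (p / \<chi>) p M \<noteq> 0"
  shows "wp_ratio (inverse (p ^ M)) p \<chi> M = (- \<chi> * inverse (p ^ M)) ^ M * tri_power p M"
proof -
  have arg: "p / (\<chi> * inverse (p ^ M) * p ^ M) = p / \<chi>"
    using assms by simp
  have "poch (p / \<chi>) p M * ((\<chi> * inverse (p ^ M)) ^ M * tri_power p M)
      = (-1) ^ M * poch (\<chi> * inverse (p ^ M)) p M"
    using poch_reverse[of "\<chi> * inverse (p ^ M)" p M] assms unfolding arg by simp
  hence "poch (\<chi> * inverse (p ^ M)) p M
      = (-1) ^ M * (poch (p / \<chi>) p M * ((\<chi> * inverse (p ^ M)) ^ M * tri_power p M))"
    by (simp flip: power_mult_distrib)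
  also have "\<dots> = poch (p / \<chi>) p M * ((- \<chi> * inverse (p ^ M)) ^ M * tri_power p M)"
    by (simp add: power_minus[of "\<chi> * inverse (p ^ M)"])
  finally show ?thesis
    using assms by (simp add: wp_ratio_def)
qed

text \<open>Since \<open>a * p ^ M = 1\<close>, the numerator factor
  \<open>1 - \<chi> * a * p ^ i\<close> is a monomial times the denominator factor
  \<open>1 - p ^ (M - i) / \<chi>\<close>. Hence the pair of factors removed on the left when k
  grows by one is, up to a monomial, the inverse of the pair added on the right.\<close>

lemma wp_ratio_reflect:
  fixes p :: "'a::field"
  assumes "p \<noteq> 0" "\<chi> \<noteq> 0" "poch (p / \<chi>) p M \<noteq> 0" "k \<le> M"
  defines "a \<equiv> inverse (p ^ M)"
  shows "wp_ratio a p \<chi> (M - k) = wp_ratio a p \<chi> M * (p / (a * \<chi> ^ 2)) ^ k * wp_ratio a p \<chi> k"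
  using assms(4)
proof (induction k)
  case (Suc k)
  define l where "l = M - Suc k"
  have l: "M - k = Suc l" "M = l + Suc k" using Suc.prems by (auto simp: l_def)
  have num: "1 - \<chi> * a * p ^ i = - (\<chi> * a * p ^ i) * (1 - p ^ Suc j / \<chi>)" if "M = i + Suc j" for i j
    using assms(1,2) unfolding a_def that by (simp add: field_simps power_add)
  have den: "1 - p ^ Suc j / \<chi> \<noteq> 0" if "j < M" for j
    using assms(3) that by (auto simp: poch_nonzero_iff)
  have nzk: "1 - p ^ Suc k / \<chi> \<noteq> 0" and nzl: "1 - p ^ Suc l / \<chi> \<noteq> 0"
    using Suc.prems by (rule_tac den, simp add: l_def)+
  have a0: "a \<noteq> 0" using assms(1) by (simp add: a_def)
  have apM: "a * p ^ l * (p * p ^ k) = 1"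
    using assms(1) by (simp add: a_def l(2) power_add field_simps)
  have nk: "1 - \<chi> * a * p ^ k = - (\<chi> * a * p ^ k) * (1 - p ^ Suc l / \<chi>)"
    using l(2) by (intro num) simp
  have nl: "1 - \<chi> * a * p ^ l = - (\<chi> * a * p ^ l) * (1 - p ^ Suc k / \<chi>)"
    using l(2) by (intro num) simp
  have eq: "wp_ratio a p \<chi> l * ((1 - \<chi> * a * p ^ l) / (1 - p ^ Suc l / \<chi>))
      = wp_ratio a p \<chi> M * (p / (a * \<chi> ^ 2)) ^ k * wp_ratio a p \<chi> k"
    using Suc.IH Suc.prems unfolding l(1) wp_ratio_Suc[of a p \<chi> l] by simp
  have "wp_ratio a p \<chi> l
      = wp_ratio a p \<chi> M * (p / (a * \<chi> ^ 2)) ^ k * wp_ratio a p \<chi> k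
        * ((1 - p ^ Suc l / \<chi>) / (1 - \<chi> * a * p ^ l))"
  proof -
    have "1 - \<chi> * a * p ^ l \<noteq> 0"
      using nzk a0 assms(1,2) unfolding nl by simp
    moreover have gen: "u = r * (d / n)" if "u * (n / d) = r" "n \<noteq> 0" "d \<noteq> 0" for u n d r :: 'a
      using that by auto
    ultimately show ?thesis
      using nzl eq by (intro gen)
  qed
  also have "(1 - p ^ Suc l / \<chi>) / (1 - \<chi> * a * p ^ l)
      = p / (a * \<chi> ^ 2) * ((1 - \<chi> * a * p ^ k) / (1 - p ^ Suc k / \<chi>))"
  proof -
    have "p / (a * \<chi> ^ 2) * (- (\<chi> * a * p ^ k)) * (\<chi> * a * p ^ l) = - (a * p ^ l * (p * p ^ k))"
      using a0 assms(2) by (simp add: power2_eq_square)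
    hence "p / (a * \<chi> ^ 2) * (- (\<chi> * a * p ^ k)) * (\<chi> * a * p ^ l) = - 1"
      unfolding apM .
    hence "p / (a * \<chi> ^ 2) * (- (\<chi> * a * p ^ k)) = - 1 / (\<chi> * a * p ^ l)"
      using a0 assms(1,2) by (intro eq_divide_imp) simp_all
    hence "- 1 / (\<chi> * a * p ^ l) = p / (a * \<chi> ^ 2) * (- (\<chi> * a * p ^ k))" ..
    have gen: "A / (- s * B) = w * (- t * A / B)" if "- 1 / s = w * (- t)" for A B s t w :: 'a
    proof -
      have "A / (- s * B) = - 1 / s * (A / B)" by simp
      thus ?thesis unfolding that by simp
    qed
    show ?thesis unfolding nk nl by (rule gen) fact
  qed
  finally show ?case
    by (simp add: wp_ratio_Suc[of a p \<chi> k] l_def mult_ac)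
qed simp

text \<open>The values at \<open>M\<close> of the six ratios, with their signs and powers of
  \<open>tri_power p M\<close>, combine with \<open>Z ^ M\<close> to the constant \<open>a\<close>;
  the powers with exponent \<open>k\<close> combine to \<open>(Z * p ^ 2) ^ k\<close>. Here
  \<open>a\<close> and \<open>p ^ (2 * k)\<close> cancel against the denominator in
  \<open>lin\<close>, whose numerator supplies the minus sign.\<close>

lemma wp_term_reflect:
  fixes p :: "'a::field"
  assumes nz: "p \<noteq> 0" "x \<noteq> 0" "y \<noteq> 0" "z \<noteq> 0" "c \<noteq> 0" "e \<noteq> 0"
    and pn: "poch p p M \<noteq> 0" "poch (p / x) p M \<noteq> 0" "poch (p / y) p M \<noteq> 0" "poch (p / z) p M \<noteq> 0"
      "poch (p / c) p M \<noteq> 0" "poch (p / e) p M \<noteq> 0"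
    and k: "k \<le> M"
  defines "a \<equiv> inverse (p ^ M)"
  shows "wp_term a p x y z c e (M - k) = - wp_term a p x y z c e k"
proof -
  define Z where "Z = p ^ 2 / (a ^ 3 * x * y * z * c * e)"
  define T where "T = tri_power p M"
  define w where "w \<chi> = p / (a * \<chi> ^ 2)" for \<chi>
  have a0: "a \<noteq> 0" using nz by (simp add: a_def)
  have Z0: "Z \<noteq> 0" using a0 nz by (simp add: Z_def)
  have refl: "wp_ratio a p \<chi> (M - k) = wp_ratio a p \<chi> M * w \<chi> ^ k * wp_ratio a p \<chi> k"
    if "\<chi> \<noteq> 0" "poch (p / \<chi>) p M \<noteq> 0" for \<chi>
    unfolding w_def a_def using nz(1) that k by (intro wp_ratio_reflect)
  have full: "wp_ratio a p \<chi> M = (- \<chi> * a) ^ M * T" if "\<chi> \<noteq> 0" "poch (p / \<chi>) p M \<noteq> 0" for \<chi>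
    unfolding a_def T_def using nz(1) that by (intro wp_ratio_full)
  have aM: "a * p ^ M = 1" using nz by (simp add: a_def)
  have lin: "1 - a * p ^ (2 * (M - k)) = - (1 - a * p ^ (2 * k)) / (a * p ^ (2 * k))"
  proof -
    have "p ^ (2 * (M - k)) * p ^ (2 * k) = p ^ M * p ^ M"
    proof -
      have "2 * (M - k) + 2 * k = M + M" using k by simp
      thus ?thesis unfolding power_add[symmetric] by (simp only:)
    qed
    moreover have "a * u * (a * v) = a * a * (u * v)" "a * a * (v * v) = (a * v) * (a * v)" for u v
      by (simp_all add: mult_ac)
    ultimately have "a * p ^ (2 * (M - k)) * (a * p ^ (2 * k)) = (a * p ^ M) * (a * p ^ M)"
      by (simp only:)
    hence "a * p ^ (2 * (M - k)) * (a * p ^ (2 * k)) = 1" by (simp add: aM)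
    thus ?thesis using a0 nz by (simp add: eq_divide_eq algebra_simps)
  qed
  have ZM: "Z ^ (M - k) = Z ^ M / Z ^ k"
    using Z0 power_add[of Z "M - k" k] k by (simp add: eq_divide_eq)
  define P where "P = p ^ M"
  have P0: "P \<noteq> 0" using nz by (simp add: P_def)
  have T2: "T ^ 2 = P ^ M / P"
  proof -
    have "P * T ^ 2 = P ^ M"
      using tri_power_square[of p M] unfolding T_def P_def by (simp add: power_mult)
    thus ?thesis using P0 by (simp add: eq_divide_eq mult.commute)
  qed
  have const: "((- 1 * a) ^ M * T) * ((- x * a) ^ M * T) * ((- y * a) ^ M * T) * ((- z * a) ^ M * T)
      * ((- c * a) ^ M * T) * ((- e * a) ^ M * T) * Z ^ M = a"
  proof -
    have "((- 1 * a) ^ M * T) * ((- x * a) ^ M * T) * ((- y * a) ^ M * T) * ((- z * a) ^ M * T)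
      * ((- c * a) ^ M * T) * ((- e * a) ^ M * T) * Z ^ M
      = ((- 1 * a) * (- x * a) * (- y * a) * (- z * a) * (- c * a) * (- e * a) * Z) ^ M * (T ^ 2) ^ 3"
      unfolding power_mult_distrib by algebra
    also have "(- 1 * a) * (- x * a) * (- y * a) * (- z * a) * (- c * a) * (- e * a) * Z = a ^ 3 * p ^ 2"
      using nz a0 by (simp add: Z_def field_simps eval_nat_numeral)
    also have "(a ^ 3 * p ^ 2) ^ M * (T ^ 2) ^ 3 = (a ^ M) ^ 3 * P ^ 2 * (P ^ M / P) ^ 3"
      by (simp add: T2 P_def power_mult_distrib power_mult[symmetric] mult.commute)
    also have "\<dots> = ((a * P) ^ M) ^ 3 * (P ^ 2 / P ^ 3)"
      by (simp add: power_mult_distrib power_divide)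
    also have "\<dots> = inverse P"
      using P0 aM by (simp add: P_def[symmetric] eval_nat_numeral field_simps)
    also have "\<dots> = a"
      by (simp add: P_def a_def)
    finally show ?thesis .
  qed
  have wZ: "w 1 * w x * w y * w z * w c * w e / Z = Z * p ^ 2"
    using nz a0 by (simp add: w_def Z_def field_simps eval_nat_numeral)
  have "wp_term a p x y z c e (M - k)
    = - (1 - a * p ^ (2 * k)) / (a * p ^ (2 * k))
       * (((- 1 * a) ^ M * T) * ((- x * a) ^ M * T) * ((- y * a) ^ M * T) * ((- z * a) ^ M * T)
          * ((- c * a) ^ M * T) * ((- e * a) ^ M * T) * Z ^ M)
       * (w 1 * w x * w y * w z * w c * w e / Z) ^ k
       * (wp_ratio a p 1 k * wp_ratio a p x k * wp_ratio a p y k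
     * wp_ratio a p z k * wp_ratio a p c k * wp_ratio a p e k)"
  proof -
    have 1: "poch (p / 1) p M \<noteq> 0" "(1::'a) \<noteq> 0" using pn by auto
    show ?thesis
    unfolding wp_term_def Z_def[symmetric] lin ZM
      refl[OF 1(2,1)] refl[OF nz(2) pn(2)] refl[OF nz(3) pn(3)] refl[OF nz(4) pn(4)] refl[OF nz(5) pn(5)] refl[OF nz(6) pn(6)]
      full[OF 1(2,1)] full[OF nz(2) pn(2)] full[OF nz(3) pn(3)] full[OF nz(4) pn(4)] full[OF nz(5) pn(5)] full[OF nz(6) pn(6)]
    by (simp only: power_mult_distrib power_inverse divide_inverse mult_ac)
  qed
  also have "\<dots> = - wp_term a p x y z c e k"
    unfolding const wZ wp_term_def Z_def[symmetric] using a0 nz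
    by (simp add: power_mult_distrib power_mult) (simp add: algebra_simps)
  finally show ?thesis .
qed

lemma wp_term_eq_0:
  fixes p :: "'a::field"
  assumes "p \<noteq> 0" "M < k"
  shows "wp_term (inverse (p ^ M)) p x y z c e k = 0"
  using assms by (simp add: wp_term_def wp_ratio_def poch_inverse_power_eq_0)

text \<open>Terms beyond \<open>M\<close> contain the vanishing
  \<open>poch (inverse (p ^ M)) p k\<close>, and reflection negates the rest. This is why both
  choices of the upper summation limit can be treated alike.\<close>

lemma sum_wp_term_eq_0:
  fixes p :: "'a::field"
  assumes "2 \<noteq> (0::'a)"
    and "p \<noteq> 0" "x \<noteq> 0" "y \<noteq> 0" "z \<noteq> 0" "c \<noteq> 0" "e \<noteq> 0"
    and "poch p p M \<noteq> 0" "poch (p / x) p M \<noteq> 0" "poch (p / y) p M \<noteq> 0" "poch (p / z) p M \<noteq> 0"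
      "poch (p / c) p M \<noteq> 0" "poch (p / e) p M \<noteq> 0"
    and "M \<le> W"
  shows "(\<Sum>k\<le>W. wp_term (inverse (p ^ M)) p x y z c e k) = 0"
proof -
  let ?t = "wp_term (inverse (p ^ M)) p x y z c e"
  have "(\<Sum>k\<le>W. ?t k) = (\<Sum>k\<le>M. ?t k)"
    using assms(2,14) by (intro sum.mono_neutral_right) (auto simp: wp_term_eq_0)
  moreover have "(\<Sum>k\<le>M. ?t k) = (\<Sum>k\<le>M. ?t (M - k))"
    by (rule sum.reindex_bij_witness[of _ "\<lambda>k. M - k" "\<lambda>k. M - k"]) auto
  moreover have "(\<Sum>k\<le>M. ?t (M - k)) = - (\<Sum>k\<le>M. ?t k)"
    unfolding sum_negf[symmetric] using assms by (intro sum.cong refl wp_term_reflect) auto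
  ultimately show ?thesis
    using assms(1) by (metis add.right_inverse mult_2 mult_eq_0_iff)
qed

subsection \<open>Local rings with principal maximal ideal\<close>

text \<open>Abstracts the localisation at a prime element: whatever lies outside the multiples of
  \<open>\<pi>\<close> is invertible, and \<open>of_nat_notin\<close> gives the residue field
  characteristic zero. The latter makes 2 and 3 invertible for the interpolation and keeps geometric
  sums of powers congruent to 1 from vanishing.\<close>

locale local_subring =
  fixes V :: "'a::field set" and \<pi> :: 'a
  assumes one_closed: "1 \<in> V"
    and add_closed: "x \<in> V \<Longrightarrow> y \<in> V \<Longrightarrow> x + y \<in> V"
    and mult_closed: "x \<in> V \<Longrightarrow> y \<in> V \<Longrightarrow> x * y \<in> V"
    and uminus_closed: "x \<in> V \<Longrightarrow> - x \<in> V"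
    and pi_closed: "\<pi> \<in> V"
    and pi_nonzero: "\<pi> \<noteq> 0"
    and inverse_closed: "x \<in> V \<Longrightarrow> x \<notin> (*) \<pi> ` V \<Longrightarrow> inverse x \<in> V"
    and one_notin: "1 \<notin> (*) \<pi> ` V"
    and of_nat_notin: "n > 0 \<Longrightarrow> of_nat n \<notin> (*) \<pi> ` V"
begin

abbreviation I :: "'a set" where "I \<equiv> (*) \<pi> ` V"

definition U :: "'a set" where "U = V - I"

lemma diff_closed: "x \<in> V \<Longrightarrow> y \<in> V \<Longrightarrow> x - y \<in> V"
  using add_closed[of x "- y"] uminus_closed by simp

lemma zero_closed: "0 \<in> V"
  using diff_closed[OF one_closed one_closed] by simp

lemma of_nat_closed: "of_nat n \<in> V"
  by (induction n) (auto intro: zero_closed one_closed add_closed)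

lemma power_closed: "x \<in> V \<Longrightarrow> x ^ n \<in> V"
  by (induction n) (auto intro: one_closed mult_closed)

lemma sum_closed: "(\<And>i. i \<in> A \<Longrightarrow> f i \<in> V) \<Longrightarrow> sum f A \<in> V"
  by (induction A rule: infinite_finite_induct) (auto intro: zero_closed add_closed)

lemma prod_closed: "(\<And>i. i \<in> A \<Longrightarrow> f i \<in> V) \<Longrightarrow> prod f A \<in> V"
  by (induction A rule: infinite_finite_induct) (auto intro: one_closed mult_closed)

lemma U_closed: "x \<in> U \<Longrightarrow> x \<in> V"
  by (simp add: U_def)

lemma poch_closed: "x \<in> V \<Longrightarrow> p \<in> V \<Longrightarrow> poch x p k \<in> V"
  unfolding poch_def by (intro prod_closed diff_closed one_closed mult_closed power_closed)

lemma I_zero: "0 \<in> I"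
  by (auto intro!: image_eqI[of _ _ 0] zero_closed)

lemma I_closed: "x \<in> I \<Longrightarrow> x \<in> V"
  by (auto intro: mult_closed pi_closed)

lemma I_add: "x \<in> I \<Longrightarrow> y \<in> I \<Longrightarrow> x + y \<in> I"
  by (auto simp flip: distrib_left intro: add_closed)

lemma I_mult: "x \<in> I \<Longrightarrow> y \<in> V \<Longrightarrow> x * y \<in> I"
  by (auto simp: mult.assoc intro!: imageI mult_closed)

lemma I_uminus: "x \<in> I \<Longrightarrow> - x \<in> I"
  by (auto simp flip: mult_minus_right intro: uminus_closed)

lemma I_diff: "x \<in> I \<Longrightarrow> y \<in> I \<Longrightarrow> x - y \<in> I"
  using I_add[of x "- y"] I_uminus by simp

lemma I_diff_commute: "x - y \<in> I \<longleftrightarrow> y - x \<in> I"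
  using I_uminus[of "x - y"] I_uminus[of "y - x"] by auto

lemma I_sum: "(\<And>i. i \<in> A \<Longrightarrow> f i \<in> I) \<Longrightarrow> sum f A \<in> I"
  by (induction A rule: infinite_finite_induct) (auto intro: I_zero I_add)

lemma U_nonzero: "x \<in> U \<Longrightarrow> x \<noteq> 0"
  using I_zero by (auto simp: U_def)

lemma one_U: "1 \<in> U"
  using one_closed one_notin by (simp add: U_def)

lemma of_nat_U: "n > 0 \<Longrightarrow> of_nat n \<in> U"
  using of_nat_closed of_nat_notin by (simp add: U_def)

lemma inverse_closed': "x \<in> U \<Longrightarrow> inverse x \<in> V"
  by (simp add: U_def inverse_closed)

lemma divide_closed: "x \<in> V \<Longrightarrow> y \<in> U \<Longrightarrow> x / y \<in> V"
  by (simp add: divide_inverse mult_closed inverse_closed')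

lemma U_mult: "x \<in> U \<Longrightarrow> y \<in> U \<Longrightarrow> x * y \<in> U"
proof -
  assume xy: "x \<in> U" "y \<in> U"
  have "y \<in> I" if "x * y \<in> I"
  proof -
    have "x * y * inverse x = y" using U_nonzero[OF xy(1)] by simp
    thus ?thesis using I_mult[OF that inverse_closed'[OF xy(1)]] by metis
  qed
  thus ?thesis using xy by (auto simp: U_def mult_closed)
qed

lemma U_inverse: "x \<in> U \<Longrightarrow> inverse x \<in> U"
proof -
  assume x: "x \<in> U"
  have "1 \<in> I" if "inverse x \<in> I"
    using I_mult[OF that U_closed[OF x]] U_nonzero[OF x] by simp
  thus ?thesis using inverse_closed'[OF x] one_notin by (auto simp: U_def)
qed

lemma U_power: "x \<in> U \<Longrightarrow> x ^ n \<in> U"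
  by (induction n) (auto intro: one_U U_mult)

lemma U_prod: "(\<And>i. i \<in> A \<Longrightarrow> f i \<in> U) \<Longrightarrow> prod f A \<in> U"
  by (induction A rule: infinite_finite_induct) (auto intro: one_U U_mult)

lemma U_cong: "x \<in> U \<Longrightarrow> x - y \<in> I \<Longrightarrow> y \<in> U"
proof -
  assume xy: "x \<in> U" "x - y \<in> I"
  have "y \<in> V" using diff_closed[OF U_closed[OF xy(1)] I_closed[OF xy(2)]] by simp
  moreover have "x \<in> I" if "y \<in> I" using I_add[OF xy(2) that] by simp
  ultimately show ?thesis using xy(1) by (auto simp: U_def)
qed

lemma poch_U: "(\<And>j. j < k \<Longrightarrow> 1 - x * p ^ j \<in> U) \<Longrightarrow> poch x p k \<in> U"
  unfolding poch_def by (intro U_prod) auto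

lemma power_cong_I: "x \<in> V \<Longrightarrow> y \<in> V \<Longrightarrow> x - y \<in> I \<Longrightarrow> x ^ n - y ^ n \<in> I"
proof (induction n)
  case (Suc n)
  have "x ^ Suc n - y ^ Suc n = (x - y) * x ^ n + (x ^ n - y ^ n) * y"
    by (simp add: algebra_simps)
  thus ?case using Suc by (auto intro!: I_add I_mult power_closed)
qed (simp add: I_zero)

text \<open>Sequences behaving like the values \<^term>\<open>F (of_nat i * h)\<close> of a power series \<^term>\<open>F\<close> over
  \<^term>\<open>V\<close>: divided differences with step \<^term>\<open>h\<close> up to order \<^term>\<open>j\<close> remain in \<^term>\<open>V\<close>.\<close>

primrec nice :: "'a \<Rightarrow> nat \<Rightarrow> (nat \<Rightarrow> 'a) \<Rightarrow> bool" where
  "nice h 0 g \<longleftrightarrow> (\<forall>i. g i \<in> V)"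
| "nice h (Suc j) g \<longleftrightarrow> (\<forall>i. g i \<in> V) \<and> nice h j (\<lambda>i. (g (Suc i) - g i) / h)"

lemma nice_value: "nice h j g \<Longrightarrow> g i \<in> V"
  by (cases j) auto

lemma nice_Suc_down: "nice h (Suc j) g \<Longrightarrow> nice h j g"
proof (induction j arbitrary: g)
  case (Suc j)
  from Suc.prems have "\<forall>i. g i \<in> V" and "nice h (Suc j) (\<lambda>i. (g (Suc i) - g i) / h)"
    unfolding nice.simps(2)[of h "Suc j"] by blast+
  thus ?case
    using Suc.IH unfolding nice.simps(2)[of h j g] by blast
qed simp

lemma nice_shift: "nice h j g \<Longrightarrow> nice h j (\<lambda>i. g (Suc i))"
  by (induction j arbitrary: g) auto

lemma nice_const: "x \<in> V \<Longrightarrow> nice h j (\<lambda>_. x)"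
  by (induction j arbitrary: x) (auto intro: zero_closed)

lemma nice_add: "nice h j f \<Longrightarrow> nice h j g \<Longrightarrow> nice h j (\<lambda>i. f i + g i)"
proof (induction j arbitrary: f g)
  case (Suc j)
  have "(\<lambda>i. (f (Suc i) + g (Suc i) - (f i + g i)) / h) = (\<lambda>i. (f (Suc i) - f i) / h + (g (Suc i) - g i) / h)"
    by (simp add: fun_eq_iff add_divide_distrib diff_divide_distrib)
  thus ?case using Suc by (auto intro: add_closed)
qed (auto intro: add_closed)

text \<open>Leibniz rule for divided differences; one factor appears shifted, hence
  \<open>nice_shift\<close>.\<close>

lemma nice_mult: "nice h j f \<Longrightarrow> nice h j g \<Longrightarrow> nice h j (\<lambda>i. f i * g i)"
proof (induction j arbitrary: f g)
  case (Suc j)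
  have "(\<lambda>i. (f (Suc i) * g (Suc i) - f i * g i) / h)
      = (\<lambda>i. f (Suc i) * ((g (Suc i) - g i) / h) + g i * ((f (Suc i) - f i) / h))"
    by (simp add: fun_eq_iff diff_divide_distrib algebra_simps)
  moreover have "nice h j \<dots>"
  proof -
    have "nice h j (\<lambda>i. f (Suc i))" "nice h j g"
      using Suc.prems nice_Suc_down by (auto simp only: nice_shift[of h j f])
    moreover have "nice h j (\<lambda>i. (f (Suc i) - f i) / h)" "nice h j (\<lambda>i. (g (Suc i) - g i) / h)"
      using Suc.prems by simp_all
    ultimately show ?thesis
      by (intro nice_add Suc.IH)
  qed
  ultimately show ?case using Suc.prems by (auto intro: mult_closed)
qed (auto intro: mult_closed)

lemma nice_uminus: "nice h j f \<Longrightarrow> nice h j (\<lambda>i. - f i)"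
  using nice_mult[OF nice_const[of "-1"], of h j f] uminus_closed[OF one_closed] by simp

lemma nice_diff: "nice h j f \<Longrightarrow> nice h j g \<Longrightarrow> nice h j (\<lambda>i. f i - g i)"
  using nice_add[of h j f "\<lambda>i. - g i"] nice_uminus by simp

lemma nice_power: "nice h j f \<Longrightarrow> nice h j (\<lambda>i. f i ^ n)"
  by (induction n) (auto intro: nice_const one_closed nice_mult)

lemma nice_prod: "(\<And>k. k \<in> A \<Longrightarrow> nice h j (f k)) \<Longrightarrow> nice h j (\<lambda>i. \<Prod>k\<in>A. f k i)"
  by (induction A rule: infinite_finite_induct) (auto intro: nice_const one_closed nice_mult)

lemma nice_sum: "(\<And>k. k \<in> A \<Longrightarrow> nice h j (f k)) \<Longrightarrow> nice h j (\<lambda>i. \<Sum>k\<in>A. f k i)"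
  by (induction A rule: infinite_finite_induct) (auto intro: nice_const zero_closed nice_add)

lemma nice_linear:
  assumes "a \<in> V" "b \<in> V" "h \<in> V" "h \<noteq> 0"
  shows "nice h j (\<lambda>i. a + b * of_nat i * h)"
proof (cases j)
  case (Suc l)
  have "(\<lambda>i. (a + b * of_nat (Suc i) * h - (a + b * of_nat i * h)) / h) = (\<lambda>_. b)"
    using assms(4) by (simp add: fun_eq_iff field_simps)
  thus ?thesis
    using Suc assms by (auto intro!: add_closed mult_closed of_nat_closed nice_const)
qed (use assms in \<open>auto intro!: add_closed mult_closed of_nat_closed\<close>)

lemma nice_inverse: "nice h j f \<Longrightarrow> (\<And>i. f i \<in> U) \<Longrightarrow> nice h j (\<lambda>i. inverse (f i))"
proof (induction j)
  case (Suc j)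
  have nz: "f i \<noteq> 0" for i using Suc.prems(2) U_nonzero by blast
  have IH: "nice h j (\<lambda>i. inverse (f i))"
    using Suc nice_Suc_down by blast
  have "(\<lambda>i. (inverse (f (Suc i)) - inverse (f i)) / h)
      = (\<lambda>i. - ((f (Suc i) - f i) / h) * (inverse (f i) * inverse (f (Suc i))))"
    using nz by (simp add: fun_eq_iff divide_inverse algebra_simps)
  moreover have "nice h j \<dots>"
    using Suc.prems IH nice_shift[OF IH] by (intro nice_mult nice_uminus) auto
  ultimately show ?case
    using Suc.prems by (auto intro: inverse_closed')
qed (auto intro: inverse_closed')

lemma nice_divide: "nice h j f \<Longrightarrow> nice h j g \<Longrightarrow> (\<And>i. g i \<in> U) \<Longrightarrow> nice h j (\<lambda>i. f i / g i)"
  unfolding divide_inverse by (intro nice_mult nice_inverse) auto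

lemma nice_poch: "nice h j x \<Longrightarrow> nice h j p \<Longrightarrow> nice h j (\<lambda>i. poch (x i) (p i) k)"
  unfolding poch_def by (intro nice_prod nice_diff nice_mult nice_power nice_const one_closed)

text \<open>With zeros at 1, 2, 3 the third difference of \<open>g\<close> at 0 reduces to
  \<open>- g 0\<close>, and niceness of order 3 puts its quotient by \<open>h ^ 3\<close> into
  \<open>V\<close>.\<close>

lemma nice_third_difference:
  assumes "nice h 3 g" "g 1 = 0" "g 2 = 0" "g 3 = 0" "h \<noteq> 0"
  shows "\<exists>v\<in>V. g 0 = h ^ 3 * v"
proof -
  have idx: "3 = Suc (Suc (Suc 0))" "2 = Suc (Suc 0)" "1 = Suc 0"
    by (rule numeral_3_eq_3 numeral_2_eq_2 One_nat_def)+
  have "nice h (Suc (Suc (Suc 0))) g"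
    using assms(1) by (simp only: idx)
  hence "((((g (Suc (Suc (Suc 0))) - g (Suc (Suc 0))) / h - (g (Suc (Suc 0)) - g (Suc 0)) / h) / h
      - ((g (Suc (Suc 0)) - g (Suc 0)) / h - (g (Suc 0) - g 0) / h) / h) / h) \<in> V" (is "?v \<in> V")
    by simp
  moreover have "?v = - g 0 / h ^ 3"
    using assms(2-4) unfolding idx by (simp add: power_Suc)
  ultimately have "- (- g 0 / h ^ 3) \<in> V"
    using uminus_closed by metis
  thus ?thesis
    using assms(5) by (intro bexI[of _ "- (- g 0 / h ^ 3)"]) auto
qed

text \<open>Stronger than a congruence at every index: the quotient by \<open>\<pi>\<close> must
  again be nice, because it is this quotient whose third difference is taken later.\<close>

definition nice_cong :: "'a \<Rightarrow> nat \<Rightarrow> (nat \<Rightarrow> 'a) \<Rightarrow> (nat \<Rightarrow> 'a) \<Rightarrow> bool" where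
  "nice_cong h j f g \<longleftrightarrow> (\<exists>t. nice h j t \<and> (\<forall>i. f i - g i = \<pi> * t i))"

lemma nice_congI: "nice h j t \<Longrightarrow> (\<And>i. f i - g i = \<pi> * t i) \<Longrightarrow> nice_cong h j f g"
  by (auto simp: nice_cong_def)

lemma nice_cong_refl [simp]: "nice_cong h j f f"
  unfolding nice_cong_def by (rule exI[of _ "\<lambda>_. 0"]) (auto intro: nice_const zero_closed)

lemma nice_cong_const: "x - y \<in> I \<Longrightarrow> nice_cong h j (\<lambda>_. x) (\<lambda>_. y)"
  unfolding nice_cong_def by (auto intro: nice_const)

lemma nice_cong_value: "nice_cong h j f g \<Longrightarrow> f i - g i \<in> I"
  unfolding nice_cong_def by (auto dest: nice_value)

lemma nice_cong_add: "nice_cong h j f f' \<Longrightarrow> nice_cong h j g g' \<Longrightarrow> nice_cong h j (\<lambda>i. f i + g i) (\<lambda>i. f' i + g' i)"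
proof -
  assume "nice_cong h j f f'" "nice_cong h j g g'"
  then obtain s t where "nice h j s" "nice h j t" "\<And>i. f i - f' i = \<pi> * s i" "\<And>i. g i - g' i = \<pi> * t i"
    by (auto simp: nice_cong_def)
  hence "nice h j (\<lambda>i. s i + t i)" "(f i + g i) - (f' i + g' i) = \<pi> * (s i + t i)" for i
    by (simp_all add: nice_add distrib_left add_diff_add)
  thus ?thesis by (rule nice_congI)
qed

lemma nice_cong_mult:
  assumes "nice_cong h j f f'" "nice_cong h j g g'" "nice h j f" "nice h j g'"
  shows "nice_cong h j (\<lambda>i. f i * g i) (\<lambda>i. f' i * g' i)"
proof -
  from assms obtain s t where *: "nice h j s" "nice h j t" "\<And>i. f i - f' i = \<pi> * s i" "\<And>i. g i - g' i = \<pi> * t i"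
    by (auto simp: nice_cong_def)
  have "f i * g i - f' i * g' i = f i * (g i - g' i) + (f i - f' i) * g' i" for i
    by (simp add: algebra_simps)
  hence "f i * g i - f' i * g' i = \<pi> * (f i * t i + s i * g' i)" for i
    by (simp add: * algebra_simps)
  moreover have "nice h j (\<lambda>i. f i * t i + s i * g' i)"
    using * assms by (intro nice_add nice_mult)
  ultimately show ?thesis by (intro nice_congI)
qed

lemma nice_cong_uminus: "nice_cong h j f f' \<Longrightarrow> nice_cong h j (\<lambda>i. - f i) (\<lambda>i. - f' i)"
proof -
  assume "nice_cong h j f f'"
  then obtain s where "nice h j s" "\<And>i. f i - f' i = \<pi> * s i"
    by (auto simp: nice_cong_def)
  hence "nice h j (\<lambda>i. - s i)" "- f i - - f' i = \<pi> * - s i" for i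
    by (simp_all only: nice_uminus minus_diff_minus mult_minus_right)
  thus ?thesis by (rule nice_congI)
qed

lemma nice_cong_diff: "nice_cong h j f f' \<Longrightarrow> nice_cong h j g g' \<Longrightarrow> nice_cong h j (\<lambda>i. f i - g i) (\<lambda>i. f' i - g' i)"
  using nice_cong_add[of h j f f' "\<lambda>i. - g i" "\<lambda>i. - g' i"] nice_cong_uminus by simp

lemma nice_cong_sum:
  "(\<And>k. k \<in> A \<Longrightarrow> nice_cong h j (f k) (g k)) \<Longrightarrow> nice_cong h j (\<lambda>i. \<Sum>k\<in>A. f k i) (\<lambda>i. \<Sum>k\<in>A. g k i)"
  by (induction A rule: infinite_finite_induct) (auto intro: nice_cong_add)

lemma nice_cong_power:
  "nice_cong h j f g \<Longrightarrow> nice h j f \<Longrightarrow> nice h j g \<Longrightarrow> nice_cong h j (\<lambda>i. f i ^ n) (\<lambda>i. g i ^ n)"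
  by (induction n) (auto intro: nice_cong_mult nice_power)

lemma nice_cong_prod:
  "(\<And>k. k \<in> A \<Longrightarrow> nice_cong h j (f k) (g k)) \<Longrightarrow> (\<And>k. k \<in> A \<Longrightarrow> nice h j (f k)) \<Longrightarrow>
   (\<And>k. k \<in> A \<Longrightarrow> nice h j (g k)) \<Longrightarrow> nice_cong h j (\<lambda>i. \<Prod>k\<in>A. f k i) (\<lambda>i. \<Prod>k\<in>A. g k i)"
  by (induction A rule: infinite_finite_induct) (auto intro!: nice_cong_mult nice_prod)

lemma nice_cong_inverse:
  assumes "nice_cong h j f g" "nice h j f" "nice h j g" "\<And>i. f i \<in> U" "\<And>i. g i \<in> U"
  shows "nice_cong h j (\<lambda>i. inverse (f i)) (\<lambda>i. inverse (g i))"
proof -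
  from assms obtain s where s: "nice h j s" "\<And>i. f i - g i = \<pi> * s i"
    by (auto simp: nice_cong_def)
  have "inverse (f i) - inverse (g i) = - (f i - g i) * (inverse (f i) * inverse (g i))" for i
    using assms(4,5)[of i] U_nonzero by (simp add: algebra_simps)
  hence "inverse (f i) - inverse (g i) = \<pi> * (- s i * (inverse (f i) * inverse (g i)))" for i
    by (simp add: s algebra_simps)
  moreover have "nice h j (\<lambda>i. - s i * (inverse (f i) * inverse (g i)))"
    using s assms by (intro nice_mult nice_uminus nice_inverse)
  ultimately show ?thesis by (intro nice_congI)
qed

lemma nice_cong_divide:
  assumes "nice_cong h j f f'" "nice_cong h j g g'" "nice h j f" "nice h j g" "nice h j g'"
    "\<And>i. g i \<in> U" "\<And>i. g' i \<in> U"
  shows "nice_cong h j (\<lambda>i. f i / g i) (\<lambda>i. f' i / g' i)"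
  unfolding divide_inverse using assms by (intro nice_cong_mult nice_cong_inverse nice_inverse) auto

lemma nice_cong_poch:
  "nice_cong h j x x' \<Longrightarrow> nice_cong h j p p' \<Longrightarrow> nice h j x \<Longrightarrow> nice h j x' \<Longrightarrow> nice h j p \<Longrightarrow> nice h j p' \<Longrightarrow>
    nice_cong h j (\<lambda>i. poch (x i) (p i) k) (\<lambda>i. poch (x' i) (p' i) k)"
  unfolding poch_def
  by (intro nice_cong_prod nice_cong_diff nice_cong_mult nice_cong_power nice_diff nice_mult nice_power
      nice_const one_closed nice_cong_refl)

end

section \<open>Integrality of the very-well-poised terms and their sum modulo \<pi>\<close>

context local_subring
begin

text \<open>Collects what makes the denominators \<open>poch (p / \<chi>) p k\<close> units for all
  \<open>k \<le> n\<close>.\<close>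

definition admissible :: "'a \<Rightarrow> nat \<Rightarrow> 'a \<Rightarrow> bool" where
  "admissible p n \<chi> \<longleftrightarrow> \<chi> \<in> U \<and> (\<forall>l\<in>{1..n}. 1 - p ^ l / \<chi> \<in> U)"

lemma admissible_U: "admissible p n \<chi> \<Longrightarrow> \<chi> \<in> U"
  by (simp add: admissible_def)

lemma admissible_mono: "admissible p n \<chi> \<Longrightarrow> m \<le> n \<Longrightarrow> admissible p m \<chi>"
  by (auto simp: admissible_def)

lemma admissible_poch: "admissible p n \<chi> \<Longrightarrow> k \<le> n \<Longrightarrow> poch (p / \<chi>) p k \<in> U"
proof (rule poch_U)
  fix j assume "admissible p n \<chi>" "k \<le> n" "j < k"
  hence "1 - p ^ Suc j / \<chi> \<in> U" by (auto simp: admissible_def simp del: power_Suc)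
  thus "1 - p / \<chi> * p ^ j \<in> U" by simp
qed

text \<open>Being a unit depends only on the residue class, so every point of the interpolation line
  inherits admissibility from 1.\<close>

lemma admissible_cong:
  assumes "admissible p n 1" "p \<in> V" "\<chi> - 1 \<in> I"
  shows "admissible p n \<chi>"
proof -
  have chi: "\<chi> \<in> U"
    using U_cong[OF one_U, of \<chi>] assms(3) I_diff_commute by blast
  have "1 - p ^ l / \<chi> \<in> U" if "l \<in> {1..n}" for l
  proof -
    have pl: "1 - p ^ l \<in> U" using assms(1) that by (auto simp: admissible_def)
    have "(1 - p ^ l) - (1 - p ^ l / \<chi>) = (\<chi> - 1) * (- (p ^ l) / \<chi>)"
      using U_nonzero[OF chi] by (simp add: field_simps)
    moreover have "(\<chi> - 1) * (- (p ^ l) / \<chi>) \<in> I"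
      using assms chi by (intro I_mult divide_closed uminus_closed power_closed)
    ultimately have "(1 - p ^ l) - (1 - p ^ l / \<chi>) \<in> I"
      by (simp only:)
    with pl show ?thesis by (rule U_cong)
  qed
  thus ?thesis using chi by (simp add: admissible_def)
qed

lemma nice_wp_ratio:
  assumes "nice h j \<chi>" "\<And>i. admissible p n (\<chi> i)" "a \<in> V" "p \<in> V" "k \<le> n"
  shows "nice h j (\<lambda>i. wp_ratio a p (\<chi> i) k)"
  unfolding wp_ratio_def using assms
  by (intro nice_divide nice_poch nice_mult nice_const admissible_poch[OF assms(2)]) (auto dest: admissible_U)

lemma nice_cong_wp_ratio:
  assumes "nice h j \<chi>" "\<And>i. admissible p n (\<chi> i)" "a \<in> V" "a' \<in> V" "a - a' \<in> I" "p \<in> V" "k \<le> n"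
  shows "nice_cong h j (\<lambda>i. wp_ratio a p (\<chi> i) k) (\<lambda>i. wp_ratio a' p (\<chi> i) k)"
  unfolding wp_ratio_def using assms
  by (intro nice_cong_divide nice_cong_poch nice_cong_mult nice_cong_refl nice_cong_const
      nice_poch nice_divide nice_mult nice_const admissible_poch[OF assms(2)]) (auto dest: admissible_U)

context
  fixes h p c e :: 'a and j n :: nat and x y z :: "nat \<Rightarrow> 'a"
  assumes nxyz: "nice h j x" "nice h j y" "nice h j z"
    and ad: "\<And>i. admissible p n (x i)" "\<And>i. admissible p n (y i)" "\<And>i. admissible p n (z i)"
      "admissible p n c" "admissible p n e" "admissible p n 1"
    and p: "p \<in> U"
begin

lemma U_xyzce: "x i \<in> U" "y i \<in> U" "z i \<in> U" "c \<in> U" "e \<in> U"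
  using ad by (auto dest: admissible_U)

lemma nice_cong_wp_term:
  assumes "a \<in> U" "a' \<in> U" "a - a' \<in> I" "k \<le> n"
  shows "nice_cong h j (\<lambda>i. wp_term a p (x i) (y i) (z i) c e k) (\<lambda>i. wp_term a' p (x i) (y i) (z i) c e k)"
proof -
  have V: "a \<in> V" "a' \<in> V" "p \<in> V" "c \<in> V" "e \<in> V"
    using assms p U_xyzce U_closed by blast+
  define m1 where "m1 = 1 - a * p ^ (2 * k)"
  define m2 where "m2 = 1 - a' * p ^ (2 * k)"
  have m: "m1 \<in> V" "m2 \<in> V"
    unfolding m1_def m2_def by (intro diff_closed one_closed mult_closed power_closed V)+
  have "(a - a') * - (p ^ (2 * k)) \<in> I"
    by (intro I_mult assms uminus_closed power_closed V)
  moreover have "(a - a') * - (p ^ (2 * k)) = m1 - m2"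
    by (simp add: m1_def m2_def algebra_simps)
  ultimately have mc: "nice_cong h j (\<lambda>_. m1) (\<lambda>_. m2)"
    by (intro nice_cong_const) simp
  have a3: "nice_cong h j (\<lambda>_. a ^ 3) (\<lambda>_. a' ^ 3)"
    by (intro nice_cong_const power_cong_I V assms)
  have denU: "b ^ 3 * x i * y i * z i * c * e \<in> U" if "b \<in> U" for b i
    using that U_xyzce by (intro U_mult U_power)
  have den: "nice h j (\<lambda>i. b ^ 3 * x i * y i * z i * c * e)" if "b \<in> U" for b
    using nxyz V U_closed[OF that] by (intro nice_mult nice_const power_closed)
  have quot: "nice h j (\<lambda>i. p ^ 2 / (b ^ 3 * x i * y i * z i * c * e))" if "b \<in> U" for b
    using den[OF that] denU[OF that] by (intro nice_divide nice_const power_closed V)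
  have "nice_cong h j (\<lambda>i. a ^ 3 * x i * y i * z i * c * e) (\<lambda>i. a' ^ 3 * x i * y i * z i * c * e)"
    using nxyz V by (intro nice_cong_mult a3 nice_cong_refl nice_mult nice_const power_closed)
  hence quotc: "nice_cong h j (\<lambda>i. p ^ 2 / (a ^ 3 * x i * y i * z i * c * e)) (\<lambda>i. p ^ 2 / (a' ^ 3 * x i * y i * z i * c * e))"
    using den denU assms by (intro nice_cong_divide nice_cong_refl nice_const power_closed V)
  have ratio: "nice h j (\<lambda>i. wp_ratio b p (x i) k)" "nice h j (\<lambda>i. wp_ratio b p (y i) k)"
      "nice h j (\<lambda>i. wp_ratio b p (z i) k)" "nice h j (\<lambda>i. wp_ratio b p c k)" "nice h j (\<lambda>i. wp_ratio b p e k)"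
      "nice h j (\<lambda>i. wp_ratio b p 1 k)" if "b \<in> V" for b
    using that nxyz ad assms(4) by (intro nice_wp_ratio[where n = n] nice_const one_closed V; simp)+
  have ratioc: "nice_cong h j (\<lambda>i. wp_ratio a p (x i) k) (\<lambda>i. wp_ratio a' p (x i) k)"
      "nice_cong h j (\<lambda>i. wp_ratio a p (y i) k) (\<lambda>i. wp_ratio a' p (y i) k)"
      "nice_cong h j (\<lambda>i. wp_ratio a p (z i) k) (\<lambda>i. wp_ratio a' p (z i) k)"
      "nice_cong h j (\<lambda>i. wp_ratio a p c k) (\<lambda>i. wp_ratio a' p c k)"
      "nice_cong h j (\<lambda>i. wp_ratio a p e k) (\<lambda>i. wp_ratio a' p e k)"
      "nice_cong h j (\<lambda>i. wp_ratio a p 1 k) (\<lambda>i. wp_ratio a' p 1 k)"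
    using nxyz ad assms by (intro nice_cong_wp_ratio[where n = n] nice_const one_closed V; simp)+
  show ?thesis
    unfolding wp_term_def m1_def[symmetric] m2_def[symmetric]
    by (intro nice_cong_mult nice_cong_power nice_mult nice_power nice_const[OF m(1)] nice_const[OF m(2)]
        mc quotc ratioc ratio[OF V(1)] ratio[OF V(2)] quot assms)
qed

text \<open>Modulo \<open>\<pi>\<close> the parameter \<open>a\<close> may be replaced by the
  inverse of \<open>p ^ M\<close>, where the sum is exactly 0 by antisymmetry. The sequences
  \<open>x\<close>, \<open>y\<close>, \<open>z\<close> are left alone, which keeps the quotient by
  \<open>\<pi>\<close> nice.\<close>

lemma nice_cong_sum_wp_term:
  assumes "a \<in> U" "a * p ^ M - 1 \<in> I" "M \<le> W" "W \<le> n"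
  shows "nice_cong h j (\<lambda>i. \<Sum>k\<le>W. wp_term a p (x i) (y i) (z i) c e k) (\<lambda>_. 0)"
proof -
  define a' where "a' = inverse (p ^ M)"
  have a': "a' \<in> U" unfolding a'_def by (intro U_inverse U_power p)
  have "a - a' = (a * p ^ M - 1) * a'"
    using U_nonzero[OF p] by (simp add: a'_def algebra_simps)
  hence "a - a' \<in> I" using assms(2) a' by (auto intro: I_mult U_closed)
  hence "nice_cong h j (\<lambda>i. \<Sum>k\<le>W. wp_term a p (x i) (y i) (z i) c e k)
      (\<lambda>i. \<Sum>k\<le>W. wp_term a' p (x i) (y i) (z i) c e k)"
    using assms a' by (intro nice_cong_sum nice_cong_wp_term) auto
  moreover have "(\<Sum>k\<le>W. wp_term a' p (x i) (y i) (z i) c e k) = 0" for i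
    unfolding a'_def
  proof (rule sum_wp_term_eq_0)
    show "(2::'a) \<noteq> 0" using U_nonzero[OF of_nat_U[of 2]] by simp
    have "M \<le> n" using assms by simp
    hence pn: "poch (p / \<chi>) p M \<noteq> 0" if "admissible p n \<chi>" for \<chi>
      using U_nonzero[OF admissible_poch[OF that]] by simp
    show "poch p p M \<noteq> 0" "poch (p / x i) p M \<noteq> 0" "poch (p / y i) p M \<noteq> 0" "poch (p / z i) p M \<noteq> 0"
      "poch (p / c) p M \<noteq> 0" "poch (p / e) p M \<noteq> 0"
      using pn[OF ad(6)] pn[OF ad(1)] pn[OF ad(2)] pn[OF ad(3)] pn[OF ad(4)] pn[OF ad(5)] by simp_all
  qed (use p U_xyzce[THEN U_nonzero] U_nonzero assms in auto)
  ultimately show ?thesis by simp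
qed

lemma nice_watson_term:
  assumes "a \<in> U" "k \<le> n"
  shows "nice h j (\<lambda>i. watson_term a p M (x i) (y i) (z i) c e k)"
proof -
  have "poch (p / c) p k \<in> U" "poch (p / e) p k \<in> U" "poch p p k \<in> U"
    using admissible_poch[OF ad(4)] admissible_poch[OF ad(5)] admissible_poch[OF ad(6)] assms by auto
  thus ?thesis
    unfolding watson_term_def using nxyz U_closed[OF p] assms U_xyzce U_xyzce[THEN U_closed] U_closed[OF assms(1)] one_closed
    by (intro nice_mult nice_poch nice_power nice_divide nice_const U_mult)
      (auto intro!: divide_closed mult_closed power_closed poch_closed intro: U_mult)
qed

end

section \<open>The congruence modulo \<pi> ^ 4\<close>

lemma prod_one_minus_approx:
  assumes "finite A" "s \<in> V" "\<And>i. i \<in> A \<Longrightarrow> g i \<in> V"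
  shows "\<exists>v\<in>V. (\<Prod>i\<in>A. 1 - s * g i) = 1 - s * (\<Sum>i\<in>A. g i) + s ^ 2 * v"
  using assms(1,3)
proof (induction A rule: finite_induct)
  case empty
  show ?case using zero_closed by (intro bexI[of _ 0]) auto
next
  case (insert b A)
  then obtain v where v: "v \<in> V" "(\<Prod>i\<in>A. 1 - s * g i) = 1 - s * (\<Sum>i\<in>A. g i) + s ^ 2 * v" by auto
  have "(\<Prod>i\<in>insert b A. 1 - s * g i) = (1 - s * g b) * (1 - s * (\<Sum>i\<in>A. g i) + s ^ 2 * v)"
    using insert v by simp
  also have "\<dots> = 1 - s * (\<Sum>i\<in>insert b A. g i) + s ^ 2 * (v - s * g b * v + g b * (\<Sum>i\<in>A. g i))"
    using insert by (simp add: algebra_simps power2_eq_square)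
  finally show ?case
    using insert v assms(2)
    by (intro bexI[of _ "v - s * g b * v + g b * (\<Sum>i\<in>A. g i)"]) (auto intro!: add_closed diff_closed mult_closed sum_closed)
qed

lemma poch_shift_eq_prod: "poch (p * w) p M = (\<Prod>i=1..M. 1 - w * p ^ i)"
proof -
  have "(\<Prod>i=1..M. 1 - w * p ^ i) = (\<Prod>j<M. 1 - w * p ^ Suc j)"
    by (rule prod.reindex_bij_witness[of _ Suc "\<lambda>i. i - 1"]) auto
  thus ?thesis by (simp add: poch_def mult_ac)
qed

text \<open>Watson's transformation with \<open>poch (p / x) p M\<close> inserted above and below.
  The denominator is then symmetric in the three parameters and the product above depends on the
  root alone, so one formula serves whichever parameter is the root.\<close>

lemma sum_wp_term_at_root:
  assumes "p \<in> U" "a \<in> U" "x * (a * p ^ M) = 1" "\<And>i. a * p ^ i \<noteq> 1" "M \<le> W"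
    "admissible p M 1" "admissible p M x" "admissible p M y" "admissible p M z" "admissible p M c" "admissible p M e"
  shows "(\<Sum>k\<le>W. wp_term a p x y z c e k)
    = (1 - a * p ^ M) / (a * x * y * z) ^ M * (poch (p * x) p M * poch (p / x) p M)
      / (poch (p / x) p M * poch (p / y) p M * poch (p / z) p M)
      * (\<Sum>k\<le>M. watson_term a p M x y z c e k)"
proof -
  have nz: "p \<noteq> 0" "a \<noteq> 0" "y \<noteq> 0" "z \<noteq> 0" "c \<noteq> 0" "e \<noteq> 0"
    using assms by (auto dest!: admissible_U U_nonzero)
  have pn: "poch (p / \<chi>) p M \<noteq> 0" if "admissible p M \<chi>" for \<chi>
    using U_nonzero[OF admissible_poch[OF that]] by simp
  have xa: "x * a = inverse (p ^ M)"
    using assms(3) by (metis inverse_unique mult.assoc mult.commute)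
  have "(\<Sum>k\<le>W. wp_term a p x y z c e k) = (\<Sum>k\<le>M. wp_term a p x y z c e k)"
    using assms(5) nz(1) xa
    by (intro sum.mono_neutral_right) (auto simp: wp_term_def wp_ratio_def poch_inverse_power_eq_0)
  also have "\<dots> = (1 - a * p ^ M) / (a * x * y * z) ^ M * poch (p * x) p M / (poch (p / y) p M * poch (p / z) p M)
      * (\<Sum>k\<le>M. watson_term a p M x y z c e k)"
    using nz assms pn[OF assms(6)] by (intro watson_transformation pn) auto
  finally show ?thesis using pn[OF assms(7)] by simp
qed

theorem sum_wp_term_cong_fourth_power:
  assumes a: "a \<in> U" and p: "p \<in> U" and ad: "admissible p W 1" "admissible p W c" "admissible p W e"
    and M: "M \<le> W" and aM: "1 - a * p ^ M \<in> I" and an: "\<And>i. a * p ^ i \<noteq> 1"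
  shows "\<exists>v\<in>V. (\<Sum>k\<le>W. wp_term a p 1 1 1 c e k)
      - (1 - a * p ^ M) / a ^ M / poch p p M * (1 - (1 - a * p ^ M) ^ 2 * (\<Sum>i=1..M. p ^ i / (1 - p ^ i) ^ 2))
        * (\<Sum>k\<le>M. watson_term a p M 1 1 1 c e k) = \<pi> ^ 4 * v"
proof -
  define t where "t = a * p ^ M"
  define u where "u = inverse t"
  define h where "h = u - 1"
  have tU: "t \<in> U" unfolding t_def by (intro U_mult a U_power p)
  have uU: "u \<in> U" unfolding u_def by (intro U_inverse tU)
  have t0: "t \<noteq> 0" and t1: "t \<noteq> 1" using U_nonzero[OF tU] an[of M] by (auto simp: t_def)
  have tI: "1 - t \<in> I" using aM by (simp add: t_def)
  have h_eq: "h = (1 - t) * u" using t0 by (simp add: h_def u_def field_simps)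
  have h0: "h \<noteq> 0" using t1 t0 by (simp add: h_eq u_def)
  have hI: "h \<in> I" unfolding h_eq by (intro I_mult tI U_closed uU)
  have hV: "h \<in> V" by (rule I_closed[OF hI])
  define x where "x i = 1 + 1 * of_nat i * h" for i
  define y where "y i = 1 + inverse (of_nat 2) * of_nat i * h" for i
  define z where "z i = 1 + inverse (of_nat 3) * of_nat i * h" for i
  have inv: "inverse (of_nat 2 :: 'a) \<in> V" "inverse (of_nat 3 :: 'a) \<in> V"
    by (auto intro!: inverse_closed' of_nat_U simp del: of_nat_numeral)
  have nz23: "(of_nat 2 :: 'a) \<noteq> 0" "(of_nat 3 :: 'a) \<noteq> 0"
    using U_nonzero[OF of_nat_U[of 2]] U_nonzero[OF of_nat_U[of 3]] by auto
  have nxyz: "nice h 3 x" "nice h 3 y" "nice h 3 z"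
    unfolding x_def y_def z_def by (intro nice_linear one_closed hV h0 inv)+
  have lin: "1 + b * of_nat i * h - 1 \<in> I" if "b \<in> V" for b i
    using I_mult[OF hI mult_closed[OF that of_nat_closed[of i]]] by (simp add: mult_ac)
  have pV: "p \<in> V" by (rule U_closed[OF p])
  have adxyz: "admissible p W (x i)" "admissible p W (y i)" "admissible p W (z i)" for i
    unfolding x_def y_def z_def by (intro admissible_cong[OF ad(1) pV] lin one_closed inv)+
  note ctxt = nxyz adxyz ad(2,3,1) p
  have adM: "admissible p M \<chi>" if "admissible p W \<chi>" for \<chi>
    using that M by (rule admissible_mono)
  have pU: "poch (p / \<chi>) p M \<in> U" if "admissible p W \<chi>" for \<chi>
    using that M by (rule admissible_poch)
  have xyzU: "x i \<in> U" "y i \<in> U" "z i \<in> U" for i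
    using adxyz by (auto dest: admissible_U)

  define f where "f i = (\<Sum>k\<le>W. wp_term a p (x i) (y i) (z i) c e k)" for i
  define S where "S i = (\<Sum>k\<le>M. watson_term a p M (x i) (y i) (z i) c e k)" for i
  \<comment> \<open>The numerator product of \<open>sum_wp_term_at_root\<close> at the root
    \<open>u\<close>, kept constant in \<open>g\<close> for every index.\<close>
  define C where "C = poch (p * u) p M * poch (p / u) p M"
  define g where "g i = C / ((a * x i * y i * z i) ^ M * (poch (p / x i) p M * poch (p / y i) p M * poch (p / z i) p M)) * S i" for i
  have CV: "C \<in> V" unfolding C_def using uU pV by (auto intro!: mult_closed poch_closed divide_closed dest: U_closed)
  have nS: "nice h 3 S" unfolding S_def using M a by (intro nice_sum nice_watson_term[OF ctxt]) auto
  have ng: "nice h 3 g"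
    unfolding g_def
    by (intro nice_mult nice_divide nice_const CV nS nice_power nice_poch nxyz U_closed[OF a] pV U_mult U_power xyzU a pU adxyz)
  have "nice_cong h 3 f (\<lambda>_. 0)"
    unfolding f_def using M aM a by (intro nice_cong_sum_wp_term[OF ctxt]) (auto simp: I_diff_commute)
  then obtain \<tau> where \<tau>: "nice h 3 \<tau>" "\<And>i. f i = \<pi> * \<tau> i"
    by (auto simp: nice_cong_def)
  obtain s where s: "s \<in> V" "1 - t = \<pi> * s" using tI by auto
  \<comment> \<open>The difference of the two sides divided by \<open>\<pi>\<close>. Dividing before
    differences are taken secures one factor \<open>\<pi>\<close> in addition to those of
    \<open>h ^ 3\<close>.\<close>
  define D where "D i = \<tau> i - s * g i" for i
  have D: "\<pi> * D i = f i - (1 - t) * g i" for i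
    by (simp add: D_def \<tau>(2) s(2) algebra_simps)
  have nD: "nice h 3 D" unfolding D_def by (intro nice_diff nice_mult nice_const \<tau> ng s)
  have ut: "u * (a * p ^ M) = 1" using t0 by (simp add: u_def flip: t_def)
  have root: "(\<Sum>k\<le>W. wp_term a p u y' z' c e k)
    = (1 - t) * (C / ((a * u * y' * z') ^ M * (poch (p / u) p M * poch (p / y') p M * poch (p / z') p M))
       * (\<Sum>k\<le>M. watson_term a p M u y' z' c e k))"
    if "admissible p W u" "admissible p W y'" "admissible p W z'" for y' z'
    using sum_wp_term_at_root[OF p a ut an M adM[OF ad(1)] adM[OF that(1)] adM[OF that(2)] adM[OF that(3)] adM[OF ad(2)] adM[OF ad(3)]]
    by (simp add: C_def t_def mult.assoc)
  have at: "x 1 = u" "y 2 = u" "z 3 = u"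
    using nz23 by (simp_all add: x_def y_def z_def h_def)
  have adu: "admissible p W u" using adxyz(1)[of 1] at(1) by simp
  have "\<pi> * D 1 = 0"
    unfolding D f_def g_def S_def at by (subst root[OF adu adxyz(2,3)]) simp
  \<comment> \<open>Here the root sits in the second parameter; symmetry moves it to the
    front.\<close>
  moreover have "\<pi> * D 2 = 0"
    unfolding D f_def g_def S_def at wp_term_swap_xy[of a p "x 2" u] watson_term_swap_xy[of a p M "x 2" u]
    by (subst root[OF adu adxyz(1,3)]) (simp add: mult_ac)
  moreover have "\<pi> * D 3 = 0"
    unfolding D f_def g_def S_def at wp_term_swap_xz[of a p "x 3" "y 3" u] watson_term_swap_xz[of a p M "x 3" "y 3" u]
    by (subst root[OF adu adxyz(2,1)]) (simp add: mult_ac)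
  ultimately obtain v where v: "v \<in> V" "D 0 = h ^ 3 * v"
    using nice_third_difference[OF nD _ _ _ h0] pi_nonzero by auto
  obtain h' where h': "h' \<in> V" "h = \<pi> * h'" using hI by auto
  have D0: "f 0 - (1 - t) * g 0 = \<pi> ^ 4 * (h' ^ 3 * v)"
    unfolding D[symmetric] v(2) h'(2) by (simp add: power_mult_distrib eval_nat_numeral mult_ac)

  define P where "P = poch p p M"
  have P1: "P \<in> U" using pU[OF ad(1)] by (simp add: P_def)
  have xyz0: "x 0 = 1" "y 0 = 1" "z 0 = 1" by (simp_all add: x_def y_def z_def)
  define \<gamma> where "\<gamma> i = p ^ i / (1 - p ^ i) ^ 2" for i
  have pi_U: "1 - p ^ i \<in> U" if "i \<in> {1..M}" for i
    using ad(1) M that by (auto simp: admissible_def)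
  have \<gamma>V: "\<gamma> i \<in> V" if "i \<in> {1..M}" for i
    unfolding \<gamma>_def using pi_U[OF that] pV by (intro divide_closed power_closed U_power)
  \<comment> \<open>As t u = 1, the identity (1 - u y)(1 - t y) = (1 - y)^2 - \<sigma> y holds for
    all y. Taken at y = p^i it makes each factor of \<open>C / P ^ 2\<close> equal to
    \<open>1 - \<sigma> * \<gamma> i\<close>.\<close>
  define \<sigma> where "\<sigma> = (1 - t) ^ 2 * u"
  have \<sigma>V: "\<sigma> \<in> V" unfolding \<sigma>_def using uU I_closed[OF tI] by (auto intro!: mult_closed power_closed dest: U_closed)
  have CP: "C / P ^ 2 = (\<Prod>i=1..M. 1 - \<sigma> * \<gamma> i)"
  proof -
    have "C / P ^ 2 = (\<Prod>i=1..M. (1 - u * p ^ i) * (1 - t * p ^ i) / (1 - p ^ i) ^ 2)"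
    proof -
      have "p / u = p * t" by (simp add: u_def divide_inverse)
      hence "C = (\<Prod>i=1..M. 1 - u * p ^ i) * (\<Prod>i=1..M. 1 - t * p ^ i)"
        unfolding C_def poch_shift_eq_prod[symmetric] by simp
      moreover have "P = (\<Prod>i=1..M. 1 - p ^ i)"
        using poch_shift_eq_prod[of p 1 M] by (simp add: P_def)
      ultimately show ?thesis
        by (simp only: prod_dividef prod.distrib prod_power_distrib)
    qed
    also have "\<dots> = (\<Prod>i=1..M. 1 - \<sigma> * \<gamma> i)"
    proof (intro prod.cong refl)
      fix i assume "i \<in> {1..M}"
      hence nz: "1 - p ^ i \<noteq> 0" using pi_U U_nonzero by blast
      have "(1 - u * p ^ i) * (1 - t * p ^ i) = (1 - p ^ i) ^ 2 - \<sigma> * p ^ i"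
      proof -
        have "t * u = 1" using t0 by (simp add: u_def)
        hence "(1 - u * P) * (1 - t * P) = (1 - P) ^ 2 - (1 - t) ^ 2 * u * P" for P by algebra
        thus ?thesis unfolding \<sigma>_def .
      qed
      thus "(1 - u * p ^ i) * (1 - t * p ^ i) / (1 - p ^ i) ^ 2 = 1 - \<sigma> * \<gamma> i"
        using nz by (simp add: \<gamma>_def diff_divide_distrib)
    qed
    finally show ?thesis .
  qed
  obtain w where w: "w \<in> V" "C / P ^ 2 = 1 - \<sigma> * (\<Sum>i=1..M. \<gamma> i) + \<sigma> ^ 2 * w"
    using prod_one_minus_approx[of "{1..M}" \<sigma> \<gamma>] \<sigma>V \<gamma>V unfolding CP by auto
  define \<Gamma> where "\<Gamma> = (\<Sum>i=1..M. \<gamma> i)"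
  have \<Gamma>V: "\<Gamma> \<in> V" unfolding \<Gamma>_def by (intro sum_closed \<gamma>V)
  \<comment> \<open>Because u = 1 + (1 - t) u, replacing \<sigma> by (1 - t)^2 costs only a multiple
    of (1 - t)^3; with the prefactor 1 - t the error is a fourth power.\<close>
  have \<sigma>: "\<sigma> = (1 - t) ^ 2 + (1 - t) ^ 3 * u"
  proof -
    have "t * u = 1" using t0 by (simp add: u_def)
    thus ?thesis unfolding \<sigma>_def by algebra
  qed
  define E where "E = - u * \<Gamma> + (1 - t) * u ^ 2 * w"
  have EV: "E \<in> V" unfolding E_def
    by (intro add_closed mult_closed uminus_closed power_closed U_closed[OF uU] \<Gamma>V w(1) I_closed[OF tI])
  have CE: "C / P ^ 2 = (1 - (1 - t) ^ 2 * \<Gamma>) + (1 - t) ^ 3 * E"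
  proof -
    have "\<sigma> ^ 2 * w = (1 - t) ^ 3 * ((1 - t) * u ^ 2 * w)" 
      unfolding \<sigma>_def by (simp add: power_mult_distrib eval_nat_numeral)
    thus ?thesis unfolding w(2) \<Gamma>_def[symmetric] E_def
      by (simp add: \<sigma> algebra_simps)
  qed
  have g0: "(1 - t) * g 0 = (1 - t) / a ^ M / P * (C / P ^ 2) * S 0"
    by (simp add: g_def xyz0 P_def[symmetric] eval_nat_numeral mult_ac)
  define B where "B = S 0 / (a ^ M * P)"
  have BV: "B \<in> V" unfolding B_def using nS a P1 by (intro divide_closed nice_value[of h 3 S] U_mult U_power)
  have g0': "(1 - t) * g 0 = (1 - t) / a ^ M / P * (1 - (1 - t) ^ 2 * \<Gamma>) * S 0 + \<pi> ^ 4 * (s ^ 4 * E * B)"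
  proof -
    have "(1 - t) * g 0 = (1 - t) / a ^ M / P * (1 - (1 - t) ^ 2 * \<Gamma>) * S 0 + (1 - t) ^ 4 * E * B"
    proof -
      have "n / A / Q * (X + n ^ 3 * E) * R = n / A / Q * X * R + n ^ 4 * E * (R / (A * Q))" for n A Q X R
        by (simp add: algebra_simps eval_nat_numeral add_divide_distrib)
      thus ?thesis unfolding g0 CE B_def .
    qed
    thus ?thesis by (simp add: s(2) power_mult_distrib mult_ac)
  qed
  have "f 0 - (1 - t) / a ^ M / P * (1 - (1 - t) ^ 2 * \<Gamma>) * S 0 = \<pi> ^ 4 * (h' ^ 3 * v + s ^ 4 * E * B)"
  proof -
    have "b - d = A * (x + y)" if "b - Y = A * x" "Y = d + A * y" for b d A x y Y :: 'a
      using that(1) unfolding that(2) by (simp add: algebra_simps)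
    thus ?thesis using D0 g0' by blast
  qed
  moreover have "h' ^ 3 * v + s ^ 4 * E * B \<in> V"
    using h' v s EV BV by (intro add_closed mult_closed power_closed)
  ultimately show ?thesis
    unfolding f_def S_def xyz0 \<Gamma>_def \<gamma>_def P_def t_def by blast
qed

end

section \<open>Order m < n: blocks of length m and the congruence modulo \<pi>\<close>

lemma exists_mod_eq_in_window:
  fixes m b k :: nat
  assumes "b < m"
  shows "\<exists>j\<in>{k..<k + m}. j mod m = b"
proof -
  define t where "t = (b + (m - k mod m)) mod m"
  have "(k + t) mod m = (k mod m + (b + (m - k mod m))) mod m"
    by (simp add: t_def mod_simps)
  also have "k mod m + (b + (m - k mod m)) = b + m"
    using assms mod_less_divisor[of m k] by linarith
  finally have "(k + t) mod m = b" using assms by simp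
  moreover have "t < m" using assms by (simp add: t_def)
  ultimately show ?thesis by (intro bexI[of _ "k + t"]) auto
qed

context local_subring
begin

lemma I_cong_mult: "x - x' \<in> I \<Longrightarrow> y - y' \<in> I \<Longrightarrow> x \<in> V \<Longrightarrow> y' \<in> V \<Longrightarrow> x * y - x' * y' \<in> I"
proof -
  assume *: "x - x' \<in> I" "y - y' \<in> I" "x \<in> V" "y' \<in> V"
  have "x * y - x' * y' = (x - x') * y' + (y - y') * x" by (simp add: algebra_simps)
  thus ?thesis using * by (auto intro!: I_add I_mult)
qed

lemma I_cong_poch:
  assumes "x - x' \<in> I" "x \<in> V" "x' \<in> V" "p \<in> V"
  shows "poch x p k - poch x' p k \<in> I"
proof (induction k)
  case (Suc k)
  have "(1 - x * p ^ k) - (1 - x' * p ^ k) = (x - x') * - (p ^ k)" by (simp add: algebra_simps)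
  hence "(1 - x * p ^ k) - (1 - x' * p ^ k) \<in> I"
    using I_mult[OF assms(1), of "- (p ^ k)"] assms by (simp only: uminus_closed power_closed)
  thus ?case unfolding poch_Suc using Suc assms
    by (intro I_cong_mult poch_closed diff_closed one_closed mult_closed power_closed)
qed (simp add: I_zero)

lemma I_cong_divide: "x - x' \<in> I \<Longrightarrow> y - y' \<in> I \<Longrightarrow> x \<in> V \<Longrightarrow> y \<in> U \<Longrightarrow> y' \<in> U \<Longrightarrow> x / y - x' / y' \<in> I"
proof -
  assume *: "x - x' \<in> I" "y - y' \<in> I" "x \<in> V" "y \<in> U" "y' \<in> U"
  have "inverse y - inverse y' = (y - y') * (- inverse y * inverse y')"
    using * U_nonzero by (simp add: algebra_simps)
  moreover have "(y - y') * (- inverse y * inverse y') \<in> I"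
    using * by (intro I_mult mult_closed uminus_closed inverse_closed')
  ultimately have "inverse y - inverse y' \<in> I" by (simp only:)
  thus ?thesis unfolding divide_inverse using * by (intro I_cong_mult inverse_closed')
qed

text \<open>The product contains \<open>l div m\<close> disjoint windows of length \<open>m\<close>,
  and each contributes one factor \<open>\<theta>\<close>.\<close>

lemma prod_window:
  assumes "m > 0" "\<And>j. F j \<in> V" and win: "\<And>k. \<exists>j\<in>{k..<k + m}. \<exists>v\<in>V. F j = \<theta> * v"
  shows "\<exists>v\<in>V. (\<Prod>j<l. F (s + j)) = \<theta> ^ (l div m) * v"
proof (induction l arbitrary: s rule: less_induct)
  case (less l)
  show ?case
  proof (cases "l < m")
    case True
    thus ?thesis using assms(2) by (intro bexI[of _ "\<Prod>j<l. F (s + j)"] prod_closed) auto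
  next
    case False
    define l' where "l' = l - m"
    have l: "l = m + l'" using False by (simp add: l'_def)
    obtain j v where j: "j \<in> {s..<s + m}" "v \<in> V" "F j = \<theta> * v" using win[of s] by blast
    define i where "i = j - s"
    have i: "i < m" "F (s + i) = \<theta> * v" using j by (auto simp: i_def)
    have "(\<Prod>j<m. F (s + j)) = F (s + i) * (\<Prod>j\<in>{..<m} - {i}. F (s + j))"
      using i(1) by (intro prod.remove) auto
    moreover obtain v' where v': "v' \<in> V" "(\<Prod>j<l'. F (s + m + j)) = \<theta> ^ (l' div m) * v'"
      using less[of l' "s + m"] l assms(1) by auto
    moreover have "(\<Prod>j<l. F (s + j)) = (\<Prod>j<m. F (s + j)) * (\<Prod>j<l'. F (s + m + j))"
      unfolding l by (induction l') (simp_all add: add.assoc mult.assoc)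
    moreover have "l div m = Suc (l' div m)" using l assms(1) by simp
    ultimately have "(\<Prod>j<l. F (s + j)) = \<theta> ^ (l div m) * (v * (\<Prod>j\<in>{..<m} - {i}. F (s + j)) * v')"
      using i(2) by (simp add: mult_ac)
    thus ?thesis using j v' assms(2)
      by (intro bexI[of _ "v * (\<Prod>j\<in>{..<m} - {i}. F (s + j)) * v'"] mult_closed prod_closed) auto
  qed
qed

text \<open>In the application \<open>\<theta>\<close> is 1 - q^m and \<open>M0\<close> is the
  residue of M modulo m. Vanishing factors above and below are all measured in powers of
  \<open>\<theta>\<close>, so they cancel inside \<open>V\<close> whatever power of
  \<open>\<pi>\<close> divides \<open>\<theta>\<close>.\<close>

context
  fixes a p c e \<theta> :: 'a and m M0 :: nat
  assumes unit: "a \<in> U" "p \<in> U" "c \<in> U" "e \<in> U"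
    and M0: "M0 < m" and \<theta>: "\<theta> \<in> I" "\<theta> \<noteq> 0"
    and p_unit: "\<And>j. \<not> m dvd j \<Longrightarrow> 1 - p ^ j \<in> U"
    and p_theta: "\<And>j. m dvd j \<Longrightarrow> j > 0 \<Longrightarrow> \<exists>w\<in>U. 1 - p ^ j = \<theta> * w"
    and a_theta: "\<And>j. j mod m = M0 \<Longrightarrow> \<exists>v\<in>V. 1 - a * p ^ j = \<theta> * v"
    and a2_theta: "\<And>j. j mod m = (2 * M0) mod m \<Longrightarrow> \<exists>v\<in>V. 1 - a ^ 2 * p ^ j = \<theta> * v"
    and ce_unit: "\<And>l. l > 0 \<Longrightarrow> 1 - p ^ l / c \<in> U" "\<And>l. l > 0 \<Longrightarrow> 1 - p ^ l / e \<in> U"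
begin

lemma in_V: "a \<in> V" "p \<in> V" "c \<in> V" "e \<in> V" "\<theta> \<in> V"
  using unit[THEN U_closed] I_closed[OF \<theta>(1)] by auto

lemma m_pos: "m > 0"
  using M0 by simp

text \<open>An exact count with a unit cofactor, because this product stands in denominators; for
  the numerators below a lower bound is enough.\<close>

lemma poch_p_theta: "\<exists>w\<in>U. poch p p l = \<theta> ^ (l div m) * w"
proof (induction l)
  case 0
  show ?case using one_U by auto
next
  case (Suc l)
  then obtain w where w: "w \<in> U" "poch p p l = \<theta> ^ (l div m) * w" by auto
  show ?case
  proof (cases "m dvd Suc l")
    case True
    obtain w' where w': "w' \<in> U" "1 - p ^ Suc l = \<theta> * w'" using p_theta[OF True] by auto
    have "Suc l div m = Suc (l div m)" using True by (simp add: div_Suc dvd_eq_mod_eq_0)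
    hence "poch p p (Suc l) = \<theta> ^ (Suc l div m) * (w * w')"
      using w w' by (simp add: poch_Suc)
    thus ?thesis using U_mult[OF w(1) w'(1)] by blast
  next
    case False
    have "Suc l div m = l div m" using False by (simp add: div_Suc dvd_eq_mod_eq_0)
    hence "poch p p (Suc l) = \<theta> ^ (Suc l div m) * (w * (1 - p ^ Suc l))"
      using w by (simp add: poch_Suc)
    thus ?thesis using U_mult[OF w(1) p_unit[OF False]] by blast
  qed
qed

lemma poch_a_theta: "\<exists>v\<in>V. poch a p k = \<theta> ^ (k div m) * v"
proof -
  have win: "\<exists>j\<in>{k..<k + m}. \<exists>v\<in>V. 1 - a * p ^ j = \<theta> * v" for k
    using exists_mod_eq_in_window[OF M0, of k] a_theta by blast
  have cl: "1 - a * p ^ j \<in> V" for j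
    by (intro diff_closed one_closed mult_closed power_closed in_V)
  show ?thesis
    using prod_window[of m "\<lambda>j. 1 - a * p ^ j" \<theta> 0 k, OF m_pos cl win] by (simp add: poch_def)
qed

text \<open>Meant for \<open>M0 < k < m\<close>, where \<open>k div m\<close> is 0 although the
  vanishing factor with index \<open>M0\<close> is already present.\<close>

lemma poch_a_theta': "M0 < k \<Longrightarrow> \<exists>v\<in>V. poch a p k = \<theta> * v"
proof -
  assume k: "M0 < k"
  obtain v where v: "v \<in> V" "1 - a * p ^ M0 = \<theta> * v" using a_theta[of M0] M0 by auto
  have "poch a p k = (1 - a * p ^ M0) * (\<Prod>j\<in>{..<k} - {M0}. 1 - a * p ^ j)"
    unfolding poch_def using k by (intro prod.remove) auto
  hence "poch a p k = \<theta> * (v * (\<Prod>j\<in>{..<k} - {M0}. 1 - a * p ^ j))"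
    by (simp add: v mult_ac)
  thus ?thesis using v in_V
    by (intro bexI[of _ "v * (\<Prod>j\<in>{..<k} - {M0}. 1 - a * p ^ j)"] mult_closed prod_closed)
      (auto intro!: diff_closed one_closed mult_closed power_closed)
qed

lemma poch_a2_theta: "\<exists>v\<in>V. poch (a ^ 2 * p ^ k) p l = \<theta> ^ (l div m) * v"
proof -
  have lt: "2 * M0 mod m < m" using m_pos by simp
  have win: "\<exists>j\<in>{k..<k + m}. \<exists>v\<in>V. 1 - a ^ 2 * p ^ j = \<theta> * v" for k
    using exists_mod_eq_in_window[OF lt, of k] a2_theta by blast
  have cl: "1 - a ^ 2 * p ^ j \<in> V" for j
    by (intro diff_closed one_closed mult_closed power_closed in_V)
  show ?thesis
    using prod_window[of m "\<lambda>j. 1 - a ^ 2 * p ^ j" \<theta> k l, OF m_pos cl win]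
    by (simp add: poch_def power_add mult.assoc)
qed

lemma theta_power_quotient: "j \<le> i \<Longrightarrow> v \<in> V \<Longrightarrow> w \<in> U \<Longrightarrow> \<theta> ^ i * v / (\<theta> ^ j * w) \<in> V"
proof -
  assume *: "j \<le> i" "v \<in> V" "w \<in> U"
  have "\<theta> ^ i * v / (\<theta> ^ j * w) = \<theta> ^ (i - j) * (v / w)"
    using * \<theta>(2) U_nonzero by (simp add: power_diff)
  thus ?thesis using * in_V by (auto intro: mult_closed power_closed divide_closed)
qed

lemma wp_ratio_one_closed: "wp_ratio a p 1 k \<in> V"
  using poch_p_theta[of k] poch_a_theta[of k] theta_power_quotient[OF order.refl]
  by (auto simp: wp_ratio_def)

lemma admissible_ce: "admissible p n c" "admissible p n e"
  using unit ce_unit by (auto simp: admissible_def)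

lemma admissible_one: "admissible p (m - 1) 1"
proof -
  have "1 - p ^ l \<in> U" if "l \<in> {1..m - 1}" for l
    using that by (intro p_unit) (auto dest: dvd_imp_le)
  thus ?thesis by (simp add: admissible_def one_U)
qed

lemma wp_ratio_ce_closed: "\<chi> = c \<or> \<chi> = e \<Longrightarrow> wp_ratio a p \<chi> k \<in> V"
  unfolding wp_ratio_def using admissible_ce[of k] in_V
  by (auto intro!: divide_closed poch_closed mult_closed admissible_poch)

lemma p_power_cong: "p ^ (i * m) - 1 \<in> I"
proof -
  obtain w where "w \<in> U" "1 - p ^ m = \<theta> * w" using p_theta[of m] m_pos by auto
  hence "1 - p ^ m \<in> I" using I_mult[OF \<theta>(1)] U_closed by metis
  hence "p ^ m - 1 \<in> I" using I_diff_commute by blast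
  from power_cong_I[OF power_closed[OF in_V(2)] one_closed this, of i]
  show ?thesis
    by (simp add: mult.commute[of i] power_mult)
qed

lemma a_cong: "a * p ^ M0 - 1 \<in> I"
proof -
  obtain v where "v \<in> V" "1 - a * p ^ M0 = \<theta> * v" using a_theta[of M0] M0 by auto
  hence "1 - a * p ^ M0 \<in> I" using I_mult[OF \<theta>(1)] by metis
  thus ?thesis using I_diff_commute by blast
qed

text \<open>Since \<open>p ^ (i * m)\<close> is congruent to 1, the \<open>s\<close> factors
  following index \<open>i * m\<close> repeat the first \<open>s\<close> ones modulo
  \<open>\<pi>\<close>. For \<open>s < m\<close> the exponents in the denominator avoid the
  multiples of \<open>m\<close>, so it stays a unit.\<close>

lemma wp_ratio_block:
  assumes "\<chi> = 1 \<or> \<chi> = c \<or> \<chi> = e" "s < m"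
  shows "\<exists>r\<in>V. wp_ratio a p \<chi> (i * m + s) = wp_ratio a p \<chi> (i * m) * r \<and> r - wp_ratio a p \<chi> s \<in> I"
proof -
  define A where "A = p ^ (i * m)"
  have A: "A - 1 \<in> I" "A \<in> V" using p_power_cong in_V power_closed by (auto simp: A_def)
  have \<chi>: "\<chi> \<in> U" using assms unit one_U by auto
  have \<chi>V: "\<chi> \<in> V" using \<chi> by (rule U_closed)
  define r where "r = poch (\<chi> * a * A) p s / poch (p / \<chi> * A) p s"
  have den: "poch (p / \<chi> * A) p s \<in> U"
  proof (rule poch_U)
    fix j assume "j < s"
    hence *: "\<not> m dvd i * m + Suc j" using assms(2)
      by (metis Suc_lessI dvd_add_right_iff dvd_triv_right nat_dvd_not_less less_trans_Suc zero_less_Suc)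
    have "1 - p ^ (i * m + Suc j) / \<chi> \<in> U"
      using assms(1) p_unit[OF *] ce_unit[of "i * m + Suc j"] by auto
    thus "1 - p / \<chi> * A * p ^ j \<in> U" by (simp add: A_def power_add mult_ac)
  qed
  have den': "poch (p / \<chi>) p s \<in> U"
    using assms admissible_poch[OF admissible_one, of s] admissible_poch[OF admissible_ce(1), of s s]
      admissible_poch[OF admissible_ce(2), of s s] by auto
  have c: "x * A - x \<in> I" if "x \<in> V" for x
    using I_mult[OF A(1) that] by (simp add: algebra_simps)
  have "r \<in> V" unfolding r_def
    using den \<chi> \<chi>V A in_V by (intro divide_closed poch_closed mult_closed)
  moreover have "wp_ratio a p \<chi> (i * m + s) = wp_ratio a p \<chi> (i * m) * r"
    by (simp add: wp_ratio_def r_def poch_add A_def)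
  moreover have "r - wp_ratio a p \<chi> s \<in> I"
    unfolding r_def wp_ratio_def using den den' \<chi> \<chi>V A in_V
    by (intro I_cong_divide I_cong_poch c mult_closed divide_closed poch_closed)
  ultimately show ?thesis by blast
qed

text \<open>Modulo \<open>\<pi>\<close>, block \<open>i\<close> is a multiple of block 0. The ratios
  and the power contribute the multiplier, while the linear factor
  \<open>1 - a * p ^ (2 * k)\<close> simply repeats with period \<open>m\<close>.\<close>

lemma wp_term_block:
  "\<exists>\<tau>\<in>V. \<forall>s<m. wp_term a p 1 1 1 c e (i * m + s) - \<tau> * wp_term a p 1 1 1 c e s \<in> I"
proof -
  define R where "R k = wp_ratio a p 1 k * wp_ratio a p 1 k * wp_ratio a p 1 k
     * wp_ratio a p 1 k * wp_ratio a p c k * wp_ratio a p e k" for k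
  define Z where "Z = p ^ 2 / (a ^ 3 * 1 * 1 * 1 * c * e)"
  have summand: "wp_term a p 1 1 1 c e k = (1 - a * p ^ (2 * k)) * (R k * Z ^ k)" for k
    by (simp add: wp_term_def R_def Z_def mult_ac)
  have ZV: "Z \<in> V" unfolding Z_def using unit in_V
    by (intro divide_closed power_closed U_mult U_power one_U)
  have RV: "R k \<in> V" for k
    unfolding R_def by (intro mult_closed wp_ratio_one_closed wp_ratio_ce_closed) auto
  show ?thesis
  proof (intro bexI[of _ "R (i * m) * Z ^ (i * m)"] allI impI)
    fix s assume s: "s < m"
    obtain r1 where r1: "r1 \<in> V" "wp_ratio a p 1 (i * m + s) = wp_ratio a p 1 (i * m) * r1" "r1 - wp_ratio a p 1 s \<in> I"
      using wp_ratio_block[of 1 s i] s by blast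
    obtain r2 where r2: "r2 \<in> V" "wp_ratio a p c (i * m + s) = wp_ratio a p c (i * m) * r2" "r2 - wp_ratio a p c s \<in> I"
      using wp_ratio_block[of c s i] s by blast
    obtain r3 where r3: "r3 \<in> V" "wp_ratio a p e (i * m + s) = wp_ratio a p e (i * m) * r3" "r3 - wp_ratio a p e s \<in> I"
      using wp_ratio_block[of e s i] s by blast
    define L where "L = 1 - a * p ^ (2 * (i * m + s))"
    define L' where "L' = 1 - a * p ^ (2 * s)"
    have LV: "L \<in> V" "L' \<in> V" unfolding L_def L'_def
      by (intro diff_closed one_closed mult_closed power_closed in_V)+
    have "L - L' = (p ^ (2 * i * m) - 1) * - (a * p ^ (2 * s))"
      by (simp add: L_def L'_def algebra_simps power_add)
    moreover have "(p ^ (2 * i * m) - 1) * - (a * p ^ (2 * s)) \<in> I"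
      by (intro I_mult p_power_cong uminus_closed mult_closed power_closed in_V)
    ultimately have L: "L - L' \<in> I" by (simp only:)
    define r where "r = r1 * r1 * r1 * r1 * r2 * r3"
    have rV: "r \<in> V" unfolding r_def by (intro mult_closed r1 r2 r3)
    have r: "r - R s \<in> I"
      unfolding r_def R_def
      by (intro I_cong_mult mult_closed r1 r2 r3 wp_ratio_one_closed wp_ratio_ce_closed) auto
    have "L * (r * Z ^ s) - L' * (R s * Z ^ s) \<in> I"
      by (intro I_cong_mult L r LV rV mult_closed power_closed ZV RV) (simp add: I_zero)
    hence "(L * (r * Z ^ s) - L' * (R s * Z ^ s)) * (R (i * m) * Z ^ (i * m)) \<in> I"
      by (intro I_mult mult_closed RV power_closed ZV)
    moreover have "R (i * m + s) = R (i * m) * r"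
      by (simp add: R_def r_def r1 r2 r3 mult_ac)
    hence "wp_term a p 1 1 1 c e (i * m + s) - R (i * m) * Z ^ (i * m) * wp_term a p 1 1 1 c e s
        = (L * (r * Z ^ s) - L' * (R s * Z ^ s)) * (R (i * m) * Z ^ (i * m))"
      unfolding summand L_def[symmetric] L'_def[symmetric] by (simp add: power_add algebra_simps)
    ultimately show "wp_term a p 1 1 1 c e (i * m + s) - R (i * m) * Z ^ (i * m) * wp_term a p 1 1 1 c e s \<in> I"
      by (simp only:)
  qed (intro mult_closed RV power_closed ZV)
qed

text \<open>Niceness of order 0 for constant sequences is mere membership in \<open>V\<close>, so
  \<open>nice_cong_sum_wp_term\<close> applies inside the first block, with \<open>M0\<close> in the
  role of \<open>M\<close>.\<close>

lemma sum_wp_term_short: "M0 \<le> S \<Longrightarrow> S < m \<Longrightarrow> (\<Sum>s\<le>S. wp_term a p 1 1 1 c e s) \<in> I"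
  using nice_cong_value[OF nice_cong_sum_wp_term[of 1 0 "\<lambda>_. 1" "\<lambda>_. 1" "\<lambda>_. 1" p "m - 1" c e a M0 S]]
    nice_const[OF one_closed] admissible_one admissible_ce unit a_cong by simp

lemma sum_wp_term_block: "M0 \<le> S \<Longrightarrow> S < m \<Longrightarrow> (\<Sum>s\<le>S. wp_term a p 1 1 1 c e (i * m + s)) \<in> I"
proof -
  assume S: "M0 \<le> S" "S < m"
  obtain \<tau> where \<tau>: "\<tau> \<in> V" "\<And>s. s < m \<Longrightarrow> wp_term a p 1 1 1 c e (i * m + s) - \<tau> * wp_term a p 1 1 1 c e s \<in> I"
    using wp_term_block by blast
  have "(\<Sum>s\<le>S. wp_term a p 1 1 1 c e (i * m + s) - \<tau> * wp_term a p 1 1 1 c e s) \<in> I"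
    using S by (intro I_sum \<tau>) auto
  moreover have "(\<Sum>s\<le>S. wp_term a p 1 1 1 c e s) * \<tau> \<in> I"
    by (intro I_mult sum_wp_term_short S \<tau>)
  ultimately have "(\<Sum>s\<le>S. wp_term a p 1 1 1 c e (i * m + s) - \<tau> * wp_term a p 1 1 1 c e s)
      + (\<Sum>s\<le>S. wp_term a p 1 1 1 c e s) * \<tau> \<in> I"
    by (rule I_add)
  thus ?thesis by (simp add: sum_subtractf sum_distrib_left[symmetric] mult.commute)
qed

lemma sum_wp_term_in_I:
  assumes "Suc W = N * m \<or> W = N * m + M0"
  shows "(\<Sum>k\<le>W. wp_term a p 1 1 1 c e k) \<in> I"
proof -
  let ?t = "wp_term a p 1 1 1 c e"
  have full: "(\<Sum>k<N * m. ?t k) \<in> I"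
  proof -
    have "(\<Sum>k<N * m. ?t k) = (\<Sum>i<N. \<Sum>k=i * m..<i * m + m. ?t k)"
      by (rule sum.nat_group[symmetric])
    also have "\<dots> = (\<Sum>i<N. \<Sum>s\<le>m - 1. ?t (i * m + s))"
    proof (rule sum.cong[OF refl])
      fix i
      show "(\<Sum>k=i * m..<i * m + m. ?t k) = (\<Sum>s\<le>m - 1. ?t (i * m + s))"
        using m_pos by (intro sum.reindex_bij_witness[of _ "\<lambda>s. i * m + s" "\<lambda>k. k - i * m"]) auto
    qed
    also have "\<dots> \<in> I"
    proof (rule I_sum)
      fix i
      show "(\<Sum>s\<le>m - 1. ?t (i * m + s)) \<in> I"
        using M0 by (intro sum_wp_term_block) auto
    qed
    finally show ?thesis .
  qed
  from assms show ?thesis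
  proof
    assume "Suc W = N * m"
    thus ?thesis using full by (simp add: lessThan_Suc_atMost[symmetric])
  next
    \<comment> \<open>The incomplete last block reaches its reflection length \<open>M0\<close>, and
      a partial block sum vanishes modulo \<open>\<pi>\<close> from there on.\<close>
    assume W: "W = N * m + M0"
    have "(\<Sum>k\<le>W. ?t k) = (\<Sum>k<N * m. ?t k) + (\<Sum>s\<le>M0. ?t (N * m + s))"
      unfolding W by (induction M0) (simp_all add: lessThan_Suc_atMost[symmetric] add_ac)
    thus ?thesis using I_add[OF full sum_wp_term_block[of M0 N]] M0 by simp
  qed
qed

text \<open>A count of factors \<open>\<theta>\<close>: below there are
  \<open>k div m + M div m\<close>, above there are \<open>(M - k) div m\<close> and three times the
  number found in \<open>poch a p k\<close>.\<close>

lemma watson_term_quotient_closed: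
  assumes M: "M mod m = M0" and k: "k \<le> M"
  shows "watson_term a p M 1 1 1 c e k / poch p p M \<in> V"
proof -
  obtain v1 where v1: "v1 \<in> V" "poch (a ^ 2 * p ^ k) p (M - k) = \<theta> ^ ((M - k) div m) * v1"
    using poch_a2_theta by blast
  \<comment> \<open>For \<open>k > M0\<close> there is at least one factor \<open>\<theta>\<close>
    even when \<open>k < m\<close>; it pays for the possible carry in the sum of
    \<open>(M - k) div m\<close> and \<open>k div m\<close>.\<close>
  define N where "N = (if k \<le> M0 then 0 else max 1 (k div m))"
  obtain v2 where v2: "v2 \<in> V" "poch a p k = \<theta> ^ N * v2"
  proof (cases "k \<le> M0")
    case True
    thus ?thesis using that[of "poch a p k"] poch_closed in_V by (simp add: N_def)
  next
    case False
    show ?thesis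
    proof (cases "k div m = 0")
      case True
      thus ?thesis using that False poch_a_theta'[of k] by (auto simp: N_def)
    next
      case False
      hence "N = k div m" using \<open>\<not> k \<le> M0\<close> by (auto simp: N_def)
      thus ?thesis using that poch_a_theta[of k] by auto
    qed
  qed
  obtain w1 where w1: "w1 \<in> U" "poch p p k = \<theta> ^ (k div m) * w1" using poch_p_theta by blast
  obtain w2 where w2: "w2 \<in> U" "poch p p M = \<theta> ^ (M div m) * w2" using poch_p_theta by blast
  define D where "D = poch (p / c) p k * poch (p / e) p k"
  have D: "D \<in> U" unfolding D_def using admissible_ce by (intro U_mult admissible_poch) auto
  define B where "B = poch (p / (a * c * e)) p k"
  have B: "B \<in> V" unfolding B_def using unit in_V by (intro poch_closed divide_closed U_mult)
  have le: "k div m + M div m \<le> (M - k) div m + 3 * N"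
  proof (cases "k \<le> M0")
    case True
    have "M - k = (M0 - k) + m * (M div m)"
      using True M by (metis Nat.add_diff_assoc2 mult.commute add.commute mod_mult_div_eq)
    hence "(M - k) div m = M div m" using M0 by (simp add: less_imp_diff_less)
    moreover have "k div m = 0" using True M0 by simp
    ultimately show ?thesis by simp
  next
    case False
    have "M div m = (M - k) div m + k div m + ((M - k) mod m + k mod m) div m"
      using div_add1_eq[of "M - k" k m] k by simp
    moreover have "((M - k) mod m + k mod m) div m \<le> 1"
    proof -
      have "(M - k) mod m + k mod m < 2 * m"
        using mod_less_divisor[OF m_pos, of "M - k"] mod_less_divisor[OF m_pos, of k] by linarith
      hence "((M - k) mod m + k mod m) div m < 2"
        by (simp add: div_less_iff_less_mult m_pos)
      thus ?thesis by simp
    qed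
    moreover have "N \<ge> 1" "N \<ge> k div m" using False by (auto simp: N_def)
    ultimately show ?thesis by linarith
  qed
  have "watson_term a p M 1 1 1 c e k / poch p p M
      = (\<theta> ^ ((M - k) div m + 3 * N) * (v1 * v2 ^ 3)) / (\<theta> ^ (k div m + M div m) * (w1 * w2)) * (B / D * p ^ k)"
    unfolding watson_term_def mult_1_left v1 v2 w1 w2 B_def[symmetric]
    by (simp add: D_def power_add power_mult power_mult_distrib eval_nat_numeral divide_inverse mult_ac)
  also have "\<dots> \<in> V"
    by (rule mult_closed[OF theta_power_quotient[OF le]])
      (intro mult_closed power_closed divide_closed U_mult v1 v2 w1 w2 B D in_V)+
  finally show ?thesis .
qed

text \<open>Both sides vanish modulo \<open>\<pi>\<close> separately. On the right
  \<open>1 - a * p ^ M\<close> is in the ideal and its cofactor is integral: a factor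
  \<open>\<theta>\<close> in some \<open>1 - p ^ i\<close> is compensated by the one in
  \<open>1 - a * p ^ M\<close>.\<close>

theorem sum_wp_term_cong_first_power:
  assumes W: "Suc W = N * m \<or> W = N * m + M0" and M: "M mod m = M0"
  shows "\<exists>v\<in>V. (\<Sum>k\<le>W. wp_term a p 1 1 1 c e k)
      - (1 - a * p ^ M) / a ^ M / poch p p M * (1 - (1 - a * p ^ M) ^ 2 * (\<Sum>i=1..M. p ^ i / (1 - p ^ i) ^ 2))
        * (\<Sum>k\<le>M. watson_term a p M 1 1 1 c e k) = \<pi> * v"
proof -
  define t where "t = 1 - a * p ^ M"
  obtain v where v: "v \<in> V" "t = \<theta> * v" using a_theta[OF M] by (auto simp: t_def)
  have tV: "t \<in> V" using v in_V mult_closed by simp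
  have tI: "t \<in> I" using I_mult[OF \<theta>(1) v(1)] v(2) by simp
  have quot: "t / (1 - p ^ i) \<in> V" if i: "i > 0" for i
  proof (cases "m dvd i")
    case True
    then obtain w where w: "w \<in> U" "1 - p ^ i = \<theta> * w" using p_theta[OF _ i] by blast
    show ?thesis using theta_power_quotient[OF order.refl v(1) w(1), of 1] unfolding v(2) w(2) by simp
  next
    case False
    show ?thesis by (rule divide_closed[OF tV p_unit[OF False]])
  qed
  define B where "B = 1 - t ^ 2 * (\<Sum>i=1..M. p ^ i / (1 - p ^ i) ^ 2)"
  have "B = 1 - (\<Sum>i=1..M. p ^ i * (t / (1 - p ^ i)) ^ 2)"
    by (simp add: B_def sum_distrib_left power_divide mult_ac)
  also have "\<dots> \<in> V"
    using quot in_V by (intro diff_closed one_closed sum_closed mult_closed power_closed) auto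
  finally have BV: "B \<in> V" .
  define S where "S = (\<Sum>k\<le>M. watson_term a p M 1 1 1 c e k / poch p p M)"
  have SV: "S \<in> V" unfolding S_def by (intro sum_closed watson_term_quotient_closed M) auto
  have "t * (inverse (a ^ M) * B * S) \<in> I"
    by (intro I_mult tI mult_closed BV SV inverse_closed' U_power unit)
  moreover have "t * (inverse (a ^ M) * B * S) = t / a ^ M / poch p p M * B * (\<Sum>k\<le>M. watson_term a p M 1 1 1 c e k)"
    unfolding S_def sum_divide_distrib[symmetric] by (simp add: divide_inverse mult_ac)
  ultimately have "(\<Sum>k\<le>W. wp_term a p 1 1 1 c e k)
     - t / a ^ M / poch p p M * B * (\<Sum>k\<le>M. watson_term a p M 1 1 1 c e k) \<in> I"
    using I_diff[OF sum_wp_term_in_I[OF W]] by metis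
  thus ?thesis unfolding t_def B_def by blast
qed

end

end

subsection \<open>Cyclotomic polynomials\<close>

lemma dvd_power_minus_one_mod:
  fixes x :: "'a::comm_ring_1"
  assumes "p dvd x ^ b - 1"
  shows "p dvd x ^ a - 1 \<longleftrightarrow> p dvd x ^ (a mod b) - 1"
proof -
  have "x ^ b - 1 dvd (x ^ b) ^ (a div b) - 1"
    unfolding power_diff_1_eq[of "x ^ b" "a div b"] by (rule dvd_triv_left)
  hence "p dvd (x ^ b) ^ (a div b) - 1"
    using assms by (rule dvd_trans[rotated])
  hence "p dvd x ^ (a mod b) * ((x ^ b) ^ (a div b) - 1)"
    by (rule dvd_mult)
  moreover have "x ^ a - 1 = x ^ (a mod b) * ((x ^ b) ^ (a div b) - 1) + (x ^ (a mod b) - 1)"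
    by (simp add: algebra_simps power_mult[symmetric] power_add[symmetric])
  ultimately show ?thesis
    by (simp only: dvd_add_right_iff)
qed

lemma dvd_power_minus_one_gcd:
  fixes x :: "'a::comm_ring_1"
  shows "p dvd x ^ a - 1 \<Longrightarrow> p dvd x ^ b - 1 \<Longrightarrow> p dvd x ^ gcd a b - 1"
proof (induction a b rule: gcd_nat_induct)
  case (step a b)
  hence "p dvd x ^ gcd b (a mod b) - 1"
    using dvd_power_minus_one_mod[of p x b a] by blast
  thus ?case by (metis gcd_red_nat)
qed simp

lemma dvd_power_minus_one_mono:
  fixes x :: "'a::comm_ring_1"
  assumes "a dvd b"
  shows "x ^ a - 1 dvd x ^ b - 1"
  using assms dvd_power_minus_one_mod[of "x ^ a - 1" x a b] by simp

declare cyclotomic.simps [simp del]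

definition unity_poly :: "nat \<Rightarrow> rat poly" where
  "unity_poly n = monom 1 n - 1"

lemma unity_poly_altdef: "unity_poly n = monom 1 1 ^ n - 1"
  by (simp add: unity_poly_def monom_power)

lemma unity_poly_nonzero: "n > 0 \<Longrightarrow> unity_poly n \<noteq> 0"
proof
  assume "n > 0" "unity_poly n = 0"
  hence "poly (unity_poly n) 2 = 0" by simp
  thus False using one_less_power[of "2::rat" n] \<open>n > 0\<close> by (simp add: unity_poly_def poly_monom)
qed

text \<open>X times the derivative of X^n - 1, minus n (X^n - 1), is the constant n; a double factor
  would divide it.\<close>

lemma square_dvd_unity_poly:
  assumes "p ^ 2 dvd unity_poly n" "n > 0"
  shows "is_unit p"
proof -
  obtain k where k: "unity_poly n = p * p * k"
    using assms(1) by (auto simp: power2_eq_square elim: dvdE)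
  have "p dvd unity_poly n"
    unfolding k by (simp add: mult.assoc)
  have "pderiv (unity_poly n) = monom (of_nat n) (n - 1)"
    by (simp add: unity_poly_def pderiv_diff pderiv_monom)
  moreover have "pderiv (p * p * k) = p * (pderiv (p * k) + k * pderiv p)"
    by (simp add: pderiv_mult algebra_simps)
  ultimately have "p dvd monom (of_nat n) (n - 1)"
    unfolding k by (metis dvd_triv_left)
  hence "p dvd monom 1 1 * monom (of_nat n) (n - 1) - smult (of_nat n) (unity_poly n)"
    using \<open>p dvd unity_poly n\<close> by (intro dvd_diff dvd_mult dvd_smult)
  also have "monom 1 1 * monom (of_nat n) (n - 1) - smult (of_nat n) (unity_poly n) = [:of_nat n:]"
    using assms(2) by (simp add: unity_poly_def mult_monom smult_diff_right smult_monom one_pCons)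
  finally have "p dvd [:of_nat n:]" .
  moreover have "is_unit [:of_nat n :: rat:]"
    using assms(2) by (simp add: is_unit_const_poly_iff dvd_field_iff)
  ultimately show ?thesis
    by (rule dvd_unit_imp_unit)
qed

definition proper_divisors :: "nat \<Rightarrow> nat set" where
  "proper_divisors n = {d\<in>{..<n}. d dvd n}"

lemma finite_proper_divisors [simp]: "finite (proper_divisors n)"
  by (simp add: proper_divisors_def)

text \<open>\<open>cyclotomic\<close> is defined with \<open>div\<close>, so exactness of the
  division must be shown. It follows from pairwise coprimality: for d < d', a common divisor of the
  two cyclotomic polynomials divides X^g - 1 with g = gcd(d, d') < d', hence also the product over
  the proper divisors of d', so its square divides the squarefree X^d' - 1.\<close>

lemma unity_poly_eq_prod: "n > 0 \<Longrightarrow> unity_poly n = cyclotomic n * (\<Prod>d\<in>proper_divisors n. cyclotomic d)"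
proof (induction n rule: less_induct)
  case (less n)
  have pos: "d > 0" if "d \<in> proper_divisors n" for d
    using that less.prems by (auto simp: proper_divisors_def intro!: Nat.gr0I)
  have dvd: "cyclotomic d dvd unity_poly d" if "d \<in> proper_divisors n" for d
    using less.IH[of d] pos[OF that] that by (simp add: proper_divisors_def)
  have cop: "coprime (cyclotomic d) (cyclotomic d')"
    if d: "d \<in> proper_divisors n" "d' \<in> proper_divisors n" and lt: "d < d'" for d d'
  proof (rule coprimeI)
    fix p assume p: "p dvd cyclotomic d" "p dvd cyclotomic d'"
    define g where "g = gcd d d'"
    have g: "g > 0" "g dvd d'" "g \<le> d"
      using pos[OF d(1)] by (auto simp: g_def intro: dvd_imp_le)
    have "p dvd unity_poly g"
      using dvd_power_minus_one_gcd[of p "monom 1 1" d d'] p dvd[OF d(1)] dvd[OF d(2)]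
      unfolding unity_poly_altdef g_def by (meson dvd_trans)
    also have "unity_poly g = (\<Prod>e\<in>insert g (proper_divisors g). cyclotomic e)"
      using less.IH[of g] g lt d(2) by (simp add: proper_divisors_def)
    also have "\<dots> dvd (\<Prod>e\<in>proper_divisors d'. cyclotomic e)"
      using g lt by (intro prod_dvd_prod_subset) (auto simp: proper_divisors_def intro: dvd_trans)
    finally have "p * p dvd cyclotomic d' * (\<Prod>e\<in>proper_divisors d'. cyclotomic e)"
      using p(2) by (intro mult_dvd_mono)
    also have "\<dots> = unity_poly d'"
      using less.IH[of d'] d pos by (simp add: proper_divisors_def)
    finally show "is_unit p"
      using square_dvd_unity_poly[of p d'] pos[OF d(2)] by (simp add: power2_eq_square)
  qed
  have "(\<Prod>d\<in>A. cyclotomic d) dvd unity_poly n" if "A \<subseteq> proper_divisors n" for A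
    using finite_subset[OF that finite_proper_divisors] that
  proof (induction A rule: finite_induct)
    case (insert d A)
    have "coprime (cyclotomic d) (\<Prod>d\<in>A. cyclotomic d)"
    proof (rule prod_coprime_right)
      fix d' assume "d' \<in> A"
      thus "coprime (cyclotomic d) (cyclotomic d')"
        using insert cop[of d d'] cop[of d' d] by (cases "d < d'") (force simp: coprime_commute)+
    qed
    moreover have "cyclotomic d dvd unity_poly n"
      using dvd[of d] insert.prems dvd_power_minus_one_mono[of d n "monom 1 1 :: rat poly"]
      unfolding unity_poly_altdef by (auto simp: proper_divisors_def intro: dvd_trans)
    ultimately show ?case using insert by (simp add: divides_mult)
  qed simp
  hence "(\<Prod>d\<in>proper_divisors n. cyclotomic d) dvd unity_poly n" by blast
  moreover have "cyclotomic n = unity_poly n div (\<Prod>d\<in>proper_divisors n. cyclotomic d)"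
    using less.prems by (subst cyclotomic.simps) (simp add: unity_poly_def proper_divisors_def)
  ultimately show ?case by simp
qed

lemma cyclotomic_dvd: "n > 0 \<Longrightarrow> cyclotomic n dvd unity_poly n"
  by (simp add: unity_poly_eq_prod)

text \<open>The cyclotomic factors of X^m - 1 belong to proper divisors of n. This will keep primes
  at which q has order m < n from dividing Phi_n.\<close>

lemma unity_poly_mult_cyclotomic_dvd:
  assumes "m dvd n" "m < n"
  shows "unity_poly m * cyclotomic n dvd unity_poly n"
proof -
  have m: "m > 0" using assms by (auto intro!: Nat.gr0I)
  have "unity_poly m = (\<Prod>e\<in>insert m (proper_divisors m). cyclotomic e)"
    using m unity_poly_eq_prod[of m] by (simp add: proper_divisors_def)
  also have "\<dots> dvd (\<Prod>e\<in>proper_divisors n. cyclotomic e)"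
    using assms by (intro prod_dvd_prod_subset) (auto simp: proper_divisors_def intro: dvd_trans)
  finally show ?thesis
    using assms unity_poly_eq_prod[of n] by (simp add: mult.commute[of "cyclotomic n"] mult_dvd_mono)
qed

lemma qint_poly_mult: "qint_poly n * unity_poly 1 = unity_poly n"
proof -
  have "unity_poly n = (monom 1 1 - 1) * (\<Sum>i<n. monom 1 1 ^ i)"
    unfolding unity_poly_altdef by (rule power_diff_1_eq)
  thus ?thesis by (simp add: qint_poly_def unity_poly_def monom_power mult.commute)
qed

subsection \<open>Embedding \<open>\<rat>[q]\<close> into the ground ring\<close>

definition Rconst :: "rat \<Rightarrow> rat poly poly" where "Rconst a = [:[:a:]:]"

lemma Rconst_simps [simp]: "Rconst 0 = 0" "Rconst 1 = 1" "Rconst (a + b) = Rconst a + Rconst b"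
  "Rconst (a * b) = Rconst a * Rconst b" "Rconst (- a) = - Rconst a"
  by (simp_all add: Rconst_def one_pCons)

lemma rpoly_q_altdef: "rpoly_q p = map_poly Rconst p"
  by (simp add: rpoly_q_def Rconst_def[abs_def])

lemma rpoly_q_add: "rpoly_q (p + r) = rpoly_q p + rpoly_q r"
  by (simp add: rpoly_q_altdef poly_eq_iff coeff_map_poly)

lemma rpoly_q_uminus: "rpoly_q (- p) = - rpoly_q p"
  by (simp add: rpoly_q_altdef poly_eq_iff coeff_map_poly)

lemma rpoly_q_diff: "rpoly_q (p - r) = rpoly_q p - rpoly_q r"
  using rpoly_q_add[of p "- r"] by (simp add: rpoly_q_uminus)

lemma Rconst_sum: "Rconst (sum f A) = (\<Sum>x\<in>A. Rconst (f x))"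
  by (induction A rule: infinite_finite_induct) auto

lemma rpoly_q_mult: "rpoly_q (p * r) = rpoly_q p * rpoly_q r"
  by (simp add: rpoly_q_altdef poly_eq_iff coeff_map_poly coeff_mult Rconst_sum)

lemma rpoly_q_1 [simp]: "rpoly_q 1 = 1"
  by (simp add: rpoly_q_altdef)

lemma rpoly_q_0 [simp]: "rpoly_q 0 = 0"
  by (simp add: rpoly_q_altdef)

lemma rpoly_q_power: "rpoly_q (p ^ n) = rpoly_q p ^ n"
  by (induction n) (simp_all add: rpoly_q_mult)

lemma rpoly_q_dvd: "p dvd r \<Longrightarrow> rpoly_q p dvd rpoly_q r"
  by (auto simp: rpoly_q_mult elim!: dvdE)

lemma rpoly_q_eq_0: "rpoly_q p = 0 \<Longrightarrow> p = 0"
proof -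
  assume "rpoly_q p = 0"
  hence "coeff (rpoly_q p) n = 0" for n by simp
  hence "coeff p n = 0" for n
    by (simp add: rpoly_q_altdef coeff_map_poly) (simp add: Rconst_def)
  thus "p = 0" by (simp add: poly_eq_iff)
qed

definition qX :: R where "qX = [:0, 1:]"

lemma rpoly_q_X: "rpoly_q (monom 1 1) = qX"
  by (simp add: rpoly_q_altdef qX_def poly_eq_iff coeff_map_poly coeff_pCons split: nat.splits) 

lemma rpoly_q_unity: "rpoly_q (unity_poly n) = qX ^ n - 1"
  by (simp only: unity_poly_altdef rpoly_q_diff rpoly_q_power rpoly_q_X rpoly_q_1)

subsection \<open>The local ring of fractions at a prime element\<close>

text \<open>\<open>\<not> p dvd y\<close> also excludes \<open>y = 0\<close>, so no degenerate
  \<open>Fract x 0\<close> enters.\<close>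

definition localization :: "'r::idom \<Rightarrow> 'r fract set" where
  "localization p = {Fract x y |x y. \<not> p dvd y}"

lemma localization_I: "\<not> p dvd y \<Longrightarrow> Fract x y \<in> localization p"
  by (auto simp: localization_def)

lemma to_fract_in_localization: "\<not> p dvd 1 \<Longrightarrow> to_fract x \<in> localization p"
  unfolding to_fract_def by (rule localization_I)

lemma Fract_in_ideal_iff:
  fixes p x y :: "'r::idom"
  assumes p: "prime_elem p" and y: "\<not> p dvd y"
  shows "Fract x y \<in> (*) (to_fract p) ` localization p \<longleftrightarrow> p dvd x"
proof
  assume "p dvd x"
  then obtain k where "x = p * k" by (elim dvdE)
  hence "Fract x y = to_fract p * Fract k y" by (simp add: to_fract_def)
  thus "Fract x y \<in> (*) (to_fract p) ` localization p"
    using localization_I[OF y] by blast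
next
  assume "Fract x y \<in> (*) (to_fract p) ` localization p"
  then obtain u v where uv: "\<not> p dvd v" "Fract x y = to_fract p * Fract u v"
    by (auto simp: localization_def)
  have "y \<noteq> 0" "v \<noteq> 0" using y uv by auto
  hence "x * v = p * u * y" using uv by (simp add: to_fract_def eq_fract)
  hence "p dvd x * v" by (metis dvd_triv_left mult.assoc)
  thus "p dvd x" using uv(1) p by (simp add: prime_elem_dvd_mult_iff)
qed

lemma to_fract_in_ideal_iff:
  "prime_elem p \<Longrightarrow> to_fract x \<in> (*) (to_fract p) ` localization p \<longleftrightarrow> p dvd x"
  unfolding to_fract_def[of x] by (rule Fract_in_ideal_iff) (simp_all add: prime_elem_def)

lemma local_subring_localization:
  fixes p :: "'r::idom"
  assumes p: "prime_elem p" and units: "\<And>n. n > 0 \<Longrightarrow> of_nat n dvd (1 :: 'r)"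
  shows "local_subring (localization p) (to_fract p)"
proof
  have p1: "\<not> p dvd 1" using p by (simp add: prime_elem_def)
  show "1 \<in> localization p" using localization_I[OF p1, of 1] by (simp add: One_fract_def)
  show "x + y \<in> localization p" "x * y \<in> localization p"
    if "x \<in> localization p" "y \<in> localization p" for x y
  proof -
    from that obtain a b c d where *: "x = Fract a b" "y = Fract c d" "\<not> p dvd b" "\<not> p dvd d"
      by (auto simp: localization_def)
    hence "b \<noteq> 0" "d \<noteq> 0" "\<not> p dvd b * d" using p by (auto simp: prime_elem_dvd_mult_iff)
    thus "x + y \<in> localization p" "x * y \<in> localization p"
      using * by (auto intro: localization_I)
  qed
  show "- x \<in> localization p" if "x \<in> localization p" for x
  proof -
    from that obtain a b where "x = Fract a b" "\<not> p dvd b" by (auto simp: localization_def)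
    thus ?thesis using localization_I[of p b "- a"] by simp
  qed
  show "to_fract p \<in> localization p" by (rule to_fract_in_localization[OF p1])
  show "to_fract p \<noteq> 0" using p by auto
  show "inverse x \<in> localization p"
    if x: "x \<in> localization p" "x \<notin> (*) (to_fract p) ` localization p" for x
  proof -
    from x obtain a b where *: "x = Fract a b" "\<not> p dvd b" by (auto simp: localization_def)
    hence "\<not> p dvd a" using x(2) Fract_in_ideal_iff[OF p] by blast
    thus ?thesis using * by (auto intro: localization_I)
  qed
  show "1 \<notin> (*) (to_fract p) ` localization p"
    using to_fract_in_ideal_iff[OF p, of 1] p1 by simp
  show "of_nat n \<notin> (*) (to_fract p) ` localization p" if "n > 0" for n
  proof -
    have "\<not> p dvd of_nat n" using units[OF that] p1 dvd_trans by blast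
    moreover have "of_nat n = to_fract (of_nat n :: 'r)"
      by (simp add: to_fract_def of_nat_fract)
    ultimately show ?thesis using to_fract_in_ideal_iff[OF p] by metis
  qed
qed

text \<open>For A - B = F/G in lowest terms it suffices that P divides F and is coprime to G, and
  both can be tested at primes because the ring is factorial. As p divides P, the exponent k is
  positive; so p divides F and therefore not G.\<close>

lemma qcong_by_primes:
  fixes P :: R
  assumes P: "P \<noteq> 0"
    and local: "\<And>p. prime_elem p \<Longrightarrow> p dvd P \<Longrightarrow>
      \<exists>k. \<not> p ^ Suc k dvd P \<and> (\<exists>v\<in>localization p. A - B = to_fract p ^ k * v)"
  shows "qcong A B P"
proof -
  define F where "F = fst (quot_of_fract (A - B))"
  define G where "G = snd (quot_of_fract (A - B))"
  have G: "G \<noteq> 0" "A - B = Fract F G" "coprime F G"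
    by (simp_all add: F_def G_def coprime_quot_of_fract)
  have mult: "\<exists>k. \<not> p ^ Suc k dvd P \<and> p ^ k dvd F \<and> \<not> p dvd G" if p: "prime_elem p" "p dvd P" for p
  proof -
    from local[OF p] obtain k x y where k: "\<not> p ^ Suc k dvd P" "\<not> p dvd y" "Fract F G = to_fract p ^ k * Fract x y"
      by (auto simp: localization_def G(2))
    have "to_fract p ^ k = to_fract (p ^ k)" by (induction k) (simp_all)
    hence "Fract F G = Fract (p ^ k * x) y" using k(3) by (simp add: to_fract_def)
    moreover have "y \<noteq> 0" using k(2) by auto
    ultimately have eq: "F * y = p ^ k * x * G" using G(1) by (simp add: eq_fract)
    have "k > 0" using k(1) p(2) by (cases k) auto
    have "p ^ k dvd y * F" using eq by (metis dvd_triv_left mult.assoc mult.commute)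
    hence F: "p ^ k dvd F" using prime_power_dvd_multD[OF p(1) _ \<open>k > 0\<close> k(2)] by blast
    hence "p dvd F" using \<open>k > 0\<close> by (meson dvd_power dvd_trans)
    hence "\<not> p dvd G" using G(3) p(1) by (meson coprime_common_divisor prime_elem_not_unit)
    thus ?thesis using k(1) F by blast
  qed
  have "coprime G P"
  proof (rule ccontr)
    assume "\<not> coprime G P"
    then obtain g where "g dvd G" "g dvd P" "\<not> is_unit g" by (auto simp: coprime_def)
    moreover have "g \<noteq> 0" using \<open>g dvd G\<close> G(1) by auto
    ultimately obtain p where "prime p" "p dvd g" using prime_divisor_exists by blast
    thus False using mult[of p] \<open>g dvd G\<close> \<open>g dvd P\<close> by (meson dvd_trans prime_imp_prime_elem)
  qed
  moreover have "P dvd F"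
  proof (cases "F = 0")
    case False
    show ?thesis
    proof (rule multiplicity_le_imp_dvd[OF P])
      fix p :: R assume p: "prime p"
      show "multiplicity p P \<le> multiplicity p F"
      proof (cases "p dvd P")
        case True
        then obtain k where k: "\<not> p ^ Suc k dvd P" "p ^ k dvd F" using mult[of p] p by blast
        have "\<not> is_unit p" using p by auto
        hence "multiplicity p F \<ge> k" using k(2) False by (intro multiplicity_geI) auto
        moreover have "multiplicity p P < Suc k" by (rule multiplicity_lessI) (use k P \<open>\<not> is_unit p\<close> in auto)
        ultimately show ?thesis by simp
      qed (simp add: not_dvd_imp_multiplicity_0)
    qed
  qed simp
  ultimately show ?thesis
    using G unfolding qcong_def by (metis dvdE)
qed

section \<open>The indeterminate q and the prime divisors of q^n - 1 in the ground ring\<close>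

lemma qvar_altdef: "qvar = to_fract qX"
  by (simp add: qvar_def to_fract_def qX_def)

lemma qvar_nonzero [simp]: "qvar \<noteq> 0"
  by (simp add: qvar_altdef qX_def)

lemma to_fract_power: "to_fract (x ^ n) = to_fract x ^ n"
  by (induction n) simp_all

lemma X_power_neq_1:
  assumes "m > 0"
  shows "[:0, 1::'a::idom:] ^ m \<noteq> 1"
proof
  assume "[:0, 1::'a:] ^ m = 1"
  hence "degree ([:0, 1::'a:] ^ m) = 0" by simp
  thus False using assms by (simp add: degree_power_eq)
qed

lemma qvar_power_neq_1: "m > 0 \<Longrightarrow> qvar ^ m \<noteq> 1"
  using X_power_neq_1[of m] unfolding qvar_altdef to_fract_power[symmetric] qX_def
  by (metis to_fract_1 to_fract_eq_iff)

lemma qvar_powi_eq_1_iff: "qvar powi z = 1 \<longleftrightarrow> z = 0"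
proof (cases "z \<ge> 0")
  case True
  then obtain k where "z = int k" by (metis nonneg_int_cases)
  thus ?thesis using qvar_power_neq_1[of k] by (cases "k = 0") auto
next
  case False
  hence z: "z = - int (nat (- z))" "nat (- z) > 0" by auto
  have "qvar powi z = inverse (qvar ^ nat (- z))"
    by (subst z(1)) (simp only: power_int_minus power_int_of_nat)
  thus ?thesis using qvar_power_neq_1[OF z(2)] z(2) by auto
qed

text \<open>A divisor of a nonzero element free of q is itself free of q, and would then divide the
  leading coefficient 1 of q^n - 1. Hence nonzero polynomials in c and e are units in the local
  rings considered.\<close>

lemma constant_not_dvd:
  fixes p :: R and s :: "rat poly poly"
  assumes p: "prime_elem p" "p dvd qX ^ n - 1" and n: "n > 0" and s: "s \<noteq> 0"
  shows "\<not> p dvd [:s:]"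
proof
  assume "p dvd [:s:]"
  hence "degree p \<le> degree [:s:]" using s by (intro dvd_imp_degree_le) auto
  then obtain t where t: "p = [:t:]" by (auto elim: degree_eq_zeroE)
  have "t dvd coeff (qX ^ n - 1) n" using p(2) unfolding t const_poly_dvd_iff by blast
  also have "coeff (qX ^ n - 1) n = 1"
    using n by (simp add: qX_def flip: monom_altdef[of "1 :: rat poly poly", simplified])
  finally show False using p(1) by (simp add: t prime_elem_def is_unit_const_poly_iff)
qed

text \<open>The primes of the argument live in the ring with c and e adjoined, so squarefreeness is
  proved there: a double prime factor would divide the derivative n q^(n-1), but neither q nor the
  unit n.\<close>

lemma qX_square_not_dvd:
  fixes p :: R
  assumes p: "prime_elem p" and n: "n > 0"
  shows "\<not> p ^ 2 dvd qX ^ n - 1"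
proof
  assume "p ^ 2 dvd qX ^ n - 1"
  then obtain k where "qX ^ n - 1 = p ^ 2 * k" by (rule dvdE)
  hence k: "qX ^ n - 1 = p * (p * k)" by (simp add: power2_eq_square mult.assoc)
  have pX: "\<not> p dvd qX"
  proof
    assume "p dvd qX"
    hence "p dvd qX ^ n" using n by (meson dvd_power dvd_trans)
    moreover have "p dvd qX ^ n - 1" by (simp add: k)
    ultimately have "p dvd qX ^ n - (qX ^ n - 1)" by (rule dvd_diff)
    thus False using p by (simp add: prime_elem_def)
  qed
  have "pderiv (qX ^ n - 1) = of_nat n * qX ^ (n - 1)"
    by (simp add: pderiv_diff pderiv_power qX_def pderiv_pCons of_nat_poly)
  moreover have "pderiv (p * (p * k)) = p * (pderiv (p * k) + k * pderiv p)"
    by (simp add: pderiv_mult algebra_simps)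
  ultimately have "p dvd of_nat n * qX ^ (n - 1)"
    unfolding k by (metis dvd_triv_left)
  hence "p dvd of_nat n"
    using p pX by (metis prime_elem_dvd_mult_iff prime_elem_dvd_power)
  moreover have "(of_nat n :: R) dvd 1"
    using n by (simp add: of_nat_poly is_unit_const_poly_iff dvd_field_iff)
  ultimately show False
    using p by (meson dvd_trans prime_elem_def)
qed

section \<open>Translation of the two sides and assembly\<close>

lemma wp_term_eq_summand:
  fixes d k :: nat and r :: int
  shows "qint (2 * int d * int k + r)
        * qpoch (qvar powi r) (qvar ^ d) k ^ 4
        * qpoch (cvar * qvar powi r) (qvar ^ d) k * qpoch (evar * qvar powi r) (qvar ^ d) k
        / (qpoch (qvar ^ d) (qvar ^ d) k ^ 4
           * qpoch (qvar ^ d / cvar) (qvar ^ d) k * qpoch (qvar ^ d / evar) (qvar ^ d) k)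
        * inverse ((cvar * evar) ^ k) * qvar powi ((2 * int d - 3 * r) * int k)
     = wp_term (qvar powi r) (qvar ^ d) 1 1 1 cvar evar k / (1 - qvar)"
proof -
  have qp: "qpoch = poch"
    by (simp add: fun_eq_iff qpoch_def poch_def)
  have "qvar powi (2 * int d - 3 * r) = (qvar ^ d) ^ 2 / (qvar powi r) ^ 3"
    by (simp add: power_int_diff power_int_mult mult.commute[of 2] mult.commute[of 3] power_mult)
  hence 1: "qvar powi ((2 * int d - 3 * r) * int k) = ((qvar ^ d) ^ 2 / (qvar powi r) ^ 3) ^ k"
    by (simp add: power_int_mult)
  have 2: "qint (2 * int d * int k + r) = (1 - qvar powi r * (qvar ^ d) ^ (2 * k)) / (1 - qvar)"
  proof -
    have "qvar powi (2 * int d * int k + r) = qvar powi (int (d * (2 * k))) * qvar powi r"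
      by (simp add: power_int_add mult_ac)
    thus ?thesis by (simp only: qint_def power_int_of_nat power_mult mult.commute)
  qed
  show ?thesis
    unfolding 1 2 qp wp_term_def wp_ratio_def
    by (simp add: power_mult_distrib power_divide divide_inverse power_inverse eval_nat_numeral mult_ac)
qed

lemma watson_side_eq:
  fixes d n M :: nat and r :: int
  assumes n: "int n = r + int d * int M" and d: "d > 0"
  shows "qint (int n) * qvar powi ((r * (r - int n)) div int d) / qpoch (qvar ^ d) (qvar ^ d) M
      * (1 - qint (int n) ^ 2 * (\<Sum>i=1..M. qvar ^ (d * i) / qint (int (d * i)) ^ 2))
      * (\<Sum>k=0..M. qpoch (qvar powi (2 * r + int d * int k)) (qvar ^ d) (M - k)
           * qpoch (qvar powi (int d - r) / (cvar * evar)) (qvar ^ d) k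
           * qpoch (qvar powi r) (qvar ^ d) k ^ 3
           / (qpoch (qvar ^ d / cvar) (qvar ^ d) k * qpoch (qvar ^ d / evar) (qvar ^ d) k
              * qpoch (qvar ^ d) (qvar ^ d) k)
           * qvar ^ (d * k))
    = (let a = qvar powi r; p = qvar ^ d in
        ((1 - a * p ^ M) / a ^ M / poch p p M * (1 - (1 - a * p ^ M) ^ 2 * (\<Sum>i=1..M. p ^ i / (1 - p ^ i) ^ 2))
        * (\<Sum>k\<le>M. watson_term a p M 1 1 1 cvar evar k)) / (1 - qvar))"
proof -
  define a where "a = qvar powi r"
  define p where "p = qvar ^ d"
  have q1: "1 - qvar \<noteq> 0" using qvar_power_neq_1[of 1] by auto
  have qp: "qpoch = poch"
    by (simp add: fun_eq_iff qpoch_def poch_def)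
  have 1: "qint (int n) = (1 - a * p ^ M) / (1 - qvar)"
  proof -
    have "qvar powi (int n) = qvar powi r * qvar powi (int (d * M))"
      unfolding n by (simp add: power_int_add)
    thus ?thesis unfolding qint_def a_def p_def by (simp only: power_int_of_nat power_mult)
  qed
  have 2: "qvar powi ((r * (r - int n)) div int d) = inverse (a ^ M)"
  proof -
    \<comment> \<open>The integer division is exact because r - n = -d M, and the power of q is the
      inverse of \<open>a ^ M\<close>.\<close>
    have "r * (r - int n) = (r * - int M) * int d" unfolding n by (simp add: algebra_simps)
    moreover have "x * int d div int d = x" for x using d by simp
    ultimately have "(r * (r - int n)) div int d = r * - int M" by (simp only:)
    thus ?thesis by (simp add: a_def power_int_mult power_int_minus)
  qed
  have 3: "qint (int n) ^ 2 * (\<Sum>i=1..M. qvar ^ (d * i) / qint (int (d * i)) ^ 2)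
      = (1 - a * p ^ M) ^ 2 * (\<Sum>i=1..M. p ^ i / (1 - p ^ i) ^ 2)"
    unfolding sum_distrib_left
  proof (intro sum.cong refl)
    fix i
    have "qint (int (d * i)) = (1 - p ^ i) / (1 - qvar)"
      unfolding qint_def p_def by (simp only: power_int_of_nat power_mult)
    thus "qint (int n) ^ 2 * (qvar ^ (d * i) / qint (int (d * i)) ^ 2) = (1 - a * p ^ M) ^ 2 * (p ^ i / (1 - p ^ i) ^ 2)"
      using q1 unfolding 1 by (simp add: p_def power_mult power_divide)
  qed
  have 4: "(\<Sum>k=0..M. qpoch (qvar powi (2 * r + int d * int k)) (qvar ^ d) (M - k)
           * qpoch (qvar powi (int d - r) / (cvar * evar)) (qvar ^ d) k
           * qpoch (qvar powi r) (qvar ^ d) k ^ 3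
           / (qpoch (qvar ^ d / cvar) (qvar ^ d) k * qpoch (qvar ^ d / evar) (qvar ^ d) k
              * qpoch (qvar ^ d) (qvar ^ d) k)
           * qvar ^ (d * k)) = (\<Sum>k\<le>M. watson_term a p M 1 1 1 cvar evar k)"
    unfolding atMost_atLeast0
  proof (intro sum.cong refl)
    fix k
    have "qvar powi (2 * r + int d * int k) = qvar powi (r * 2) * qvar powi (int (d * k))"
      by (simp add: power_int_add mult.commute)
    hence 5: "qvar powi (2 * r + int d * int k) = a ^ 2 * p ^ k"
      by (simp only: power_int_of_nat power_mult a_def p_def) (simp add: power_int_mult)
    have 6: "qvar powi (int d - r) / (cvar * evar) = p / (a * cvar * evar)"
      by (simp add: power_int_diff a_def p_def)
    show "qpoch (qvar powi (2 * r + int d * int k)) (qvar ^ d) (M - k)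
           * qpoch (qvar powi (int d - r) / (cvar * evar)) (qvar ^ d) k
           * qpoch (qvar powi r) (qvar ^ d) k ^ 3
           / (qpoch (qvar ^ d / cvar) (qvar ^ d) k * qpoch (qvar ^ d / evar) (qvar ^ d) k
              * qpoch (qvar ^ d) (qvar ^ d) k)
           * qvar ^ (d * k) = watson_term a p M 1 1 1 cvar evar k"
      unfolding 5 6 qp watson_term_def a_def[symmetric] p_def[symmetric] power_mult
      by (simp add: eval_nat_numeral mult_ac)
  qed
  show ?thesis
    unfolding 2 3 4 unfolding 1 qp Let_def a_def[symmetric] p_def[symmetric]
    by (simp add: divide_inverse mult_ac)
qed

text \<open>The extra factor \<open>1 - qvar\<close> in the conclusion anticipates the denominator
  \<open>1 - qvar\<close> of both sides of the final congruence; it can be split off because it is a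
  unit at \<open>\<pi>\<close>.\<close>

lemma local_congruence:
  fixes \<pi> :: R and n d W M :: nat and r :: int
  defines "P \<equiv> rpoly_q (qint_poly n * cyclotomic n ^ 3)"
    and "a \<equiv> qvar powi r" and "p \<equiv> qvar ^ d"
  assumes \<pi>: "prime_elem \<pi>" "\<pi> dvd P"
    and n: "n > 1" "d \<ge> 2" "r \<in> {1, -1}" "int n = r + int d * int M" "W = M \<or> W = n - 1"
  shows "\<exists>k. \<not> \<pi> ^ Suc k dvd P \<and> (\<exists>v\<in>localization \<pi>.
      (\<Sum>k\<le>W. wp_term a p 1 1 1 cvar evar k)
      - (1 - a * p ^ M) / a ^ M / poch p p M * (1 - (1 - a * p ^ M) ^ 2 * (\<Sum>i=1..M. p ^ i / (1 - p ^ i) ^ 2))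
        * (\<Sum>k\<le>M. watson_term a p M 1 1 1 cvar evar k) = to_fract \<pi> ^ k * ((1 - qvar) * v))"
proof -
  have n0: "n > 0" using n by simp
  interpret local_subring "localization \<pi>" "to_fract \<pi>"
  proof (rule local_subring_localization[OF \<pi>(1)])
    show "(of_nat k :: R) dvd 1" if "k > 0" for k
      using that by (simp add: of_nat_poly is_unit_const_poly_iff dvd_field_iff)
  qed
  note ideal_iff = to_fract_in_ideal_iff[OF \<pi>(1)]
  define A where "A = rpoly_q (qint_poly n)"
  define B where "B = rpoly_q (cyclotomic n)"
  have P: "P = A * B ^ 3" by (simp add: P_def A_def B_def rpoly_q_mult rpoly_q_power)
  have A: "A * (qX - 1) = qX ^ n - 1"
  proof -
    have "rpoly_q (qint_poly n * unity_poly 1) = qX ^ n - 1"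
      by (simp only: qint_poly_mult rpoly_q_unity)
    thus ?thesis using rpoly_q_unity[of 1] by (simp add: rpoly_q_mult A_def)
  qed
  have Advd: "A dvd qX ^ n - 1" unfolding A[symmetric] by simp
  have Bdvd: "B dvd qX ^ n - 1" unfolding B_def rpoly_q_unity[symmetric] by (intro rpoly_q_dvd cyclotomic_dvd n0)
  have sq: "\<not> \<pi> ^ 2 dvd qX ^ n - 1" by (rule qX_square_not_dvd[OF \<pi>(1) n0])
  have "qX ^ n - 1 \<noteq> 0" using sq by auto
  hence nz: "A \<noteq> 0" "B \<noteq> 0" using Advd Bdvd by auto
  have AB: "\<pi> dvd A \<or> \<pi> dvd B"
    using \<pi> unfolding P by (auto simp: prime_elem_dvd_mult_iff dest: prime_elem_dvd_power)
  hence \<pi>n: "\<pi> dvd qX ^ n - 1"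
    using Advd Bdvd dvd_trans by blast

  define m where "m = (LEAST m. m > 0 \<and> \<pi> dvd qX ^ m - 1)"
  have m: "m > 0" "\<pi> dvd qX ^ m - 1"
    using LeastI[of "\<lambda>m. m > 0 \<and> \<pi> dvd qX ^ m - 1" n] n0 \<pi>n by (auto simp: m_def)
  have m_least: "m \<le> l" if "l > 0" "\<pi> dvd qX ^ l - 1" for l
    unfolding m_def using that by (intro Least_le) auto
  have order: "\<pi> dvd qX ^ l - 1 \<longleftrightarrow> m dvd l" for l
  proof
    assume "\<pi> dvd qX ^ l - 1"
    hence "\<pi> dvd qX ^ gcd l m - 1" using m(2) by (rule dvd_power_minus_one_gcd)
    hence "m \<le> gcd l m" using m(1) by (intro m_least) auto
    hence "gcd l m = m" using m(1) gcd_le2_nat[of m l] by linarith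
    thus "m dvd l" by (metis gcd_dvd1)
  next
    assume "m dvd l"
    thus "\<pi> dvd qX ^ l - 1" using m(2) by (meson dvd_power_minus_one_mono dvd_trans)
  qed
  have mn: "m dvd n" using order \<pi>n by blast
  hence mle: "m \<le> n" using n0 by (rule dvd_imp_le)
  \<comment> \<open>Otherwise \<open>\<pi>\<close> would divide both q^m - 1 and Phi_n, and its
    square would divide q^n - 1.\<close>
  have not_B: "\<not> \<pi> dvd B" if "m < n"
  proof
    assume "\<pi> dvd B"
    hence "\<pi> * \<pi> dvd (qX ^ m - 1) * B" using m(2) by (rule mult_dvd_mono[rotated])
    also have "(qX ^ m - 1) * B dvd qX ^ n - 1"
      unfolding B_def rpoly_q_unity[symmetric] rpoly_q_mult[symmetric]
      by (intro rpoly_q_dvd unity_poly_mult_cyclotomic_dvd mn that)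
    finally show False using sq by (simp add: power2_eq_square)
  qed
  \<comment> \<open>If \<pi> divided q - 1, it would not divide Phi_n, hence it would divide [n];
    then [n] (q - 1) = q^n - 1 would have a double factor.\<close>
  have m1: "m \<noteq> 1"
  proof
    assume m1: "m = 1"
    hence "\<not> \<pi> dvd B" using not_B n by simp
    hence "\<pi> dvd A" using AB by blast
    hence "\<pi> * \<pi> dvd A * (qX - 1)" using m(2) m1 by (intro mult_dvd_mono) auto
    thus False using sq unfolding A by (simp add: power2_eq_square)
  qed

  have qpow: "qvar ^ l - 1 = to_fract (qX ^ l - 1)" for l
    by (simp add: qvar_altdef to_fract_power)
  have q_ideal: "1 - qvar ^ l \<in> I \<longleftrightarrow> m dvd l" for l
    using I_diff_commute[of 1 "qvar ^ l"] ideal_iff[of "qX ^ l - 1"] order unfolding qpow by simp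
  have p1: "\<not> \<pi> dvd 1" using \<pi>(1) by (simp add: prime_elem_def)
  have fract_V: "to_fract x \<in> localization \<pi>" for x by (rule to_fract_in_localization[OF p1])
  have fract_U: "to_fract x \<in> U \<longleftrightarrow> \<not> \<pi> dvd x" for x
    using fract_V ideal_iff by (simp add: U_def)
  have const_U: "to_fract [:s:] \<in> U" if "s \<noteq> 0" for s
    using constant_not_dvd[OF \<pi>(1) \<pi>n n0 that] fract_U by blast
  have qV: "qvar \<in> localization \<pi>" unfolding qvar_altdef by (rule fract_V)
  have qU: "qvar \<in> U"
  proof -
    have "\<not> \<pi> dvd qX"
    proof
      assume "\<pi> dvd qX"
      hence "\<pi> dvd qX ^ m" using m(1) by (meson dvd_power dvd_trans)
      hence "\<pi> dvd qX ^ m - (qX ^ m - 1)" using m(2) by (rule dvd_diff)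
      thus False using p1 by simp
    qed
    thus ?thesis unfolding qvar_altdef fract_U .
  qed
  have q_unit: "1 - qvar ^ l \<in> U" if "\<not> m dvd l" for l
    using q_ideal that by (auto simp: U_def intro!: diff_closed one_closed power_closed qV)
  have ce: "cvar = to_fract [:[:[:0, 1:]:]:]" "evar = to_fract [:[:0, 1:]:]"
    by (simp_all add: cvar_def evar_def to_fract_def)
  have cU: "cvar \<in> U" "evar \<in> U" unfolding ce by (auto intro!: const_U)
  \<comment> \<open>If q^l were congruent to \<chi>, then \<chi>^m would be congruent to q^(l m),
    hence to 1, and \<pi> would divide the nonzero constant s^m - 1.\<close>
  have ce_unit: "1 - qvar ^ l / \<chi> \<in> U" if \<chi>: "\<chi> = to_fract [:s:]" "s \<noteq> 0" "s ^ m \<noteq> 1" for l \<chi> s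
  proof -
    have \<chi>U: "\<chi> \<in> U" unfolding \<chi>(1) by (rule const_U[OF \<chi>(2)])
    have "1 - qvar ^ l / \<chi> \<in> localization \<pi>"
      by (intro diff_closed one_closed divide_closed power_closed qV \<chi>U)
    moreover have "1 - qvar ^ l / \<chi> \<notin> I"
    proof
      assume "1 - qvar ^ l / \<chi> \<in> I"
      hence "(1 - qvar ^ l / \<chi>) * \<chi> \<in> I" by (rule I_mult[OF _ U_closed[OF \<chi>U]])
      moreover have "(1 - qvar ^ l / \<chi>) * \<chi> = \<chi> - qvar ^ l"
        using U_nonzero[OF \<chi>U] by (simp add: field_simps)
      ultimately have "\<chi> ^ m - (qvar ^ l) ^ m \<in> I"
        by (intro power_cong_I U_closed[OF \<chi>U] power_closed qV) simp
      moreover have "(qvar ^ l) ^ m - 1 \<in> I"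
        using q_ideal[of "l * m"] I_diff_commute[of 1] by (simp add: power_mult)
      ultimately have "(\<chi> ^ m - (qvar ^ l) ^ m) + ((qvar ^ l) ^ m - 1) \<in> I"
        by (rule I_add)
      hence "\<chi> ^ m - 1 \<in> I" by simp
      moreover have "\<chi> ^ m - 1 = to_fract [:s ^ m - 1:]"
      proof -
        have "[:s:] ^ m - 1 = [:s ^ m - 1:]"
          by (simp add: poly_const_pow one_pCons)
        thus ?thesis unfolding \<chi>(1) by (metis to_fract_1 to_fract_diff to_fract_power)
      qed
      ultimately have "\<pi> dvd [:s ^ m - 1:]" using ideal_iff by metis
      thus False using constant_not_dvd[OF \<pi>(1) \<pi>n n0, of "s ^ m - 1"] \<chi>(3) by simp
    qed
    ultimately show ?thesis by (simp add: U_def)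
  qed
  have c_unit: "1 - qvar ^ l / cvar \<in> U" for l
  proof (rule ce_unit[OF ce(1)])
    show "[:[:0, 1::rat:]:] ^ m \<noteq> 1"
      using X_power_neq_1[OF m(1), where 'a = rat] by (simp add: poly_const_pow one_pCons)
  qed simp
  have e_unit: "1 - qvar ^ l / evar \<in> U" for l
    by (rule ce_unit[OF ce(2) _ X_power_neq_1[OF m(1)]]) simp

  have aU: "a \<in> U" using n(3) qU by (auto simp: a_def power_int_minus U_inverse)
  have pU: "p \<in> U" unfolding p_def by (intro U_power qU)
  have p_pow: "p ^ l = qvar ^ (d * l)" for l by (simp add: p_def power_mult)
  have ap_pow: "a * p ^ l = qvar powi (r + int d * int l)" for l
  proof -
    have "qvar powi (r + int d * int l) = qvar powi r * qvar powi (int (d * l))"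
      by (simp add: power_int_add)
    thus ?thesis unfolding a_def p_pow by (simp only: power_int_of_nat)
  qed
  have apM: "a * p ^ M = qvar ^ n"
    unfolding ap_pow n(4)[symmetric] by simp
  have an: "a * p ^ i \<noteq> 1" for i
  proof
    assume "a * p ^ i = 1"
    hence "int d * int i = - r" unfolding ap_pow qvar_powi_eq_1_iff by simp
    hence "int d dvd 1" using n(3) by (metis dvd_minus_iff dvd_triv_left insertE minus_minus singletonD)
    thus False using n(2) by simp
  qed
  \<comment> \<open>A common divisor of n and d divides r. Hence p = q^d has the same order m modulo
    \<pi> as q.\<close>
  have cop: "coprime n d"
  proof (rule coprimeI)
    fix k assume "k dvd n" "k dvd d"
    hence "int k dvd int n - int d * int M" by (intro dvd_diff dvd_mult2) auto
    hence "int k dvd r" using n(4) by simp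
    hence "int k dvd 1" using n(3) by auto
    thus "is_unit k" by simp
  qed
  hence copm: "coprime m d" using mn by (meson coprime_divisors dvd_refl)
  have m_dvd: "m dvd d * l \<longleftrightarrow> m dvd l" for l
    using copm by (simp add: coprime_dvd_mult_right_iff)
  have MW: "M \<le> W" "W \<le> n - 1"
  proof -
    have "M \<le> n - 1"
    proof (rule ccontr)
      assume "\<not> M \<le> n - 1"
      hence "n \<le> M" using n by simp
      hence "2 * int n \<le> int d * int M" using n(2) by (intro mult_mono) auto
      hence "2 * int n \<le> int n - r" using n(4) by linarith
      moreover have "- 1 \<le> r" using n(3) by auto
      ultimately show False using n(1) by linarith
    qed
    thus "M \<le> W" "W \<le> n - 1" using n(5) by auto
  qed
  have q1U: "1 - qvar \<in> U" using q_unit[of 1] m1 by simp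
  have scale: "\<exists>v\<in>localization \<pi>. D = x * ((1 - qvar) * v)" if "\<exists>v\<in>localization \<pi>. D = x * v" for D x
  proof -
    from that obtain v where "v \<in> localization \<pi>" "D = x * v" by blast
    thus ?thesis using U_nonzero[OF q1U]
      by (intro bexI[of _ "v / (1 - qvar)"] divide_closed q1U) auto
  qed

  show ?thesis
  proof (cases "m = n")
    case True
    have adm: "admissible p W \<chi>" if "\<chi> \<in> U" "\<And>l. \<not> m dvd l \<Longrightarrow> 1 - qvar ^ l / \<chi> \<in> U" for \<chi>
      unfolding admissible_def
    proof (intro conjI ballI that(1))
      fix l assume "l \<in> {1..W}"
      hence "\<not> m dvd l" using MW True n by (auto dest!: dvd_imp_le)
      thus "1 - p ^ l / \<chi> \<in> U" unfolding p_pow using m_dvd by (intro that(2)) simp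
    qed
    have "1 - a * p ^ M \<in> I" unfolding apM q_ideal by (rule mn)
    hence "\<exists>v\<in>localization \<pi>. (\<Sum>k\<le>W. wp_term a p 1 1 1 cvar evar k)
      - (1 - a * p ^ M) / a ^ M / poch p p M * (1 - (1 - a * p ^ M) ^ 2 * (\<Sum>i=1..M. p ^ i / (1 - p ^ i) ^ 2))
        * (\<Sum>k\<le>M. watson_term a p M 1 1 1 cvar evar k) = to_fract \<pi> ^ 4 * v"
      using q_unit c_unit e_unit
      by (intro sum_wp_term_cong_fourth_power aU pU adm one_U cU MW an) simp_all
    moreover have "\<not> \<pi> ^ Suc 4 dvd P"
    proof
      assume *: "\<pi> ^ Suc 4 dvd P"
      \<comment> \<open>\<open>A\<close> and \<open>B\<close> both divide the squarefree q^n - 1, so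
        the multiplicity of \<pi> in A B^3 is at most 1 + 3.\<close>
      have mult1: "multiplicity \<pi> x \<le> 1" if "x dvd qX ^ n - 1" for x
      proof -
        have "\<not> \<pi> ^ 2 dvd x" using that sq by (meson dvd_trans)
        moreover have "x \<noteq> 0" using that sq by auto
        moreover have "\<not> is_unit \<pi>" using \<pi>(1) by (simp add: prime_elem_def)
        ultimately have "multiplicity \<pi> x < 2" by (intro multiplicity_lessI)
        thus ?thesis by simp
      qed
      have "multiplicity \<pi> P = multiplicity \<pi> A + 3 * multiplicity \<pi> B"
        using nz \<pi>(1) unfolding P
        by (simp add: prime_elem_multiplicity_mult_distrib prime_elem_multiplicity_power_distrib)
      hence "multiplicity \<pi> P \<le> 4" using mult1[OF Advd] mult1[OF Bdvd] by simp
      moreover have "Suc 4 \<le> multiplicity \<pi> P"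
        using * nz \<pi>(1) unfolding P by (intro multiplicity_geI) (auto simp: prime_elem_def)
      ultimately show False by simp
    qed
    ultimately show ?thesis by (intro exI[of _ 4] conjI scale)
  next
    case False
    hence lt: "m < n" using mle by simp
    define \<theta> where "\<theta> = 1 - qvar ^ m"
    have \<theta>: "\<theta> \<in> I" "\<theta> \<noteq> 0" "\<theta> \<in> localization \<pi>"
      using q_ideal[of m] qvar_power_neq_1[OF m(1)] I_closed by (auto simp: \<theta>_def)
    have geom: "1 - qvar ^ (m * k) = \<theta> * (\<Sum>i<k. (qvar ^ m) ^ i)" for k
      unfolding \<theta>_def power_mult by (rule one_diff_power_eq)
    have geomV: "(\<Sum>i<k. (qvar ^ m) ^ i) \<in> localization \<pi>" for k
      by (intro sum_closed power_closed qV)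
    have theta_nat: "\<exists>v\<in>localization \<pi>. 1 - qvar ^ l = \<theta> * v" if "m dvd l" for l
      using that geom geomV by (auto elim!: dvdE)
    \<comment> \<open>The cofactor is a geometric sum of k terms congruent to 1; its residue k is
      nonzero in characteristic zero.\<close>
    have theta_unit: "\<exists>w\<in>U. 1 - qvar ^ l = \<theta> * w" if "m dvd l" "l > 0" for l
    proof -
      from that obtain k where k: "l = m * k" "k > 0" by (auto elim!: dvdE)
      have "(\<Sum>i<k. 1 - (qvar ^ m) ^ i) \<in> I"
        using q_ideal by (intro I_sum) (auto simp flip: power_mult)
      moreover have "(\<Sum>i<k. 1 - (qvar ^ m) ^ i) = of_nat k - (\<Sum>i<k. (qvar ^ m) ^ i)"
        by (simp add: sum_subtractf)
      ultimately have "(\<Sum>i<k. (qvar ^ m) ^ i) \<in> U"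
        using U_cong[OF of_nat_U[OF k(2)]] by metis
      thus ?thesis using geom k(1) by blast
    qed
    \<comment> \<open>Integer exponents are allowed because \<open>2 * r + int d * int j\<close> is
      negative for r = -1 and j = 0.\<close>
    have theta_int: "\<exists>v\<in>localization \<pi>. 1 - qvar powi z = \<theta> * v" if "int m dvd z" for z
    proof (cases "z \<ge> 0")
      case True
      then obtain l where "z = int l" by (metis nonneg_int_cases)
      thus ?thesis using theta_nat[of l] that by simp
    next
      case False
      define l where "l = nat (- z)"
      have z: "z = - int l" using False by (simp add: l_def)
      obtain v where v: "v \<in> localization \<pi>" "1 - qvar ^ l = \<theta> * v"
        using theta_nat[of l] \<open>int m dvd z\<close> by (auto simp: z)
      have "1 - qvar powi z = (1 - qvar ^ l) * - inverse (qvar ^ l)"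
        by (simp add: z power_int_minus field_simps)
      also have "\<dots> = \<theta> * (v * - inverse (qvar ^ l))" by (simp add: v)
      finally show ?thesis
        by (intro bexI[of _ "v * - inverse (qvar ^ l)"] mult_closed uminus_closed inverse_closed' U_power qU v)
    qed
    define M0 where "M0 = M mod m"
    have mz: "int m dvd r + int d * int j" if "j mod m = M0" for j
    proof -
      have *: "int m dvd int M - int j"
        using that unfolding M0_def by (metis mod_eq_dvd_iff of_nat_mod)
      have "int m dvd int n" using mn by simp
      hence "int m dvd int n - int d * (int M - int j)"
        by (rule dvd_diff[OF _ dvd_mult[OF *]])
      thus ?thesis using n(4) by (simp add: algebra_simps)
    qed
    have mz2: "int m dvd 2 * r + int d * int j" if "j mod m = (2 * M0) mod m" for j
    proof -
      have "j mod m = (2 * M) mod m"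
        using that unfolding M0_def by (simp add: mod_mult_right_eq)
      hence *: "int m dvd int (2 * M) - int j"
        by (metis mod_eq_dvd_iff of_nat_mod)
      have "int m dvd 2 * int n" using mn by simp
      hence "int m dvd 2 * int n - int d * (int (2 * M) - int j)"
        by (rule dvd_diff[OF _ dvd_mult[OF *]])
      thus ?thesis using n(4) by (simp add: algebra_simps)
    qed
    have a2: "a ^ 2 * p ^ j = qvar powi (2 * r + int d * int j)" for j
    proof -
      have "qvar powi (2 * r + int d * int j) = qvar powi (r * 2) * qvar powi (int (d * j))"
        by (simp add: power_int_add mult.commute)
      thus ?thesis unfolding a_def p_pow by (simp only: power_int_of_nat) (simp add: power_int_mult)
    qed
    \<comment> \<open>For W = n - 1 all blocks are complete since m divides n; for W = M the last
      one stops at index \<open>M0\<close>.\<close>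
    have Wm: "Suc W = (n div m) * m \<or> W = (M div m) * m + M0"
      using n(5) mn n0 by (auto simp: M0_def)
    then obtain N where N: "Suc W = N * m \<or> W = N * m + M0" by blast
    have "\<exists>v\<in>localization \<pi>. (\<Sum>k\<le>W. wp_term a p 1 1 1 cvar evar k)
      - (1 - a * p ^ M) / a ^ M / poch p p M * (1 - (1 - a * p ^ M) ^ 2 * (\<Sum>i=1..M. p ^ i / (1 - p ^ i) ^ 2))
        * (\<Sum>k\<le>M. watson_term a p M 1 1 1 cvar evar k) = to_fract \<pi> * v"
    proof (rule sum_wp_term_cong_first_power[OF aU pU cU _ \<theta>(1,2) _ _ _ _ _ _ N])
      show "M0 < m" using m(1) by (simp add: M0_def)
      show "1 - p ^ j \<in> U" if "\<not> m dvd j" for j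
        unfolding p_pow using that m_dvd by (intro q_unit) simp
      show "\<exists>w\<in>U. 1 - p ^ j = \<theta> * w" if "m dvd j" "j > 0" for j
        unfolding p_pow using that m_dvd n(2) by (intro theta_unit) auto
      show "\<exists>v\<in>localization \<pi>. 1 - a * p ^ j = \<theta> * v" if "j mod m = M0" for j
        unfolding ap_pow by (intro theta_int mz that)
      show "\<exists>v\<in>localization \<pi>. 1 - a ^ 2 * p ^ j = \<theta> * v" if "j mod m = (2 * M0) mod m" for j
        unfolding a2 by (intro theta_int mz2 that)
      show "1 - p ^ l / cvar \<in> U" "1 - p ^ l / evar \<in> U" for l
        unfolding p_pow by (rule c_unit, rule e_unit)
      show "M mod m = M0" by (simp add: M0_def)
    qed
    hence "\<exists>v\<in>localization \<pi>. (\<Sum>k\<le>W. wp_term a p 1 1 1 cvar evar k)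
      - (1 - a * p ^ M) / a ^ M / poch p p M * (1 - (1 - a * p ^ M) ^ 2 * (\<Sum>i=1..M. p ^ i / (1 - p ^ i) ^ 2))
        * (\<Sum>k\<le>M. watson_term a p M 1 1 1 cvar evar k) = to_fract \<pi> ^ 1 * v"
      by simp
    moreover have "\<not> \<pi> ^ Suc 1 dvd P"
    proof
      assume "\<pi> ^ Suc 1 dvd P"
      hence "\<pi> ^ 2 dvd B ^ 3 * A" unfolding P by (simp add: numeral_2_eq_2 mult.commute)
      moreover have "\<not> \<pi> dvd B ^ 3" using not_B[OF lt] \<pi>(1) by (meson prime_elem_dvd_power)
      ultimately have "\<pi> ^ 2 dvd A" using prime_power_dvd_multD[OF \<pi>(1), of 2 "B ^ 3" A] by simp
      thus False using sq Advd by (meson dvd_trans)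
    qed
    ultimately show ?thesis by (intro exI[of _ 1] conjI scale)
  qed
qed

theorem theorem3p1:
  fixes n d W :: nat and r :: int
  assumes "n > 1" and "d \<ge> 2" and "r \<in> {1, -1}"
    and "int n mod int d = r mod int d"
    and "W = nat ((int n - r) div int d) \<or> W = n - 1"
  shows "qcong
    (\<Sum>k=0..W. qint (2 * int d * int k + r)
        * qpoch (qvar powi r) (qvar ^ d) k ^ 4
        * qpoch (cvar * qvar powi r) (qvar ^ d) k * qpoch (evar * qvar powi r) (qvar ^ d) k
        / (qpoch (qvar ^ d) (qvar ^ d) k ^ 4
           * qpoch (qvar ^ d / cvar) (qvar ^ d) k * qpoch (qvar ^ d / evar) (qvar ^ d) k)
        * inverse ((cvar * evar) ^ k) * qvar powi ((2 * int d - 3 * r) * int k))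
    (let M = nat ((int n - r) div int d) in
      qint (int n) * qvar powi ((r * (r - int n)) div int d) / qpoch (qvar ^ d) (qvar ^ d) M
      * (1 - qint (int n) ^ 2 * (\<Sum>i=1..M. qvar ^ (d * i) / qint (int (d * i)) ^ 2))
      * (\<Sum>k=0..M. qpoch (qvar powi (2 * r + int d * int k)) (qvar ^ d) (M - k)
           * qpoch (qvar powi (int d - r) / (cvar * evar)) (qvar ^ d) k
           * qpoch (qvar powi r) (qvar ^ d) k ^ 3
           / (qpoch (qvar ^ d / cvar) (qvar ^ d) k * qpoch (qvar ^ d / evar) (qvar ^ d) k
              * qpoch (qvar ^ d) (qvar ^ d) k)
           * qvar ^ (d * k)))
    (rpoly_q (qint_poly n * cyclotomic n ^ 3))"
proof -
  define M where "M = nat ((int n - r) div int d)"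
  have "int d dvd int n - r" using assms(4) by (simp add: mod_eq_dvd_iff)
  moreover have "(int n - r) div int d \<ge> 0" using assms(1-3) by (intro pos_imp_zdiv_nonneg_iff[THEN iffD2]) auto
  ultimately have nM: "int n = r + int d * int M" by (auto simp: M_def)
  have d: "d > 0" using assms(2) by simp
  have q1: "1 - qvar \<noteq> 0" using qvar_power_neq_1[of 1] by auto
  have "rpoly_q (qint_poly n * cyclotomic n ^ 3) \<noteq> 0"
  proof
    assume "rpoly_q (qint_poly n * cyclotomic n ^ 3) = 0"
    hence "qint_poly n = 0 \<or> cyclotomic n = 0" by (auto dest: rpoly_q_eq_0)
    hence "unity_poly n = 0"
      using unity_poly_eq_prod[of n] qint_poly_mult[of n] assms(1) by auto
    thus False using unity_poly_nonzero[of n] assms(1) by simp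
  qed
  moreover have "\<exists>k. \<not> \<pi> ^ Suc k dvd rpoly_q (qint_poly n * cyclotomic n ^ 3) \<and>
     (\<exists>v\<in>localization \<pi>. (\<Sum>k\<le>W. wp_term (qvar powi r) (qvar ^ d) 1 1 1 cvar evar k / (1 - qvar))
      - (let a = qvar powi r; p = qvar ^ d in
        ((1 - a * p ^ M) / a ^ M / poch p p M * (1 - (1 - a * p ^ M) ^ 2 * (\<Sum>i=1..M. p ^ i / (1 - p ^ i) ^ 2))
        * (\<Sum>k\<le>M. watson_term a p M 1 1 1 cvar evar k)) / (1 - qvar)) = to_fract \<pi> ^ k * v)"
    if \<pi>: "prime_elem \<pi>" "\<pi> dvd rpoly_q (qint_poly n * cyclotomic n ^ 3)" for \<pi>
  proof -
    have eq: "x / (1 - qvar) - y / (1 - qvar) = s * v" if "x - y = s * ((1 - qvar) * v)" for x y s v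
      using that q1 by (simp add: diff_divide_distrib[symmetric])
    show ?thesis
      using local_congruence[OF \<pi> assms(1-3) nM assms(5)[folded M_def]]
      unfolding Let_def sum_divide_distrib[symmetric] by (blast intro: eq)
  qed
  ultimately show ?thesis
    unfolding wp_term_eq_summand M_def[symmetric] Let_def watson_side_eq[OF nM d, unfolded Let_def]
    unfolding atMost_atLeast0[symmetric] by (rule qcong_by_primes)
qed

end
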